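(* On $\mathbb{R}^d$ let $c(x,y)=\|x-y\|^2$ and let $\varepsilon>0$. Let $\mu_0,\mu_1\in\mathcal{P}(\mathbb{R}^d)$ have bounded support, means $m_0,m_1\in\mathbb{R}^d$ and centered measures $\bar\mu_i=(\mathrm{id}-m_i)_\#\mu_i$, $i=0,1$. Then $$\mathsf{d}_S(\mu_0,\mu_1)^2=\|m_1-m_0\|^2+\mathsf{d}_S(\bar\mu_0,\bar\mu_1)^2 .$$ In particular $\mathsf{d}_S(\mu_0,\mu_1)\ge\|m_1-m_0\|$ with equality if and only if $\mu_1$ is a translation of $\mu_0$. In this case $\mu_t=(\mathrm{id}+t(m_1-m_0))_\#\mu_0$, $t\in[0,1]$, is the unique geodesic between them.
   Context: $\mathcal{P}(\mathbb{R}^d)$: Borel probability measures; $T_\#\mu$ is the pushforward. For $\mu$ with bounded support, $f_{\mu,\mu}$ is the unique continuous function on $\mathbb{R}^d$ with $\int\exp\left(\frac1\varepsilon(f_{\mu,\mu}(x)+f_{\mu,\mu}(y)-c(x,y))\right)d\mu(x)=1$ for all $y\in\mathbb{R}^d$; $a_\mu=\exp(f_{\mu,\mu}/\varepsilon)$; $k_c(x,y)=\exp(-\|x-y\|^2/\varepsilon)$; $k_\mu(x,y)=a_\mu(x)a_\mu(y)k_c(x,y)$; $K_\mu[\phi](y)=\int\phi(x)k_\mu(x,y)\,d\mu(x)$. $\mathcal{H}_c$ is the reproducing kernel Hilbert space of $k_c$ on $\mathbb{R}^d$ and $B(\mu)=\int a_\mu(x)k_c(x,\cdot)\,d\mu(x)=\exp(-f_{\mu,\mu}/\varepsilon)\in\mathcal{H}_c$.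 For $\dot\beta\in\mathcal{H}_c$ with $\langle B(\mu),\dot\beta\rangle_{\mathcal{H}_c}=0$ (equivalently $\int a_\mu\dot\beta\,d\mu=0$), $$\tilde{\mathbf{g}}_\mu(\dot\beta,\dot\beta)=\frac\varepsilon2\left(\|\dot\beta\|_{\mathcal{H}_c}^2+2\left\langle a_\mu\dot\beta,(\mathrm{id}-K_\mu)^{-1}[a_\mu\dot\beta]\right\rangle_{L^2(\mu)}\right),$$ with the inverse taken on $L^2(\mu)/\mathbb{R}$ (quotient by constants), where $\mathrm{id}-K_\mu$ is boundedly invertible. A path $(\mu_t)_{t\in[0,1]}$ of probability measures, all supported in a common bounded set, is admissible if $(\beta_t)_t=(B(\mu_t))_t$ belongs to the Sobolev space $H^1((0,1);\mathcal{H}_c)$ ($L^2$ functions with distributional derivative $\dot\beta$ in $L^2$; continuous representative on $[0,1]$). Its energy is $E((\mu_t)_t)=\int_0^1\tilde{\mathbf{g}}_{\mu_t}(\dot\beta_t,\dot\beta_t)\,dt$. $\mathsf{d}_S(\mu_0,\mu_1)=(\inf E)^{1/2}$, the infimum over admissible paths from $\mu_0$ to $\mu_1$; a geodesic is an admissible path attaining the infimum. *)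

theory Defs
  imports "HOL-Probability.Probability"
begin

section \<open>Measures\<close>

definition borel_prob :: "'a::euclidean_space measure \<Rightarrow> bool" where
  "borel_prob \<mu> \<longleftrightarrow> prob_space \<mu> \<and> sets \<mu> = sets borel"

definition bounded_support :: "'a::euclidean_space measure \<Rightarrow> bool" where
  "bounded_support \<mu> \<longleftrightarrow> (\<exists>S. bounded S \<and> (AE x in \<mu>. x \<in> S))"

definition in_L2 :: "'x measure \<Rightarrow> ('x \<Rightarrow> real) \<Rightarrow> bool" where
  "in_L2 M f \<longleftrightarrow> f \<in> borel_measurable M \<and> integrable M (\<lambda>x. (f x)\<^sup>2)"


section \<open>The self-transport potential and the operator \<open>K\<^sub>\<mu>\<close>\<close>

definition cost :: "'a::euclidean_space \<Rightarrow> 'a \<Rightarrow> real" where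
  "cost x y = (norm (x - y))\<^sup>2"

definition potential :: "real \<Rightarrow> 'a::euclidean_space measure \<Rightarrow> 'a \<Rightarrow> real" where
  "potential \<epsilon> \<mu> = (THE f. continuous_on UNIV f \<and>
     (\<forall>y. (LINT x|\<mu>. exp ((f x + f y - cost x y) / \<epsilon>)) = 1))"

definition a_fun :: "real \<Rightarrow> 'a::euclidean_space measure \<Rightarrow> 'a \<Rightarrow> real" where
  "a_fun \<epsilon> \<mu> x = exp (potential \<epsilon> \<mu> x / \<epsilon>)"

definition k_c :: "real \<Rightarrow> 'a::euclidean_space \<Rightarrow> 'a \<Rightarrow> real" where
  "k_c \<epsilon> x y = exp (- cost x y / \<epsilon>)"

definition k_mu :: "real \<Rightarrow> 'a::euclidean_space measure \<Rightarrow> 'a \<Rightarrow> 'a \<Rightarrow> real" where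
  "k_mu \<epsilon> \<mu> x y = a_fun \<epsilon> \<mu> x * a_fun \<epsilon> \<mu> y * k_c \<epsilon> x y"

definition K_op :: "real \<Rightarrow> 'a::euclidean_space measure \<Rightarrow> ('a \<Rightarrow> real) \<Rightarrow> 'a \<Rightarrow> real" where
  "K_op \<epsilon> \<mu> \<phi> y = (LINT x|\<mu>. \<phi> x * k_mu \<epsilon> \<mu> x y)"

text \<open>A representative \<open>\<psi>\<close> of the class \<open>(id - K\<^sub>\<mu>)\<^sup>-\<^sup>1[\<phi>]\<close> in the quotient of \<open>L\<^sup>2(\<mu>)\<close> by the
  constants: \<open>(id - K\<^sub>\<mu>) \<psi>\<close> and \<open>\<phi>\<close> agree in the quotient.  It is determined up to an additive
  constant (and null sets), which does not affect its \<open>L\<^sup>2(\<mu>)\<close> pairing with functions of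
  \<open>\<mu>\<close>-mean zero.\<close>

definition id_minus_K_inverse ::
    "real \<Rightarrow> 'a::euclidean_space measure \<Rightarrow> ('a \<Rightarrow> real) \<Rightarrow> 'a \<Rightarrow> real" where
  "id_minus_K_inverse \<epsilon> \<mu> \<phi> =
     (SOME \<psi>. in_L2 \<mu> \<psi> \<and> (\<exists>c. AE y in \<mu>. \<psi> y - K_op \<epsilon> \<mu> \<psi> y = \<phi> y + c))"


section \<open>Reproducing kernel Hilbert spaces\<close>

text \<open>A Hilbert space of functions is given by a complete inner product space \<open>'h\<close> together with
  an injective linear map \<open>evl\<close> identifying its elements with functions; it is the reproducing
  kernel Hilbert space of \<open>k\<close> if every \<open>k x\<close> belongs to it and represents evaluation at \<open>x\<close>.
  These conditions determine the function space and its inner product.  In the definitions and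
  results below, \<open>'h\<close> is also of class \<open>second_countable_topology\<close>, as the Bochner integral
  requires; this is no restriction, since the space of the Gaussian kernel is separable.\<close>

definition is_rkhs :: "('h::{real_inner,banach} \<Rightarrow> 'x \<Rightarrow> real) \<Rightarrow> ('x \<Rightarrow> 'x \<Rightarrow> real) \<Rightarrow> bool" where
  "is_rkhs evl k \<longleftrightarrow>
     (\<forall>x. linear (\<lambda>h. evl h x)) \<and> inj evl \<and>
     (\<forall>x. \<exists>h. evl h = k x \<and> (\<forall>g. inner g h = evl g x))"

definition B_map :: "real \<Rightarrow> ('h::{real_inner,banach,second_countable_topology} \<Rightarrow>
    'a::euclidean_space \<Rightarrow> real) \<Rightarrow> 'a measure \<Rightarrow> 'h" where
  "B_map \<epsilon> evl \<mu> = (LINT x|\<mu>. a_fun \<epsilon> \<mu> x *\<^sub>R (THE h. evl h = k_c \<epsilon> x))"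

text \<open>The metric tensor, meaningful for \<open>h\<close> orthogonal to \<open>B(\<mu>)\<close>, so that \<open>a\<^sub>\<mu> h\<close> has \<open>\<mu>\<close>-mean zero.
  Along admissible paths the derivative satisfies this for almost every time, because
  \<open>B(\<mu>)\<close> always has norm 1.\<close>

definition g_tilde :: "real \<Rightarrow> ('h::{real_inner,banach,second_countable_topology} \<Rightarrow>
    'a::euclidean_space \<Rightarrow> real) \<Rightarrow> 'a measure \<Rightarrow> 'h \<Rightarrow> real" where
  "g_tilde \<epsilon> evl \<mu> h =
     (let \<phi> = (\<lambda>x. a_fun \<epsilon> \<mu> x * evl h x)
      in \<epsilon> / 2 * ((norm h)\<^sup>2 + 2 * (LINT x|\<mu>. \<phi> x * id_minus_K_inverse \<epsilon> \<mu> \<phi> x)))"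


section \<open>Sobolev paths\<close>

definition test_function :: "(real \<Rightarrow> real) \<Rightarrow> bool" where
  "test_function \<phi> \<longleftrightarrow>
     (\<forall>n. ((deriv ^^ n) \<phi>) differentiable_on UNIV) \<and>
     (\<exists>a b. 0 < a \<and> b < 1 \<and> (\<forall>t. t \<notin> {a..b} \<longrightarrow> \<phi> t = 0))"

definition L2_path :: "(real \<Rightarrow> 'h::{real_inner,banach,second_countable_topology}) \<Rightarrow> bool" where
  "L2_path v \<longleftrightarrow> set_borel_measurable lborel {0<..<1} v \<and>
     set_integrable lborel {0<..<1} (\<lambda>t. (norm (v t))\<^sup>2)"

definition L2_weak_derivative ::
    "(real \<Rightarrow> 'h::{real_inner,banach,second_countable_topology}) \<Rightarrow> (real \<Rightarrow> 'h) \<Rightarrow> bool" where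
  "L2_weak_derivative \<beta> v \<longleftrightarrow> L2_path v \<and>
     (\<forall>\<phi>. test_function \<phi> \<longrightarrow>
        (LINT t:{0<..<1}|lborel. deriv \<phi> t *\<^sub>R \<beta> t) = - (LINT t:{0<..<1}|lborel. \<phi> t *\<^sub>R v t))"

definition weak_deriv ::
    "(real \<Rightarrow> 'h::{real_inner,banach,second_countable_topology}) \<Rightarrow> real \<Rightarrow> 'h" where
  "weak_deriv \<beta> = (SOME v. L2_weak_derivative \<beta> v)"

text \<open>Membership in \<open>H\<^sup>1((0,1); 'h)\<close> for a path given at every time in \<open>[0,1]\<close>: the path itself is
  required to be the continuous representative, so that its values at the endpoints (and at
  every single time) are meaningful.\<close>

definition H1_path :: "(real \<Rightarrow> 'h::{real_inner,banach,second_countable_topology}) \<Rightarrow> bool" where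
  "H1_path \<beta> \<longleftrightarrow> L2_path \<beta> \<and> (\<exists>v. L2_weak_derivative \<beta> v) \<and> continuous_on {0..1} \<beta>"


section \<open>The distance and its geodesics\<close>

definition admissible :: "real \<Rightarrow> ('h::{real_inner,banach,second_countable_topology} \<Rightarrow>
    'a::euclidean_space \<Rightarrow> real) \<Rightarrow> (real \<Rightarrow> 'a measure) \<Rightarrow> bool" where
  "admissible \<epsilon> evl \<mu> \<longleftrightarrow>
     (\<forall>t\<in>{0..1}. borel_prob (\<mu> t)) \<and>
     (\<exists>S. bounded S \<and> (\<forall>t\<in>{0..1}. AE x in \<mu> t. x \<in> S)) \<and>
     H1_path (\<lambda>t. B_map \<epsilon> evl (\<mu> t))"

definition energy :: "real \<Rightarrow> ('h::{real_inner,banach,second_countable_topology} \<Rightarrow>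
    'a::euclidean_space \<Rightarrow> real) \<Rightarrow> (real \<Rightarrow> 'a measure) \<Rightarrow> ennreal" where
  "energy \<epsilon> evl \<mu> =
     (\<integral>\<^sup>+t\<in>{0<..<1}.
        ennreal (g_tilde \<epsilon> evl (\<mu> t) (weak_deriv (\<lambda>s. B_map \<epsilon> evl (\<mu> s)) t)) \<partial>lborel)"

definition admissible_between :: "real \<Rightarrow> ('h::{real_inner,banach,second_countable_topology} \<Rightarrow>
    'a::euclidean_space \<Rightarrow> real) \<Rightarrow> 'a measure \<Rightarrow> 'a measure \<Rightarrow> (real \<Rightarrow> 'a measure) set" where
  "admissible_between \<epsilon> evl \<mu>\<^sub>0 \<mu>\<^sub>1 = {\<mu>. admissible \<epsilon> evl \<mu> \<and> \<mu> 0 = \<mu>\<^sub>0 \<and> \<mu> 1 = \<mu>\<^sub>1}"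

definition ennreal_sqrt :: "ennreal \<Rightarrow> ennreal" where
  "ennreal_sqrt z = (if z = \<infinity> then \<infinity> else ennreal (sqrt (enn2real z)))"

text \<open>Valued in \<open>[0,\<infinity>]\<close>, with the infimum over an empty set of paths equal to \<open>\<infinity>\<close>.\<close>

definition d_S :: "real \<Rightarrow> ('h::{real_inner,banach,second_countable_topology} \<Rightarrow>
    'a::euclidean_space \<Rightarrow> real) \<Rightarrow> 'a measure \<Rightarrow> 'a measure \<Rightarrow> ennreal" where
  "d_S \<epsilon> evl \<mu>\<^sub>0 \<mu>\<^sub>1 = ennreal_sqrt (INF \<mu>\<in>admissible_between \<epsilon> evl \<mu>\<^sub>0 \<mu>\<^sub>1. energy \<epsilon> evl \<mu>)"

definition is_geodesic :: "real \<Rightarrow> ('h::{real_inner,banach,second_countable_topology} \<Rightarrow>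
    'a::euclidean_space \<Rightarrow> real) \<Rightarrow> 'a measure \<Rightarrow> 'a measure \<Rightarrow> (real \<Rightarrow> 'a measure) \<Rightarrow> bool" where
  "is_geodesic \<epsilon> evl \<mu>\<^sub>0 \<mu>\<^sub>1 \<mu> \<longleftrightarrow>
     \<mu> \<in> admissible_between \<epsilon> evl \<mu>\<^sub>0 \<mu>\<^sub>1 \<and>
     energy \<epsilon> evl \<mu> = (INF \<nu>\<in>admissible_between \<epsilon> evl \<mu>\<^sub>0 \<mu>\<^sub>1. energy \<epsilon> evl \<nu>)"

end

theory Submission
  imports Defs
begin

text \<open>
  Translating a path \<open>\<mu>\<^sub>t\<close> by \<open>p + t w\<close> acts on \<open>\<beta>\<^sub>t = B(\<mu>\<^sub>t)\<close> by the unitary group of translations, so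
  up to this unitary the new velocity is \<open>\<beta>\<^sub>t' + \<Gamma>\<close> with \<open>\<Gamma> = - w \<cdot> \<nabla>\<beta>\<^sub>t\<close>.  In the Hilbert space the
  metric tensor is \<open>\<epsilon>/2 \<langle>h, (1 + T) (1 - T)\<^sup>-\<^sup>1 h\<rangle>\<close>, where \<open>T h\<close> embeds \<open>a\<^sup>2 h \<mu>\<close> and is a contraction on
  the complement of \<open>B(\<mu>)\<close>.  For \<open>h = \<Gamma>\<close> the resolvent is explicit: \<open>(1 - T) N = \<epsilon>/2 \<Gamma>\<close> for the product \<open>N\<close>
  of \<open>B(\<mu>)\<close> with the linear function \<open>x \<mapsto> w \<cdot> x\<close>.  Hence the cross term is \<open>2 \<langle>N + T N, \<beta>\<^sub>t'\<rangle>\<close>, which is twice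
  the derivative of \<open>w \<cdot> m(\<mu>\<^sub>t)\<close>, and the energy changes by exactly \<open>2 w \<cdot> (m(\<mu>\<^sub>1) - m(\<mu>\<^sub>0)) + |w|\<^sup>2\<close>.
  Centering a path linearly in time is therefore a bijection of admissible paths lowering the energy by
  \<open>|m\<^sub>1 - m\<^sub>0|\<^sup>2\<close>.  The equality case and uniqueness follow as paths of zero energy have constant \<open>B(\<mu>\<^sub>t)\<close>
  and \<open>B\<close> is injective.
\<close>

section \<open>The Gaussian reproducing kernel Hilbert space\<close>

text \<open>Two obstacles shape the proof. The translation group is strongly but not norm
  continuous, so a path shifted by a moving vector cannot be differentiated by a product rule in the
  Hilbert space. Its increments are tested against kernel functions instead: the motion passes to
  the kernel functions, which depend smoothly on their base point. Moreover, only
  \<open>\<beta>\<close> is known to be regular in time. The fields \<open>M\<close>,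
  \<open>N\<close> and \<open>\<Gamma>\<close> along a path are merely shown to be continuous, by
  interpolating between uniform bounds and the continuity of \<open>\<beta>\<close>. This suffices
  because the mean obeys an exact difference identity, \<open>inner w (m t - m s) = inner (M t + N
  s) (\<beta> t - \<beta> s)\<close>, in which the two times are mixed so that the off-diagonal
  terms cancel; summing over fine partitions then yields the derivative of the mean without
  differentiating \<open>M\<close> or \<open>N\<close>. The squared norm of \<open>w\<close> in the
  result comes from the Leibniz rule applied to the linear factor of \<open>N\<close>.\<close>

locale gaussian_rkhs =
  fixes \<epsilon> :: real
    and evl :: "'h::{real_inner,banach,second_countable_topology} \<Rightarrow> 'a::euclidean_space \<Rightarrow> real"
  assumes eps_pos: "\<epsilon> > 0"
    and rkhs: "is_rkhs evl (k_c \<epsilon>)"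
begin

definition kx :: "'a \<Rightarrow> 'h" where
  "kx x = (THE h. evl h = k_c \<epsilon> x)"

lemma inj_evl: "inj evl"
  using rkhs by (simp add: is_rkhs_def)

lemma evl_ext: "(\<And>x. evl g x = evl h x) \<Longrightarrow> g = h"
  by (rule injD [OF inj_evl]) (rule ext)

lemma evl_kx: "evl (kx x) = k_c \<epsilon> x"
proof -
  have "\<exists>h. evl h = k_c \<epsilon> x"
    using rkhs by (metis is_rkhs_def)
  then have "\<exists>!h. evl h = k_c \<epsilon> x"
    using inj_evl by (metis injD)
  then show ?thesis
    unfolding kx_def by (rule theI')
qed

lemma evl_eq_inner: "evl g x = inner g (kx x)"
proof -
  obtain h where "evl h = k_c \<epsilon> x" "\<forall>g. inner g h = evl g x"
    using rkhs by (metis is_rkhs_def)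
  then show ?thesis
    using inj_evl evl_kx by (metis injD)
qed

lemma kc_eq: "k_c \<epsilon> x y = exp (- (norm (x - y))\<^sup>2 / \<epsilon>)"
  by (simp add: k_c_def cost_def)

lemma inner_kx: "inner (kx x) (kx y) = exp (- (norm (x - y))\<^sup>2 / \<epsilon>)"
  by (simp add: evl_eq_inner [symmetric] evl_kx kc_eq)

lemma kc_pos: "k_c \<epsilon> x y > 0"
  and kc_sym: "k_c \<epsilon> x y = k_c \<epsilon> y x"
  using eps_pos by (auto simp: kc_eq norm_minus_commute)

lemma norm_kx [simp]: "norm (kx x) = 1"
  by (simp add: norm_eq_sqrt_inner inner_kx)

lemma abs_evl_le: "\<bar>evl g x\<bar> \<le> norm g"
  using Cauchy_Schwarz_ineq2 [of g "kx x"] by (simp add: evl_eq_inner)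

lemma evl_add: "evl (g + h) x = evl g x + evl h x"
  and evl_diff: "evl (g - h) x = evl g x - evl h x"
  and evl_scaleR: "evl (c *\<^sub>R g) x = c * evl g x"
  and evl_minus: "evl (- g) x = - evl g x"
  and evl_zero: "evl 0 x = 0"
  by (simp_all add: evl_eq_inner inner_add_left inner_diff_left)

lemmas evl_simps = evl_add evl_diff evl_scaleR evl_minus evl_zero

lemma tendsto_evl: "(f \<longlongrightarrow> l) F \<Longrightarrow> ((\<lambda>n. evl (f n) x) \<longlongrightarrow> evl l x) F"
  by (simp add: evl_eq_inner tendsto_inner)

lemma one_minus_exp_le: "1 - exp (- t) \<le> t" for t :: real
  using exp_ge_add_one_self [of "- t"] by linarith

lemma norm_kx_diff: "norm (kx x - kx y) \<le> sqrt (2 / \<epsilon>) * norm (x - y)"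
proof -
  have "(norm (kx x - kx y))\<^sup>2 = 2 * (1 - exp (- ((norm (x - y))\<^sup>2 / \<epsilon>)))"
    unfolding power2_norm_eq_inner [of "kx x - kx y"]
    by (simp add: inner_diff_left inner_diff_right inner_kx norm_minus_commute)
  also have "\<dots> \<le> 2 * ((norm (x - y))\<^sup>2 / \<epsilon>)"
    using one_minus_exp_le by (intro mult_left_mono) auto
  also have "\<dots> = (sqrt (2 / \<epsilon>) * norm (x - y))\<^sup>2"
    using eps_pos by (simp add: power_mult_distrib)
  finally show ?thesis
    using eps_pos by (auto intro: power2_le_imp_le)
qed

lemma continuous_kx: "continuous_on A kx"
proof -
  have "(sqrt (2 / \<epsilon>))-lipschitz_on UNIV kx"
    using norm_kx_diff eps_pos by (intro lipschitz_onI) (auto simp: dist_norm)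
  then show ?thesis
    using lipschitz_on_continuous_on continuous_on_subset by blast
qed

lemma continuous_evl: "continuous_on A (evl g)"
  by (simp add: evl_eq_inner continuous_on_inner continuous_kx)

end

subsection \<open>Density of the kernel functions\<close>

lemma subspace_closure:
  fixes S :: "'h::real_normed_vector set"
  assumes "subspace S"
  shows "subspace (closure S)"
proof (rule subspaceI)
  show "0 \<in> closure S"
    using assms closure_subset subspace_0 by blast
  show "x + y \<in> closure S" if "x \<in> closure S" "y \<in> closure S" for x y
    using that assms unfolding closure_sequential
    by (metis (no_types, lifting) subspace_add tendsto_add)
  show "c *\<^sub>R x \<in> closure S" if "x \<in> closure S" for c x
    using that assms unfolding closure_sequential
    by (metis (no_types, lifting) subspace_scale tendsto_scaleR tendsto_const)
qed

lemma power2_norm_diff_scaleR: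
  "(norm (x - t *\<^sub>R y))\<^sup>2 = (norm x)\<^sup>2 - 2 * t * inner x y + t\<^sup>2 * inner y y"
  unfolding power2_norm_eq_inner
  by (simp add: inner_diff_left inner_diff_right inner_commute power2_eq_square algebra_simps)

lemma norm_add_squared: "(norm (x + y))\<^sup>2 = (norm x)\<^sup>2 + (norm y)\<^sup>2 + 2 * inner x y"
  unfolding power2_norm_eq_inner by (simp add: inner_add_left inner_add_right inner_commute [of y x])

text \<open>The projection theorem: a minimising sequence for the distance from \<open>g\<close> to
  \<open>L\<close> is Cauchy by the parallelogram law, and \<open>z\<close> is \<open>g\<close>
  minus the nearest point obtained as its limit.\<close>

lemma closed_subspace_orthogonal:
  fixes L :: "'h::{real_inner,banach} set"
  assumes L: "subspace L" "closed L" and g: "g \<notin> L"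
  obtains z where "z \<noteq> 0" "\<And>y. y \<in> L \<Longrightarrow> inner z y = 0"
proof -
  define d where "d = infdist g L"
  have L0: "0 \<in> L" and Lne: "L \<noteq> {}"
    using L subspace_0 by blast+
  have d_pos: "d \<ge> 0" by (simp add: d_def infdist_nonneg)
  have d_le: "d \<le> norm (g - y)" if "y \<in> L" for y
    unfolding d_def using infdist_le [OF that, of g] by (simp add: dist_norm)
  have "\<exists>y\<in>L. norm (g - y) < d + 1 / Suc n" for n
  proof -
    have "infdist g L < d + 1 / Suc n" by (simp add: d_def)
    then show ?thesis
      unfolding infdist_notempty [OF Lne] using Lne
      by (subst (asm) cINF_less_iff) (auto simp: dist_norm intro!: bdd_belowI2 [where m = 0])
  qed
  then obtain y where yL: "\<And>n. y n \<in> L" and y: "\<And>n. norm (g - y n) < d + 1 / Suc n"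
    by metis
  have par: "(norm (y m - y n))\<^sup>2 \<le> 2 * (norm (g - y m))\<^sup>2 + 2 * (norm (g - y n))\<^sup>2 - 4 * d\<^sup>2" for m n
  proof -
    have "(1/2) *\<^sub>R (y m + y n) \<in> L"
      using yL L(1) by (intro subspace_scale subspace_add)
    then have "d \<le> norm (g - (1/2) *\<^sub>R (y m + y n))" by (rule d_le)
    also have "g - (1/2) *\<^sub>R (y m + y n) = (1/2) *\<^sub>R ((g - y m) + (g - y n))"
      by (simp add: scaleR_right_diff_distrib scaleR_right_distrib scaleR_half_double flip: scaleR_2)
    finally have "2 * d \<le> norm ((g - y m) + (g - y n))"
      by simp
    then have "(2 * d)\<^sup>2 \<le> (norm ((g - y m) + (g - y n)))\<^sup>2"
      using d_pos by (intro power_mono) auto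
    moreover have "(norm ((g - y m) + (g - y n)))\<^sup>2 + (norm ((g - y n) - (g - y m)))\<^sup>2 =
        2 * (norm (g - y m))\<^sup>2 + 2 * (norm (g - y n))\<^sup>2"
      unfolding power2_norm_eq_inner
      using inner_commute [of "g - y m" "g - y n"]
      by (simp only: inner_add_left inner_add_right inner_diff_left [of "g - y n" "g - y m"]
          inner_diff_right [of _ "g - y n" "g - y m"])
    moreover have "(g - y n) - (g - y m) = y m - y n" by simp
    ultimately show ?thesis
      by (simp add: power_mult_distrib)
  qed
  have lim: "(\<lambda>n. (d + 1 / Suc n)\<^sup>2 - d\<^sup>2) \<longlonglongrightarrow> (d + 0)\<^sup>2 - d\<^sup>2"
    by (intro tendsto_intros LIMSEQ_Suc[OF lim_1_over_n])
  have "Cauchy y"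
  proof (rule CauchyI)
    fix e :: real assume "e > 0"
    then have "\<forall>\<^sub>F n in sequentially. (d + 1 / Suc n)\<^sup>2 - d\<^sup>2 < e\<^sup>2 / 4"
      using lim by (intro order_tendstoD) auto
    then obtain N where N: "\<And>n. n \<ge> N \<Longrightarrow> (d + 1 / Suc n)\<^sup>2 - d\<^sup>2 < e\<^sup>2 / 4"
      unfolding eventually_sequentially by blast
    have *: "(norm (g - y n))\<^sup>2 - d\<^sup>2 < e\<^sup>2 / 4" if "n \<ge> N" for n
      using N [OF that] power_mono [OF less_imp_le [OF y [of n]] norm_ge_zero, of 2] by linarith
    show "\<exists>M. \<forall>m\<ge>M. \<forall>n\<ge>M. norm (y m - y n) < e"
    proof (intro exI allI impI)
      fix m n assume "m \<ge> N" "n \<ge> N"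
      then have "(norm (y m - y n))\<^sup>2 < e\<^sup>2"
        using par [of m n] * [of m] * [of n] by linarith
      then show "norm (y m - y n) < e"
        using \<open>e > 0\<close> by (auto intro: power_less_imp_less_base)
    qed
  qed
  then obtain p where p: "y \<longlonglongrightarrow> p"
    by (auto simp: convergent_eq_Cauchy [symmetric])
  have pL: "p \<in> L"
    using L(2) p yL closed_sequentially by blast
  have "norm (g - p) \<le> d"
  proof (rule LIMSEQ_le)
    show "(\<lambda>n. norm (g - y n)) \<longlonglongrightarrow> norm (g - p)"
      by (intro tendsto_intros p)
    show "(\<lambda>n. d + 1 / Suc n) \<longlonglongrightarrow> d"
      using tendsto_add [OF tendsto_const LIMSEQ_Suc [OF lim_1_over_n], of d] by simp
    show "\<exists>N. \<forall>n\<ge>N. norm (g - y n) \<le> d + 1 / Suc n"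
      using y less_imp_le by blast
  qed
  then have min: "norm (g - p) \<le> norm (g - q)" if "q \<in> L" for q
    using d_le [OF that] by linarith
  have "inner (g - p) u = 0" if u: "u \<in> L" for u
  proof (cases "u = 0")
    case False
    \<comment> \<open>This \<open>t\<close> minimises the norm of
      \<open>(g - p) - t *\<^sub>R u\<close>; a nonzero inner product would produce a point of
      \<open>L\<close> closer than \<open>p\<close>.\<close>
    define t where "t = inner (g - p) u / inner u u"
    have uu: "inner u u > 0" using False by simp
    have "p + t *\<^sub>R u \<in> L" using pL u L(1) by (intro subspace_add subspace_scale)
    then have "(norm (g - p))\<^sup>2 \<le> (norm ((g - p) - t *\<^sub>R u))\<^sup>2"
      using min [of "p + t *\<^sub>R u"] by (intro power_mono) (auto simp: algebra_simps)
    also have "\<dots> = (norm (g - p))\<^sup>2 - 2 * t * inner (g - p) u + t\<^sup>2 * inner u u"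
      by (simp only: power2_norm_diff_scaleR)
    also have "\<dots> = (norm (g - p))\<^sup>2 - (inner (g - p) u)\<^sup>2 / inner u u"
      using uu by (simp add: t_def power2_eq_square field_simps)
    finally have "(inner (g - p) u)\<^sup>2 / inner u u \<le> 0" by simp
    then show ?thesis using uu by (simp add: divide_le_0_iff)
  qed simp
  moreover have "g - p \<noteq> 0" using g pL by auto
  ultimately show ?thesis using that by blast
qed

context gaussian_rkhs
begin

lemma closure_span_kx: "closure (span (range kx)) = UNIV"
proof (rule ccontr)
  let ?L = "closure (span (range kx))"
  assume "?L \<noteq> UNIV"
  then obtain g where g: "g \<notin> ?L" by blast
  obtain z where z: "z \<noteq> 0" "\<And>y. y \<in> ?L \<Longrightarrow> inner z y = 0"
    using closed_subspace_orthogonal [OF _ _ g] by (metis closed_closure subspace_closure subspace_span)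
  have "kx x \<in> ?L" for x
    using closure_subset span_superset by fast
  then have "z = 0"
    using z by (intro evl_ext) (simp add: evl_eq_inner)
  with z show False by simp
qed

text \<open>The extension principle for the whole space: a property stable under limits and linear
  combinations is checked on kernel functions only. Their span is dense because an element
  orthogonal to all of them vanishes at every point.\<close>

lemma kx_dense:
  assumes "closed S" "subspace S" "\<And>x. kx x \<in> S"
  shows "h \<in> S"
proof -
  have "span (range kx) \<subseteq> S"
    using assms by (intro span_minimal) auto
  then have "closure (span (range kx)) \<subseteq> S"
    using assms(1) by (simp add: closure_minimal)
  then show ?thesis using closure_span_kx by blast
qed

subsection \<open>Translations\<close>

definition shift :: "'a \<Rightarrow> 'h \<Rightarrow> 'h" where
  "shift p h = (THE h'. \<forall>y. evl h' y = evl h (y - p))"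

lemma shift_unique: "(\<And>y. evl h' y = evl h (y - p)) \<Longrightarrow> shift p h = h'"
proof -
  assume h': "\<And>y. evl h' y = evl h (y - p)"
  show ?thesis
    unfolding shift_def
  proof (rule the_equality)
    show "g = h'" if "\<forall>y. evl g y = evl h (y - p)" for g
      by (rule evl_ext) (simp add: that h')
  qed (simp add: h')
qed

text \<open>Translation permutes the kernel functions, and the Gaussian is translation invariant, so
  translation is an isometry of their span. It extends to the closure along Cauchy sequences; the
  limit is the translated function because evaluations are continuous.\<close>

lemma shift_exists: "\<exists>h'. (\<forall>y. evl h' y = evl h (y - p)) \<and> norm h' = norm h"
proof -
  let ?T = "\<lambda>h h'. \<forall>y. evl h' y = evl h (y - p)"
  have kxT: "?T (kx x) (kx (x + p))" for x
    by (simp add: evl_kx kc_eq algebra_simps)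
  have ex: "\<exists>h'. ?T h h'" if "h \<in> span (range kx)" for h
    using that
  proof (induction rule: span_induct_alt)
    case base
    then show ?case by (metis evl_zero)
  next
    case (step c x y)
    then obtain y' z where "?T y y'" "x = kx z" by blast
    then have "?T (c *\<^sub>R x + y) (c *\<^sub>R kx (z + p) + y')"
      using kxT [of z] by (simp add: evl_simps)
    then show ?case by blast
  qed
  then obtain V where V: "\<And>h y. h \<in> span (range kx) \<Longrightarrow> evl (V h) y = evl h (y - p)"
    by metis
  have Vkx: "V (kx x) = kx (x + p)" for x
    using V [of "kx x"] kxT by (intro evl_ext) (auto simp: span_base)
  have inn: "inner (V g) (V h) = inner g h"
    if g: "g \<in> span (range kx)" and h: "h \<in> span (range kx)" for g h
  proof -
    have "h \<in> span (range kx) \<and> inner (V g) (V h) = inner g h"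
      using h
    proof (induction rule: span_induct_alt)
      case base
      have "V 0 = 0" by (intro evl_ext) (simp add: V span_zero evl_zero)
      then show ?case by (simp add: span_zero)
    next
      case (step c x y)
      then obtain z where x: "x = kx z" by auto
      have mem: "c *\<^sub>R x + y \<in> span (range kx)"
        using step by (simp add: span_add span_scale span_base)
      have "V (c *\<^sub>R x + y) = c *\<^sub>R V x + V y"
        using step mem by (intro evl_ext) (simp add: V evl_simps span_base x)
      \<comment> \<open>Reproducing property twice: pairing with \<open>kx (z + p)\<close> evaluates
        \<open>V g\<close> at \<open>z + p\<close>, which is the value of \<open>g\<close> at
        \<open>z\<close>.\<close>
      moreover have "inner (V g) (V x) = inner g x"
        using V [OF g, of "z + p"] by (simp add: x Vkx evl_eq_inner)
      ultimately show ?case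
        using step.IH mem by (simp add: inner_add_right)
    qed
    then show ?thesis by blast
  qed
  have nrm: "norm (V g - V h) = norm (g - h)"
    if g: "g \<in> span (range kx)" and h: "h \<in> span (range kx)" for g h
  proof -
    have "V g - V h = V (g - h)"
      using g h by (intro evl_ext) (simp add: V evl_simps span_diff)
    then show ?thesis
      using inn [of "g - h" "g - h"] g h by (simp add: norm_eq_sqrt_inner span_diff)
  qed
  have "h \<in> closure (span (range kx))"
    by (simp add: closure_span_kx)
  then obtain s where s: "\<And>n. s n \<in> span (range kx)" "s \<longlonglongrightarrow> h"
    unfolding closure_sequential by blast
  have "Cauchy s"
    using s(2) by (rule LIMSEQ_imp_Cauchy)
  then have "Cauchy (\<lambda>n. V (s n))"
    using s(1) by (simp add: Cauchy_def dist_norm nrm)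
  then have "\<exists>l. (\<lambda>n. V (s n)) \<longlonglongrightarrow> l"
    by (simp only: convergent_eq_Cauchy)
  then obtain h' where h': "(\<lambda>n. V (s n)) \<longlonglongrightarrow> h'" ..
  have "evl h' y = evl h (y - p)" for y
  proof -
    have "(\<lambda>n. evl (V (s n)) y) \<longlonglongrightarrow> evl h' y"
      by (rule tendsto_evl [OF h'])
    moreover have "(\<lambda>n. evl (s n) (y - p)) \<longlonglongrightarrow> evl h (y - p)"
      by (rule tendsto_evl [OF s(2)])
    ultimately show ?thesis
      by (simp add: V s(1) LIMSEQ_unique)
  qed
  moreover have "norm h' = norm h"
  proof (rule LIMSEQ_unique)
    show "(\<lambda>n. norm (V (s n))) \<longlonglongrightarrow> norm h'"
      by (rule tendsto_norm [OF h'])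
    have "V 0 = 0" by (intro evl_ext) (simp add: V span_zero evl_zero)
    then have "norm (V (s n)) = norm (s n)" for n
      using nrm [OF s(1) span_zero, of n] by simp
    then show "(\<lambda>n. norm (V (s n))) \<longlonglongrightarrow> norm h"
      by (simp add: tendsto_norm s(2))
  qed
  ultimately show ?thesis by blast
qed

lemma evl_shift: "evl (shift p h) y = evl h (y - p)"
  and norm_shift [simp]: "norm (shift p h) = norm h"
proof -
  obtain h' where h': "\<forall>y. evl h' y = evl h (y - p)" "norm h' = norm h"
    using shift_exists by blast
  then have "shift p h = h'"
    using shift_unique by blast
  then show "evl (shift p h) y = evl h (y - p)" "norm (shift p h) = norm h"
    using h' by auto
qed

lemma shift_add: "shift p (g + h) = shift p g + shift p h"
  by (rule evl_ext) (simp add: evl_add evl_shift)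

lemma shift_diff: "shift p (g - h) = shift p g - shift p h"
  by (rule evl_ext) (simp add: evl_diff evl_shift)

lemma shift_scaleR: "shift p (c *\<^sub>R h) = c *\<^sub>R shift p h"
  by (rule evl_ext) (simp add: evl_scaleR evl_shift)

lemma shift_zero: "shift p 0 = 0"
  by (rule evl_ext) (simp add: evl_zero evl_shift)

lemma shift_kx: "shift p (kx x) = kx (x + p)"
  by (rule evl_ext) (simp add: evl_shift evl_kx kc_eq diff_diff_eq2)

lemma inner_shift: "inner (shift p g) (shift p h) = inner g h"
proof -
  have "(norm (shift p g + shift p h))\<^sup>2 = (norm (g + h))\<^sup>2"
    using norm_shift [of p "g + h"] by (simp only: shift_add)
  then show ?thesis
    using norm_add_squared [of "shift p g" "shift p h"] norm_add_squared [of g h] by simp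
qed

lemma bounded_linear_shift: "bounded_linear (shift p)"
  by (rule bounded_linear_intro [where K = 1]) (auto simp: shift_add shift_scaleR)

text \<open>Strong continuity of the translation group: clear on kernel functions, and preserved by
  limits because shifts are isometries, which makes the convergence uniform in
  \<open>p\<close>.\<close>

lemma continuous_shift_param: "continuous_on UNIV (\<lambda>p. shift p h)"
proof -
  have "h \<in> {h. continuous_on UNIV (\<lambda>p. shift p h)}"
  proof (rule kx_dense)
    show "subspace {h. continuous_on UNIV (\<lambda>p. shift p h)}"
      unfolding subspace_def
      by (auto simp: shift_add shift_scaleR shift_zero intro!: continuous_intros)
    show "kx x \<in> {h. continuous_on UNIV (\<lambda>p. shift p h)}" for x
      by (auto simp: shift_kx intro!: continuous_on_compose2 [OF continuous_kx] continuous_intros)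
    show "closed {h. continuous_on UNIV (\<lambda>p. shift p h)}"
      unfolding closed_sequential_limits
    proof safe
      fix s l assume s: "\<forall>n. s n \<in> {h. continuous_on UNIV (\<lambda>p. shift p h)}" "s \<longlonglongrightarrow> l"
      have "uniform_limit UNIV (\<lambda>n p. shift p (s n)) (\<lambda>p. shift p l) sequentially"
      proof (rule uniform_limitI)
        fix e :: real assume "e > 0"
        with s(2) have "\<forall>\<^sub>F n in sequentially. dist (s n) l < e"
          using tendstoD by blast
        then show "\<forall>\<^sub>F n in sequentially. \<forall>p\<in>UNIV. dist (shift p (s n)) (shift p l) < e"
          by (simp add: dist_norm flip: shift_diff)
      qed
      then show "continuous_on UNIV (\<lambda>p. shift p l)"
        using s(1) by (intro uniform_limit_theorem [of _ _ _ _ ]) auto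
    qed
  qed
  then show ?thesis by simp
qed

text \<open>Isometry separates the change of the vector from the change of the shift. Joint
  continuity makes a path shifted by a moving vector continuous, and its velocity
  measurable.\<close>

lemma continuous_shift: "continuous_on UNIV (\<lambda>(p, h). shift p h)"
  unfolding continuous_on_def
proof safe
  fix p h
  have "((\<lambda>q. shift (fst q) h) \<longlongrightarrow> shift p h) (at (p, h) within UNIV)"
  proof (rule tendsto_compose_at [where y = p and f = fst and g = "\<lambda>p. shift p h", unfolded o_def])
    show "(fst \<longlongrightarrow> p) (at (p, h) within UNIV)"
      by (auto intro!: tendsto_eq_intros)
    show "((\<lambda>p. shift p h) \<longlongrightarrow> shift p h) (at p)"
      using continuous_shift_param [of h] by (simp add: continuous_on_def)
  qed auto
  then have 1: "((\<lambda>q. norm (shift (fst q) h - shift p h)) \<longlongrightarrow> 0) (at (p, h))"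
    by (simp add: tendsto_norm_zero_iff LIM_zero_iff)
  have "((\<lambda>q. norm (snd q - h)) \<longlongrightarrow> 0) (at (p, h) within UNIV)"
    by (auto intro!: tendsto_norm_zero LIM_zero tendsto_eq_intros)
  with 1 have 2: "((\<lambda>q. norm (snd q - h) + norm (shift (fst q) h - shift p h)) \<longlongrightarrow> 0 + 0) (at (p, h))"
    by (intro tendsto_add) auto
  have le: "norm (shift (fst q) (snd q) - shift p h) \<le> norm (snd q - h) + norm (shift (fst q) h - shift p h)" for q
  proof -
    have "shift (fst q) (snd q) - shift p h = shift (fst q) (snd q - h) + (shift (fst q) h - shift p h)"
      by (simp add: shift_diff)
    then show ?thesis by (metis norm_triangle_ineq norm_shift)
  qed
  have "((\<lambda>q. norm (shift (fst q) (snd q) - shift p h)) \<longlongrightarrow> 0) (at (p, h))"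
    by (rule tendsto_sandwich [OF _ _ tendsto_const 2[simplified]]) (use le in auto)
  then show "((\<lambda>(p, h). shift p h) \<longlongrightarrow> shift p h) (at (p, h))"
    by (simp add: tendsto_norm_zero_iff LIM_zero_iff case_prod_unfold)
qed

lemma inner_kx_left: "inner (kx x) g = evl g x"
  by (simp add: evl_eq_inner inner_commute)

subsection \<open>Differentiating the kernel functions\<close>

text \<open>The derivative of \<open>kx\<close> at \<open>x\<close> in direction \<open>w\<close>.
  Along dyadic steps, consecutive difference quotients differ by a second difference of
  \<open>kx\<close>, whose norm is explicit.\<close>

definition dk :: "'a \<Rightarrow> 'a \<Rightarrow> 'h" where
  "dk w x = lim (\<lambda>n. 2 ^ n *\<^sub>R (kx (x + (1 / 2 ^ n) *\<^sub>R w) - kx x))"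

lemma inner_kx_step: "inner (kx (x + s *\<^sub>R w)) (kx (x + t *\<^sub>R w)) = exp (- ((s - t)\<^sup>2 * ((norm w)\<^sup>2 / \<epsilon>)))"
proof -
  have "x + s *\<^sub>R w - (x + t *\<^sub>R w) = (s - t) *\<^sub>R w"
    by (simp add: scaleR_left_diff_distrib)
  then show ?thesis
    by (simp add: inner_kx power_mult_distrib)
qed

text \<open>The squared norm is a polynomial in
  \<open>q = exp (- (norm v)\<^sup>2 / \<epsilon>)\<close> with a double root at
  \<open>q = 1\<close>. It is therefore of order \<open>(1 - q)\<^sup>2\<close>, and
  \<open>1 - q\<close> is at most \<open>(norm v)\<^sup>2 / \<epsilon>\<close>.\<close>

lemma norm_second_difference:
  "norm (kx (x + 2 *\<^sub>R v) - 2 *\<^sub>R kx (x + v) + kx x) \<le> 4 * ((norm v)\<^sup>2 / \<epsilon>)"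
proof -
  define t where "t = (norm v)\<^sup>2 / \<epsilon>"
  define q where "q = exp (- t)"
  have t: "t \<ge> 0" using eps_pos by (simp add: t_def)
  have q: "q > 0" "q \<le> 1" "1 - q \<le> t"
    using t one_minus_exp_le by (auto simp: q_def)
  have q4: "exp (- (4 * t)) = q ^ 4"
    by (simp add: q_def flip: exp_of_nat_mult)
  have AB: "inner (kx (x + 2 *\<^sub>R v)) (kx (x + v)) = q"
    and BC: "inner (kx (x + v)) (kx x) = q"
    and AC: "inner (kx (x + 2 *\<^sub>R v)) (kx x) = q ^ 4"
    using inner_kx_step [of x 2 v 1] inner_kx_step [of x 1 v 0] inner_kx_step [of x 2 v 0] q4
    by (simp_all add: q_def t_def)
  have AA: "inner (kx y) (kx y) = 1" for y by (simp add: inner_kx)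
  have "(norm (kx (x + 2 *\<^sub>R v) - 2 *\<^sub>R kx (x + v) + kx x))\<^sup>2 = 6 - 8 * q + 2 * q ^ 4"
    unfolding power2_norm_eq_inner
    using AB BC AC AA
      inner_commute [of "kx (x + 2 *\<^sub>R v)" "kx (x + v)"] inner_commute [of "kx (x + v)" "kx x"]
      inner_commute [of "kx (x + 2 *\<^sub>R v)" "kx x"]
    by (simp add: inner_add_left inner_add_right inner_diff_left inner_diff_right)
  also have "\<dots> = (1 - q)\<^sup>2 * (2 * q\<^sup>2 + 4 * q + 6)"
    by (simp add: power2_eq_square power4_eq_xxxx algebra_simps)
  also have "\<dots> \<le> t\<^sup>2 * 16"
  proof (rule mult_mono)
    show "(1 - q)\<^sup>2 \<le> t\<^sup>2" using q by (intro power_mono) auto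
    have "q\<^sup>2 \<le> 1" using q by (simp add: power_le_one)
    then show "2 * q\<^sup>2 + 4 * q + 6 \<le> 16" using q by linarith
  qed (use q in auto)
  also have "\<dots> = (4 * t)\<^sup>2" by (simp add: power_mult_distrib)
  finally show ?thesis
    unfolding t_def [symmetric] using t by (auto intro: power2_le_imp_le)
qed

text \<open>Halving the step changes the quotient by \<open>2 ^ n\<close> times a second difference
  with increment \<open>(1 / 2 ^ Suc n) *\<^sub>R w\<close>, hence by a multiple of
  \<open>(1/2) ^ n\<close>; the telescoping series converges.\<close>

lemma dk_limit: "(\<lambda>n. 2 ^ n *\<^sub>R (kx (x + (1 / 2 ^ n) *\<^sub>R w) - kx x)) \<longlonglongrightarrow> dk w x"
proof -
  define D where "D n = 2 ^ n *\<^sub>R (kx (x + (1 / 2 ^ n) *\<^sub>R w) - kx x)" for n :: nat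
  have le: "norm (D (Suc n) - D n) \<le> ((norm w)\<^sup>2 / \<epsilon>) * (1/2) ^ n" for n
  proof -
    define v where "v = (1 / 2 ^ Suc n) *\<^sub>R w"
    have v2: "(1 / 2 ^ n) *\<^sub>R w = 2 *\<^sub>R v" by (simp add: v_def)
    have "D (Suc n) = 2 ^ n *\<^sub>R (2 *\<^sub>R (kx (x + v) - kx x))"
      by (simp add: D_def v_def)
    moreover have "kx (x + 2 *\<^sub>R v) - kx x - 2 *\<^sub>R (kx (x + v) - kx x) =
        kx (x + 2 *\<^sub>R v) - 2 *\<^sub>R kx (x + v) + kx x"
      by (simp add: scaleR_2)
    ultimately have "D n - D (Suc n) = 2 ^ n *\<^sub>R (kx (x + 2 *\<^sub>R v) - 2 *\<^sub>R kx (x + v) + kx x)"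
      unfolding D_def [of n] v2 by (metis scaleR_right_diff_distrib)
    then have "norm (D (Suc n) - D n) = 2 ^ n * norm (kx (x + 2 *\<^sub>R v) - 2 *\<^sub>R kx (x + v) + kx x)"
      by (simp add: norm_minus_commute)
    also have "\<dots> \<le> 2 ^ n * (4 * ((norm v)\<^sup>2 / \<epsilon>))"
      by (intro mult_left_mono norm_second_difference) auto
    also have "\<dots> = ((norm w)\<^sup>2 / \<epsilon>) * (1/2) ^ n"
    proof -
      have "(norm v)\<^sup>2 = (norm w)\<^sup>2 / (4 * (2 ^ n * 2 ^ n))"
        by (simp add: v_def power_divide power2_eq_square)
      then show ?thesis by (simp add: power_one_over)
    qed
    finally show ?thesis .
  qed
  have "summable (\<lambda>n. D (Suc n) - D n)"
    by (rule summable_comparison_test' [of _ 0, OF _ le]) (auto intro!: summable_mult summable_geometric)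
  then have "convergent (\<lambda>n. \<Sum>i<n. D (Suc i) - D i)"
    by (simp add: summable_iff_convergent)
  then have "convergent (\<lambda>n. D n - D 0)"
    by (simp add: sum_lessThan_telescope)
  then obtain l where "(\<lambda>n. D n - D 0) \<longlonglongrightarrow> l"
    by (auto simp: convergent_def)
  then have "(\<lambda>n. D n - D 0 + D 0) \<longlonglongrightarrow> l + D 0"
    by (intro tendsto_add tendsto_const)
  then have "convergent D"
    by (auto simp: convergent_def)
  then show ?thesis
    unfolding dk_def D_def [symmetric] by (simp add: convergent_LIMSEQ_iff)
qed

lemma dyadic_to_0: "filterlim (\<lambda>n. 1 / 2 ^ n :: real) (at 0) sequentially"
  unfolding filterlim_at
  using LIMSEQ_divide_realpow_zero [of 2 1] by simp

lemma evl_dk: "evl (dk w x) y = 2 / \<epsilon> * (inner w (y - x) * k_c \<epsilon> x y)"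
proof -
  define f where "f = (\<lambda>s. exp (- (norm (x - y))\<^sup>2 / \<epsilon> + s * (2 / \<epsilon> * inner w (y - x)) + s\<^sup>2 * (- (norm w)\<^sup>2 / \<epsilon>)))"
  have fk: "k_c \<epsilon> (x + s *\<^sub>R w) y = f s" for s
  proof -
    have "x + s *\<^sub>R w - y = (x - y) + s *\<^sub>R w" by simp
    then have "(norm (x + s *\<^sub>R w - y))\<^sup>2 = (norm (x - y))\<^sup>2 + 2 * s * inner (x - y) w + s\<^sup>2 * (norm w)\<^sup>2"
      by (simp only: norm_add_squared) (simp add: power_mult_distrib algebra_simps)
    moreover have "inner (x - y) w = - inner w (y - x)"
      by (simp add: inner_diff_left inner_diff_right inner_commute)
    ultimately have "- (norm (x + s *\<^sub>R w - y))\<^sup>2 / \<epsilon> =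
        - (norm (x - y))\<^sup>2 / \<epsilon> + s * (2 / \<epsilon> * inner w (y - x)) + s\<^sup>2 * (- (norm w)\<^sup>2 / \<epsilon>)"
      by (simp add: diff_divide_distrib)
    then show ?thesis
      by (simp only: kc_eq f_def)
  qed
  have "(f has_field_derivative 2 / \<epsilon> * (inner w (y - x) * f 0)) (at 0)"
    unfolding f_def using eps_pos by (auto intro!: derivative_eq_intros)
  then have "((\<lambda>h. (f (0 + h) - f 0) / h) \<longlongrightarrow> 2 / \<epsilon> * (inner w (y - x) * f 0)) (at 0)"
    by (simp only: DERIV_def)
  then have "(\<lambda>n. (f (0 + 1 / 2 ^ n) - f 0) / (1 / 2 ^ n)) \<longlonglongrightarrow> 2 / \<epsilon> * (inner w (y - x) * f 0)"
    by (rule filterlim_compose [OF _ dyadic_to_0])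
  then have "(\<lambda>n. 2 ^ n * (k_c \<epsilon> (x + (1 / 2 ^ n) *\<^sub>R w) y - k_c \<epsilon> x y)) \<longlonglongrightarrow>
      2 / \<epsilon> * (inner w (y - x) * k_c \<epsilon> x y)"
    using fk [of 0] by (simp add: fk mult.commute)
  moreover have "(\<lambda>n. 2 ^ n * (k_c \<epsilon> (x + (1 / 2 ^ n) *\<^sub>R w) y - k_c \<epsilon> x y)) \<longlonglongrightarrow> evl (dk w x) y"
    using tendsto_evl [OF dk_limit, of x w y] by (simp add: evl_simps evl_kx)
  ultimately show ?thesis
    using LIMSEQ_unique by blast
qed

lemma shift_dk: "shift p (dk w x) = dk w (x + p)"
  by (rule evl_ext) (simp add: evl_shift evl_dk kc_eq diff_diff_eq2 algebra_simps)

lemma continuous_dk: "continuous_on UNIV (dk w)"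
proof -
  have "dk w = (\<lambda>p. shift p (dk w 0))"
    by (simp add: fun_eq_iff shift_dk)
  then show ?thesis
    using continuous_shift_param by metis
qed

lemma evl_dk_line: "evl (dk w x) (x + s *\<^sub>R w) = 2 * s * ((norm w)\<^sup>2 / \<epsilon>) * exp (- (s\<^sup>2 * ((norm w)\<^sup>2 / \<epsilon>)))"
  by (simp add: evl_dk kc_eq power2_norm_eq_inner power_mult_distrib)

lemma norm_dk: "(norm (dk w x))\<^sup>2 = 2 * ((norm w)\<^sup>2 / \<epsilon>)"
proof -
  let ?\<theta> = "(norm w)\<^sup>2 / \<epsilon>"
  let ?D = "\<lambda>n. 2 ^ n *\<^sub>R (kx (x + (1 / 2 ^ n) *\<^sub>R w) - kx x)"
  have "(\<lambda>n. inner (dk w x) (?D n)) \<longlonglongrightarrow> inner (dk w x) (dk w x)"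
    by (intro tendsto_inner tendsto_const dk_limit)
  moreover have "inner (dk w x) (?D n) = 2 * ?\<theta> * exp (- ((1 / 2 ^ n)\<^sup>2 * ?\<theta>))" for n
    using evl_dk_line [of w x "1 / 2 ^ n"] evl_dk_line [of w x 0]
    by (simp add: inner_diff_right flip: evl_eq_inner)
  moreover have "(\<lambda>n. 2 * ?\<theta> * exp (- ((1 / 2 ^ n)\<^sup>2 * ?\<theta>))) \<longlonglongrightarrow> 2 * ?\<theta> * exp (- (0\<^sup>2 * ?\<theta>))"
    using dyadic_to_0 unfolding filterlim_at by (intro tendsto_intros) auto
  ultimately show ?thesis
    using LIMSEQ_unique by (fastforce simp: power2_norm_eq_inner)
qed

text \<open>All inner products are explicit, and the squared norm becomes
  \<open>2 * ((1 - q) - \<tau>) + 4 * (\<tau> * (1 - q))\<close> with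
  \<open>q = exp (- \<tau>)\<close>. The first summand is nonpositive and the second at most
  \<open>4 * \<tau>\<^sup>2\<close>. The bound does not depend on \<open>x\<close>, so it survives
  integration.\<close>

lemma kx_remainder:
  "norm (kx (x + s *\<^sub>R w) - kx x - s *\<^sub>R dk w x) \<le> 2 * ((norm w)\<^sup>2 / \<epsilon>) * s\<^sup>2"
proof -
  define \<tau> where "\<tau> = s\<^sup>2 * ((norm w)\<^sup>2 / \<epsilon>)"
  define q where "q = exp (- \<tau>)"
  let ?X = "kx (x + s *\<^sub>R w) - kx x"
  have \<tau>: "\<tau> \<ge> 0" using eps_pos by (simp add: \<tau>_def)
  have q: "q > 0" "q \<le> 1" "1 - q \<le> \<tau>"
    using \<tau> one_minus_exp_le by (auto simp: q_def)
  have AA: "inner (kx y) (kx y) = 1" for y by (simp add: inner_kx)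
  have XX: "(norm ?X)\<^sup>2 = 2 - 2 * q"
    using inner_kx_step [of x s w 0] inner_kx_step [of x 0 w s] AA
    unfolding power2_norm_eq_inner [of ?X]
    by (simp add: inner_diff_left inner_diff_right q_def \<tau>_def)
  have Xd: "s * inner ?X (dk w x) = 2 * \<tau> * q"
  proof -
    have "inner ?X (dk w x) = evl (dk w x) (x + s *\<^sub>R w) - evl (dk w x) x"
      by (simp add: inner_diff_left inner_kx_left)
    then show ?thesis
      using evl_dk_line [of w x s] evl_dk_line [of w x 0]
      by (simp add: q_def \<tau>_def power2_eq_square)
  qed
  have dd: "s\<^sup>2 * inner (dk w x) (dk w x) = 2 * \<tau>"
    using norm_dk [of w x] by (simp add: \<tau>_def flip: power2_norm_eq_inner)
  have "(norm (?X - s *\<^sub>R dk w x))\<^sup>2 = (2 - 2 * q) - 2 * (2 * \<tau> * q) + 2 * \<tau>"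
    unfolding power2_norm_diff_scaleR using XX Xd dd by simp
  also have "\<dots> = 2 * ((1 - q) - \<tau>) + 4 * (\<tau> * (1 - q))"
    by (simp add: algebra_simps)
  also have "\<dots> \<le> 0 + 4 * (\<tau> * \<tau>)"
    using q \<tau> by (intro add_mono mult_left_mono) auto
  also have "\<dots> = (2 * \<tau>)\<^sup>2"
    by (simp add: power2_eq_square)
  finally have "(norm (?X - s *\<^sub>R dk w x))\<^sup>2 \<le> (2 * \<tau>)\<^sup>2"
    by simp
  then have "norm (?X - s *\<^sub>R dk w x) \<le> 2 * \<tau>"
    using \<tau> by (auto intro: power2_le_imp_le)
  then show ?thesis
    by (simp add: \<tau>_def algebra_simps)
qed

lemma kx_has_vector_derivative:
  "((\<lambda>s. kx (x + s *\<^sub>R w)) has_vector_derivative dk w (x + s *\<^sub>R w)) (at s)"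
  unfolding has_vector_derivative_def has_derivative_at
proof (intro conjI bounded_linear_scaleR_left)
  let ?c = "2 * ((norm w)\<^sup>2 / \<epsilon>)"
  let ?r = "\<lambda>h. norm (kx (x + (s + h) *\<^sub>R w) - kx (x + s *\<^sub>R w) - h *\<^sub>R dk w (x + s *\<^sub>R w)) / norm h"
  have "?r h \<le> ?c * \<bar>h\<bar>" for h
  proof (cases "h = 0")
    case False
    have eq: "x + (s + h) *\<^sub>R w = (x + s *\<^sub>R w) + h *\<^sub>R w"
      by (simp add: scaleR_left_distrib)
    have "norm (kx (x + (s + h) *\<^sub>R w) - kx (x + s *\<^sub>R w) - h *\<^sub>R dk w (x + s *\<^sub>R w)) \<le> ?c * h\<^sup>2"
      unfolding eq by (rule kx_remainder)
    moreover have "h\<^sup>2 = \<bar>h\<bar> * \<bar>h\<bar>" by (simp add: power2_eq_square)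
    ultimately show ?thesis
      using False by (simp add: pos_divide_le_eq mult.assoc)
  qed (use eps_pos in simp)
  moreover have "((\<lambda>h. ?c * \<bar>h\<bar>) \<longlongrightarrow> 0) (at 0)"
    using eps_pos by (auto intro!: tendsto_eq_intros)
  ultimately show "?r \<midarrow>0\<rightarrow> 0"
    by (intro Lim_null_comparison [of ?r]) auto
qed

text \<open>The product of \<open>kx x\<close> with the linear function \<open>inner w\<close>:
  writing \<open>inner w y = inner w x + inner w (y - x)\<close>, the second summand times the
  Gaussian is a multiple of its derivative in \<open>x\<close>. In particular this product belongs
  to the space.\<close>

definition nx :: "'a \<Rightarrow> 'a \<Rightarrow> 'h" where
  "nx w x = inner w x *\<^sub>R kx x + (\<epsilon> / 2) *\<^sub>R dk w x"

lemma evl_nx: "evl (nx w x) y = inner w y * k_c \<epsilon> x y"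
  using eps_pos by (simp add: nx_def evl_simps evl_kx evl_dk inner_diff_right algebra_simps)

lemma continuous_nx: "continuous_on UNIV (nx w)"
  unfolding nx_def [abs_def] by (intro continuous_intros continuous_kx continuous_dk)

end

section \<open>The self-transport potential\<close>

lemma integrable_continuous_bounded_support:
  fixes f :: "'a::euclidean_space \<Rightarrow> 'b::{banach,second_countable_topology}"
  assumes \<mu>: "borel_prob \<mu>" "bounded_support \<mu>" and f: "continuous_on UNIV f"
  shows "integrable \<mu> f"
proof -
  interpret prob_space \<mu> using \<mu> by (simp add: borel_prob_def)
  obtain S where S: "bounded S" "AE x in \<mu>. x \<in> S"
    using \<mu> by (auto simp: bounded_support_def)
  have "compact (f ` closure S)"
    using S f by (intro compact_continuous_image continuous_on_subset [OF f]) (auto simp: compact_closure)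
  then obtain B where B: "\<And>x. x \<in> closure S \<Longrightarrow> norm (f x) \<le> B"
    by (meson bounded_iff compact_imp_bounded imageI)
  have "f \<in> borel_measurable \<mu>"
    using borel_measurable_continuous_onI [OF f] measurable_cong_sets \<mu>(1) borel_prob_def by blast
  then show ?thesis
    using S closure_subset by (intro integrable_const_bound [where B = B]) (auto intro!: B)
qed

lemma integral_nonpos:
  fixes f :: "'b \<Rightarrow> real"
  shows "(\<And>x. f x \<le> 0) \<Longrightarrow> (LINT x|M. f x) \<le> 0"
  using integral_nonneg_AE [of "\<lambda>x. - f x" M] by simp

locale bounded_prob = gaussian_rkhs \<epsilon> evl
  for \<epsilon> :: real
    and evl :: "'h::{real_inner,banach,second_countable_topology} \<Rightarrow> 'a::euclidean_space \<Rightarrow> real" +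
  fixes \<mu> :: "'a measure"
  assumes borel_prob: "borel_prob \<mu>"
    and bounded_support: "bounded_support \<mu>"
begin

sublocale prob_space \<mu>
  using borel_prob by (simp add: borel_prob_def)

lemma sets_eq_borel [measurable_cong, simp]: "sets \<mu> = sets borel"
  using borel_prob by (simp add: borel_prob_def)

lemma integrable_cont: "continuous_on UNIV f \<Longrightarrow> integrable \<mu> f"
  for f :: "'a \<Rightarrow> 'b::{banach,second_countable_topology}"
  using integrable_continuous_bounded_support borel_prob bounded_support by blast

text \<open>The kernel mean embedding of the signed measure with density \<open>f\<close> with
  respect to \<open>\<mu>\<close>.\<close>

definition emb :: "('a \<Rightarrow> real) \<Rightarrow> 'h" where
  "emb f = (LINT x|\<mu>. f x *\<^sub>R kx x)"

lemma inner_integral: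
  fixes V :: "'a \<Rightarrow> 'h"
  assumes "continuous_on UNIV V"
  shows "inner (LINT x|\<mu>. V x) g = (LINT x|\<mu>. inner (V x) g)"
  by (cases "g = 0") (simp_all add: integrable_cont assms)

lemma inner_emb:
  assumes "continuous_on UNIV f"
  shows "inner g (emb f) = (LINT x|\<mu>. f x * evl g x)"
  using assms inner_integral [of "\<lambda>x. f x *\<^sub>R kx x" g]
  by (simp add: emb_def inner_commute [of g] continuous_on_scaleR continuous_kx inner_kx_left)

lemma evl_emb:
  assumes "continuous_on UNIV f"
  shows "evl (emb f) y = (LINT x|\<mu>. f x * k_c \<epsilon> x y)"
  using inner_emb [OF assms, of "kx y"] by (simp add: inner_kx_left evl_kx kc_sym [of y])

lemma emb_diff:
  assumes "continuous_on UNIV f" "continuous_on UNIV g"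
  shows "emb (\<lambda>x. f x - g x) = emb f - emb g"
  unfolding emb_def
  using assms by (simp add: scaleR_diff_left integrable_cont continuous_on_scaleR continuous_kx)

lemma emb_add:
  assumes "continuous_on UNIV f" "continuous_on UNIV g"
  shows "emb (\<lambda>x. f x + g x) = emb f + emb g"
  unfolding emb_def
  using assms by (simp add: scaleR_add_left integrable_cont continuous_on_scaleR continuous_kx)

lemma emb_scale: "emb (\<lambda>x. c * f x) = c *\<^sub>R emb f"
  by (simp add: emb_def flip: scaleR_scaleR)

section \<open>Existence, uniqueness and bounds of the scaling\<close>

lemma continuous_kc: "continuous_on A (\<lambda>x. k_c \<epsilon> x y)"
  unfolding kc_eq by (intro continuous_intros) (use eps_pos in auto)

text \<open>The Schroedinger (Sinkhorn) system of the self-transport problem in the unknown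
  \<open>exp (f / \<epsilon>)\<close>; it expresses that
  \<open>a x * a y * k_c \<epsilon> x y\<close> is a Markov density with respect to
  \<open>\<mu>\<close>.\<close>

definition is_scaling :: "('a \<Rightarrow> real) \<Rightarrow> bool" where
  "is_scaling a \<longleftrightarrow> continuous_on UNIV a \<and> (\<forall>x. a x > 0) \<and>
     (\<forall>y. (LINT x|\<mu>. a x * k_c \<epsilon> x y) = 1 / a y)"

text \<open>If both \<open>a\<close> and \<open>a'\<close> are scalings, the squared norm of the difference of their
  embeddings is the integral of \<open>(a - a') (1 / a - 1 / a') \<le> 0\<close>.\<close>

lemma is_scaling_unique:
  assumes a: "is_scaling a" and a': "is_scaling a'"
  shows "a = a'"
proof -
  have c: "continuous_on UNIV a" "continuous_on UNIV a'"
    using a a' by (auto simp: is_scaling_def)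
  have ev: "evl (emb a) y = 1 / a y" "evl (emb a') y = 1 / a' y" for y
    using a a' c by (auto simp: evl_emb is_scaling_def)
  have pos: "a x > 0" "a' x > 0" for x
    using a a' by (auto simp: is_scaling_def)
  define d where "d = emb a - emb a'"
  have "inner d d = inner d (emb (\<lambda>x. a x - a' x))"
    using c by (simp add: emb_diff d_def)
  also have "\<dots> = (LINT x|\<mu>. (a x - a' x) * evl d x)"
    using c by (intro inner_emb continuous_intros)
  also have "\<dots> \<le> 0"
  proof (rule integral_nonpos)
    fix x
    have "(a x - a' x) * evl d x = - ((a x - a' x)\<^sup>2 / (a x * a' x))"
      using pos [of x] by (simp add: d_def evl_diff ev field_simps power2_eq_square)
    then show "(a x - a' x) * evl d x \<le> 0"
      using pos [of x] by simp
  qed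
  finally have "d = 0" by (metis inner_ge_zero inner_eq_zero_iff order_antisym)
  then have "emb a = emb a'" by (simp add: d_def)
  then have "1 / a y = 1 / a' y" for y
    using ev by metis
  then show ?thesis by (simp add: fun_eq_iff)
qed

lemma kernel_lower_bound:
  assumes "bounded S"
  obtains \<delta> where "0 < \<delta>" "\<delta> \<le> 1" "\<And>x y. x \<in> S \<Longrightarrow> y \<in> S \<Longrightarrow> \<delta> \<le> k_c \<epsilon> x y"
proof -
  obtain D where D: "\<And>x. x \<in> S \<Longrightarrow> norm x \<le> D" "D > 0"
    using assms by (meson bounded_pos)
  show ?thesis
  proof
    show "0 < exp (- (2 * D)\<^sup>2 / \<epsilon>)" "exp (- (2 * D)\<^sup>2 / \<epsilon>) \<le> 1"
      using eps_pos by auto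
    show "exp (- (2 * D)\<^sup>2 / \<epsilon>) \<le> k_c \<epsilon> x y" if "x \<in> S" "y \<in> S" for x y
    proof -
      have "norm (x - y) \<le> 2 * D"
        using norm_triangle_ineq4 [of x y] D(1) [OF that(1)] D(1) [OF that(2)] by linarith
      then have "(norm (x - y))\<^sup>2 \<le> (2 * D)\<^sup>2" by (intro power_mono) auto
      then show ?thesis
        using eps_pos by (simp add: kc_eq divide_right_mono)
    qed
  qed
qed

text \<open>The scaling is \<open>1 / b\<close> for a fixed point \<open>b\<close> in the Hilbert space of the map
  sending \<open>b\<close> to the embedding of \<open>1 / b\<close>.  Truncating \<open>b\<close> at \<open>\<delta>\<close> makes this map Lipschitz; it is
  also monotonically decreasing, so a suitable average with the identity is a contraction.
  At the fixed point the truncation is not active.\<close>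

lemma is_scaling_exists: "\<exists>a. is_scaling a"
proof -
  obtain S where S: "bounded S" "AE x in \<mu>. x \<in> S"
    using bounded_support by (auto simp: bounded_support_def)
  obtain \<delta> where \<delta>: "0 < \<delta>" "\<delta> \<le> 1" "\<And>x y. x \<in> S \<Longrightarrow> y \<in> S \<Longrightarrow> \<delta> \<le> k_c \<epsilon> x y"
    using kernel_lower_bound [OF S(1)] by blast
  define r where "r b x = 1 / max (evl b x) \<delta>" for b x
  have r_cont: "continuous_on UNIV (r b)" for b
    unfolding r_def [abs_def] using \<delta> by (intro continuous_intros continuous_evl) (auto simp: max_def)
  have r_pos: "r b x > 0" for b x
    using \<delta> by (simp add: r_def)
  define F where "F b = emb (r b)" for b
  define l where "l = 1 / \<delta>\<^sup>2"
  have l: "l > 0" using \<delta> by (simp add: l_def)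
  have r_lip: "\<bar>r b x - r b' x\<bar> \<le> l * norm (b - b')" for b b' x
  proof -
    let ?m = "max (evl b x) \<delta>" and ?m' = "max (evl b' x) \<delta>"
    have m: "?m \<ge> \<delta>" "?m' \<ge> \<delta>" by auto
    have mm: "?m * ?m' \<ge> \<delta>\<^sup>2"
      unfolding power2_eq_square using m \<delta>(1) by (intro mult_mono) auto
    have "\<bar>r b x - r b' x\<bar> = \<bar>?m' - ?m\<bar> / (?m * ?m')"
    proof -
      have "r b x - r b' x = (?m' - ?m) / (?m * ?m')"
        unfolding r_def using m \<delta>(1) by (subst diff_frac_eq) auto
      then show ?thesis using m \<delta>(1) by (simp add: abs_mult)
    qed
    also have "\<dots> \<le> \<bar>?m' - ?m\<bar> / \<delta>\<^sup>2"
      using mm \<delta>(1) by (intro divide_left_mono mult_pos_pos) (auto intro: less_le_trans)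
    also have "\<dots> \<le> norm (b - b') / \<delta>\<^sup>2"
    proof (rule divide_right_mono)
      have "\<bar>?m' - ?m\<bar> \<le> \<bar>evl (b - b') x\<bar>"
        by (auto simp: evl_diff)
      then show "\<bar>?m' - ?m\<bar> \<le> norm (b - b')"
        using abs_evl_le order_trans by blast
    qed simp
    finally show ?thesis by (simp add: l_def)
  qed
  have F_lip: "norm (F b - F b') \<le> l * norm (b - b')" for b b'
  proof -
    have "F b - F b' = (LINT x|\<mu>. (r b x - r b' x) *\<^sub>R kx x)"
      using emb_diff [OF r_cont r_cont, of b b'] by (simp add: F_def emb_def)
    also have "norm \<dots> \<le> (LINT x|\<mu>. norm ((r b x - r b' x) *\<^sub>R kx x))"
      by (rule integral_norm_bound)
    also have "\<dots> \<le> (LINT x|\<mu>. l * norm (b - b'))"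
      using r_lip by (intro integral_mono integrable_cont continuous_intros continuous_kx r_cont) auto
    finally show ?thesis by (simp add: prob_space)
  qed
  have F_mono: "inner (b - b') (F b - F b') \<le> 0" for b b'
  proof -
    have "inner (b - b') (F b - F b') = (LINT x|\<mu>. (r b x - r b' x) * evl (b - b') x)"
      unfolding F_def emb_diff [OF r_cont r_cont, symmetric]
      by (intro inner_emb continuous_intros r_cont)
    also have "\<dots> \<le> 0"
    proof (rule integral_nonpos)
      fix x
      have "r b x \<ge> r b' x" if "evl b x \<le> evl b' x" for b b'
        unfolding r_def using that \<delta>(1) by (intro divide_left_mono mult_pos_pos) auto
      then show "(r b x - r b' x) * evl (b - b') x \<le> 0"
        by (cases "evl b x \<le> evl b' x") (auto simp: evl_diff mult_le_0_iff)
    qed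
    finally show ?thesis .
  qed
  \<comment> \<open>By monotonicity the averaged map has squared Lipschitz constant at most
    \<open>(1 - \<tau>)\<^sup>2 + \<tau>\<^sup>2 * l\<^sup>2\<close>. This is smallest for the
    present \<open>\<tau>\<close>, with value \<open>1 - \<tau>\<close>.\<close>
  define \<tau> where "\<tau> = 1 / (1 + l\<^sup>2)"
  have \<tau>: "0 < \<tau>" "\<tau> \<le> 1" "\<tau> * (1 + l\<^sup>2) = 1"
  proof -
    have "1 + l\<^sup>2 > 0" by (simp add: add_pos_nonneg)
    then show "0 < \<tau>" "\<tau> \<le> 1" "\<tau> * (1 + l\<^sup>2) = 1"
      by (auto simp: \<tau>_def divide_le_eq)
  qed
  define G where "G b = (1 - \<tau>) *\<^sub>R b + \<tau> *\<^sub>R F b" for b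
  have "\<exists>!b. G b = b"
  proof (rule banach_fix_type)
    show "0 \<le> sqrt (1 - \<tau>)" "sqrt (1 - \<tau>) < 1"
      using \<tau> by auto
    show "\<forall>b b'. dist (G b) (G b') \<le> sqrt (1 - \<tau>) * dist b b'"
    proof (intro allI)
      fix b b'
      let ?d = "b - b'" and ?D = "F b - F b'"
      have eq: "G b - G b' = (1 - \<tau>) *\<^sub>R ?d + \<tau> *\<^sub>R ?D"
        by (simp add: G_def algebra_simps)
      have "(norm (G b - G b'))\<^sup>2 = (1 - \<tau>)\<^sup>2 * (norm ?d)\<^sup>2 + \<tau>\<^sup>2 * (norm ?D)\<^sup>2 + 2 * ((1 - \<tau>) * \<tau> * inner ?d ?D)"
        unfolding eq norm_add_squared by (simp add: power_mult_distrib mult.assoc)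
      also have "\<dots> \<le> (1 - \<tau>)\<^sup>2 * (norm ?d)\<^sup>2 + \<tau>\<^sup>2 * (l * norm ?d)\<^sup>2 + 0"
      proof (intro add_mono mult_left_mono)
        show "(norm ?D)\<^sup>2 \<le> (l * norm ?d)\<^sup>2"
          using F_lip [of b b'] by (intro power_mono) auto
        show "2 * ((1 - \<tau>) * \<tau> * inner ?d ?D) \<le> 0"
          using F_mono [of b b'] \<tau> by (simp add: mult_nonneg_nonpos)
      qed auto
      also have "\<dots> = ((1 - \<tau>)\<^sup>2 + \<tau>\<^sup>2 * l\<^sup>2) * (norm ?d)\<^sup>2"
        by (simp add: power_mult_distrib algebra_simps)
      also have "(1 - \<tau>)\<^sup>2 + \<tau>\<^sup>2 * l\<^sup>2 = 1 - 2 * \<tau> + \<tau> * (\<tau> * (1 + l\<^sup>2))"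
        by (simp add: power2_eq_square algebra_simps)
      also have "\<dots> = 1 - \<tau>"
        using \<tau> by simp
      also have "(1 - \<tau>) * (norm ?d)\<^sup>2 = (sqrt (1 - \<tau>) * norm ?d)\<^sup>2"
        using \<tau> by (simp add: power_mult_distrib)
      finally show "dist (G b) (G b') \<le> sqrt (1 - \<tau>) * dist b b'"
        unfolding dist_norm using \<tau> by (auto intro: power2_le_imp_le)
    qed
  qed
  then obtain b where "G b = b" by blast
  then have "\<tau> *\<^sub>R F b = \<tau> *\<^sub>R b"
    by (simp add: G_def algebra_simps)
  then have b: "b = emb (r b)"
    using \<tau> by (simp add: F_def)
  \<comment> \<open>Pairing the fixed point equation with \<open>b\<close> itself gives
    \<open>norm b \<le> 1\<close>. Then \<open>b \<le> 1\<close> pointwise, so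
    \<open>r b \<ge> 1\<close>, and the equation forces \<open>b\<close> to lie above the integral
    of the kernel, which is at least \<open>\<delta>\<close> on \<open>S\<close>.\<close>
  have "(norm b)\<^sup>2 = inner b (emb (r b))"
    using b by (simp add: power2_norm_eq_inner)
  also have "\<dots> = (LINT x|\<mu>. r b x * evl b x)"
    by (rule inner_emb [OF r_cont])
  also have "\<dots> \<le> (LINT x|\<mu>. 1)"
  proof (intro integral_mono integrable_cont continuous_intros r_cont continuous_evl)
    show "r b x * evl b x \<le> 1" for x
      using \<delta>(1) by (auto simp: r_def max_def divide_simps)
  qed
  finally have "norm b \<le> 1"
    by (simp add: prob_space abs_square_le_1)
  then have b_le: "evl b x \<le> 1" for x
    using abs_evl_le [of b x] by linarith
  have r_ge: "r b x \<ge> 1" for x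
    using b_le [of x] \<delta> by (simp add: r_def)
  have evb: "evl b y = (LINT x|\<mu>. r b x * k_c \<epsilon> x y)" for y
    using b evl_emb [OF r_cont] by metis
  have evb_ge: "evl b y \<ge> (LINT x|\<mu>. k_c \<epsilon> x y)" for y
    unfolding evb
  proof (intro integral_mono integrable_cont continuous_intros r_cont continuous_kc)
    show "k_c \<epsilon> x y \<le> r b x * k_c \<epsilon> x y" for x
      using r_ge [of x] kc_pos [of x y] by (simp add: mult_le_cancel_right1)
  qed
  have bS: "evl b y \<ge> \<delta>" if "y \<in> S" for y
  proof -
    have "(LINT x|\<mu>. \<delta>) \<le> (LINT x|\<mu>. k_c \<epsilon> x y)"
    proof (rule integral_mono_AE)
      show "AE x in \<mu>. \<delta> \<le> k_c \<epsilon> x y"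
        using S(2) by eventually_elim (use \<delta>(3) that in blast)
    qed (intro integrable_cont continuous_intros continuous_kc)+
    then show ?thesis using evb_ge [of y] by (simp add: prob_space)
  qed
  \<comment> \<open>Off \<open>S\<close> the value may fall below \<open>\<delta>\<close>. This is
    harmless, as the integrals only see \<open>S\<close>; positivity at \<open>y\<close> comes from
    a kernel bound on \<open>S\<close> enlarged by \<open>y\<close>.\<close>
  have b_pos: "evl b y > 0" for y
  proof -
    obtain \<delta>' where \<delta>': "0 < \<delta>'" "\<And>x z. x \<in> insert y S \<Longrightarrow> z \<in> insert y S \<Longrightarrow> \<delta>' \<le> k_c \<epsilon> x z"
      using kernel_lower_bound [of "insert y S"] S(1) by (metis bounded_insert)
    have "(LINT x|\<mu>. \<delta>') \<le> (LINT x|\<mu>. k_c \<epsilon> x y)"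
    proof (rule integral_mono_AE)
      show "AE x in \<mu>. \<delta>' \<le> k_c \<epsilon> x y"
        using S(2) by eventually_elim (use \<delta>'(2) in blast)
    qed (intro integrable_cont continuous_intros continuous_kc)+
    then show ?thesis using evb_ge [of y] \<delta>'(1) by (simp add: prob_space)
  qed
  have ib_cont: "continuous_on UNIV (\<lambda>x. 1 / evl b x)"
    using b_pos by (intro continuous_on_divide continuous_on_const continuous_evl) (auto simp: less_imp_neq [symmetric])
  have "is_scaling (\<lambda>x. 1 / evl b x)"
    unfolding is_scaling_def
  proof (intro conjI allI ib_cont)
    fix y
    have "(LINT x|\<mu>. 1 / evl b x * k_c \<epsilon> x y) = (LINT x|\<mu>. r b x * k_c \<epsilon> x y)"
    proof (rule integral_cong_AE)
      show "AE x in \<mu>. 1 / evl b x * k_c \<epsilon> x y = r b x * k_c \<epsilon> x y"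
        using S(2) by eventually_elim (simp add: r_def max_absorb1 bS)
    qed (intro borel_measurable_integrable integrable_cont continuous_on_mult ib_cont r_cont continuous_kc)+
    then show "(LINT x|\<mu>. 1 / evl b x * k_c \<epsilon> x y) = 1 / (1 / evl b y)"
      by (simp add: evb)
  qed (use b_pos in auto)
  then show ?thesis by blast
qed

text \<open>Exponential and logarithm give a bijection between potentials and scalings, so existence
  and uniqueness of the scaling make the definite description in \<open>potential\<close>
  meaningful.\<close>

lemma is_scaling_a_fun: "is_scaling (a_fun \<epsilon> \<mu>)"
proof -
  let ?P = "\<lambda>f. continuous_on UNIV f \<and> (\<forall>y. (LINT x|\<mu>. exp ((f x + f y - cost x y) / \<epsilon>)) = 1)"
  have iff: "?P f \<longleftrightarrow> is_scaling (\<lambda>x. exp (f x / \<epsilon>))" for f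
  proof -
    have "continuous_on UNIV f \<longleftrightarrow> continuous_on UNIV (\<lambda>x. exp (f x / \<epsilon>))"
    proof
      assume "continuous_on UNIV f"
      then show "continuous_on UNIV (\<lambda>x. exp (f x / \<epsilon>))"
        using eps_pos by (intro continuous_intros) auto
    next
      assume "continuous_on UNIV (\<lambda>x. exp (f x / \<epsilon>))"
      then have "continuous_on UNIV (\<lambda>x. \<epsilon> * ln (exp (f x / \<epsilon>)))"
        by (intro continuous_on_mult continuous_on_const continuous_on_ln) auto
      then show "continuous_on UNIV f" using eps_pos by simp
    qed
    moreover have "(LINT x|\<mu>. exp ((f x + f y - cost x y) / \<epsilon>)) = 1 \<longleftrightarrow>
        (LINT x|\<mu>. exp (f x / \<epsilon>) * k_c \<epsilon> x y) = 1 / exp (f y / \<epsilon>)" for y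
    proof -
      have "exp ((f x + f y - cost x y) / \<epsilon>) = exp (f y / \<epsilon>) * (exp (f x / \<epsilon>) * k_c \<epsilon> x y)" for x
        by (simp add: k_c_def add_divide_distrib diff_divide_distrib flip: exp_add)
      then have "(LINT x|\<mu>. exp ((f x + f y - cost x y) / \<epsilon>)) = exp (f y / \<epsilon>) * (LINT x|\<mu>. exp (f x / \<epsilon>) * k_c \<epsilon> x y)"
        by simp
      then show ?thesis by (auto simp: field_simps)
    qed
    ultimately show ?thesis by (simp add: is_scaling_def)
  qed
  obtain a where a: "is_scaling a" using is_scaling_exists by blast
  then have pos: "a x > 0" for x by (simp add: is_scaling_def)
  have "?P (\<lambda>x. \<epsilon> * ln (a x))"
    unfolding iff using a pos eps_pos by simp
  moreover have "f = g" if "?P f" "?P g" for f g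
    using is_scaling_unique [of "\<lambda>x. exp (f x / \<epsilon>)" "\<lambda>x. exp (g x / \<epsilon>)"] that eps_pos
    unfolding iff by (simp add: fun_eq_iff)
  ultimately have "\<exists>!f. ?P f" by blast
  then have "?P (potential \<epsilon> \<mu>)"
    unfolding potential_def by (rule theI')
  then show ?thesis
    unfolding iff by (simp add: a_fun_def [abs_def])
qed

abbreviation a :: "'a \<Rightarrow> real" where "a \<equiv> a_fun \<epsilon> \<mu>"
abbreviation B :: "'h" where "B \<equiv> B_map \<epsilon> evl \<mu>"

lemma a_eqI: "is_scaling b \<Longrightarrow> a = b"
  using is_scaling_unique is_scaling_a_fun by blast

lemma continuous_a: "continuous_on UNIV a"
  and a_pos: "a x > 0"
  and a_eq: "(LINT x|\<mu>. a x * k_c \<epsilon> x y) = 1 / a y"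
  using is_scaling_a_fun by (auto simp: is_scaling_def)

lemma B_eq_emb: "B = emb a"
  by (simp add: B_map_def emb_def kx_def)

lemma evl_B: "evl B y = 1 / a y"
  by (simp add: B_eq_emb evl_emb continuous_a a_eq)

lemma inner_B: "inner g B = (LINT x|\<mu>. a x * evl g x)"
  by (simp add: B_eq_emb inner_emb continuous_a)

lemma norm_B: "norm B = 1"
proof -
  have "inner B B = (LINT x|\<mu>. 1)"
    unfolding inner_B evl_B using a_pos by (simp add: less_imp_neq [symmetric])
  then show ?thesis by (simp add: norm_eq_sqrt_inner prob_space)
qed

lemma a_ge_1: "a x \<ge> 1"
  using abs_evl_le [of B x] a_pos [of x] by (simp add: evl_B norm_B field_simps)

text \<open>Since \<open>a\<close> is at least 1, the integral defining \<open>1 / a y\<close> is at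
  least \<open>\<delta>\<close>. The bound depends on the measure only through \<open>S\<close>,
  hence is uniform along an admissible path.\<close>

lemma a_le:
  assumes S: "AE x in \<mu>. x \<in> S" and y: "y \<in> S"
    and \<delta>: "0 < \<delta>" "\<And>x y. x \<in> S \<Longrightarrow> y \<in> S \<Longrightarrow> \<delta> \<le> k_c \<epsilon> x y"
  shows "a y \<le> 1 / \<delta>"
proof -
  have "(LINT x|\<mu>. \<delta>) \<le> (LINT x|\<mu>. a x * k_c \<epsilon> x y)"
  proof (rule integral_mono_AE)
    show "AE x in \<mu>. \<delta> \<le> a x * k_c \<epsilon> x y"
      using S
    proof eventually_elim
      case (elim x)
      then have "1 * \<delta> \<le> a x * k_c \<epsilon> x y"
        using \<delta> y a_ge_1 [of x] a_pos [of x] by (intro mult_mono) (auto intro: less_imp_le)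
      then show ?case by simp
    qed
  qed (intro integrable_cont continuous_intros continuous_kc continuous_a)+
  then show ?thesis
    using \<delta>(1) a_pos [of y] by (simp add: a_eq prob_space field_simps)
qed

end

section \<open>The metric tensor\<close>

context bounded_prob
begin

lemma integrable_mult_cont:
  fixes G :: "'a \<Rightarrow> 'b::{banach,second_countable_topology}"
  assumes f: "integrable \<mu> f" and G: "continuous_on UNIV G"
  shows "integrable \<mu> (\<lambda>x. f x *\<^sub>R G x)"
proof -
  obtain S where S: "bounded S" "AE x in \<mu>. x \<in> S"
    using bounded_support by (auto simp: bounded_support_def)
  have "compact (G ` closure S)"
    using S G by (intro compact_continuous_image continuous_on_subset [OF G]) (auto simp: compact_closure)
  then obtain b where b: "\<And>x. x \<in> closure S \<Longrightarrow> norm (G x) \<le> b"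
    by (meson bounded_iff compact_imp_bounded imageI)
  show ?thesis
  proof (rule Bochner_Integration.integrable_bound)
    show "integrable \<mu> (\<lambda>x. b * f x)" using f by simp
    show "(\<lambda>x. f x *\<^sub>R G x) \<in> borel_measurable \<mu>"
      using f integrable_cont [OF G] by (intro borel_measurable_scaleR) auto
    show "AE x in \<mu>. norm (f x *\<^sub>R G x) \<le> norm (b * f x)"
      using S(2)
    proof eventually_elim
      case (elim x)
      then have "norm (G x) \<le> \<bar>b\<bar>" using b [of x] closure_subset [of S] by force
      then show ?case
        using mult_left_mono [of "norm (G x)" "\<bar>b\<bar>" "\<bar>f x\<bar>"] by (simp add: abs_mult mult.commute)
    qed
  qed
qed

section \<open>A self-adjoint counterpart of \<open>K_op\<close> on the Hilbert space and its
  spectral gap\<close>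

definition T :: "'h \<Rightarrow> 'h" where
  "T g = emb (\<lambda>x. (a x)\<^sup>2 * evl g x)"

lemma continuous_T_integrand: "continuous_on UNIV (\<lambda>x. (a x)\<^sup>2 * evl g x)"
  by (intro continuous_intros continuous_a continuous_evl)

lemma inner_T: "inner g (T h) = (LINT x|\<mu>. (a x)\<^sup>2 * evl h x * evl g x)"
  by (simp add: T_def inner_emb continuous_T_integrand)

lemma T_sym: "inner (T g) h = inner g (T h)"
  unfolding inner_commute [of "T g"] inner_T by (simp add: ac_simps)

lemma evl_T: "evl (T g) y = (LINT x|\<mu>. (a x)\<^sup>2 * evl g x * k_c \<epsilon> x y)"
  by (simp add: T_def evl_emb continuous_T_integrand)

lemma T_add: "T (g + h) = T g + T h"
  unfolding T_def evl_add distrib_left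
  by (intro emb_add continuous_intros continuous_a continuous_evl)

lemma T_scaleR: "T (c *\<^sub>R g) = c *\<^sub>R T g"
proof -
  have "(\<lambda>x. (a x)\<^sup>2 * evl (c *\<^sub>R g) x) = (\<lambda>x. c * ((a x)\<^sup>2 * evl g x))"
    by (simp add: evl_scaleR ac_simps)
  then show ?thesis by (simp add: T_def emb_scale)
qed

lemma T_diff: "T (g - h) = T g - T h"
  using T_add [of g "(-1) *\<^sub>R h"] T_scaleR [of "-1" h] by simp

lemma T_B: "T B = B"
proof -
  have "(\<lambda>x. (a x)\<^sup>2 * evl B x) = a"
    using a_pos by (simp add: fun_eq_iff evl_B power2_eq_square less_imp_neq [symmetric])
  then show ?thesis by (simp add: T_def B_eq_emb)
qed

lemma T_orth: "inner g B = 0 \<Longrightarrow> inner (T g) B = 0"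
  by (simp add: T_sym T_B)

text \<open>This is the spectral gap of the Markov operator with symmetric kernel \<open>k_mu\<close>, whose density
  is bounded below: the Dirichlet form dominates a multiple of the variance.\<close>

lemma T_spectral_gap:
  obtains \<delta> where "0 < \<delta>" "\<delta> \<le> 1"
    "\<And>g. inner g B = 0 \<Longrightarrow> (norm (T g))\<^sup>2 \<le> (1 - \<delta>) * inner g (T g)"
proof -
  obtain S where S: "bounded S" "AE x in \<mu>. x \<in> S"
    using bounded_support by (auto simp: bounded_support_def)
  obtain \<delta> where \<delta>: "0 < \<delta>" "\<delta> \<le> 1" "\<And>x y. x \<in> S \<Longrightarrow> y \<in> S \<Longrightarrow> \<delta> \<le> k_c \<epsilon> x y"
    using kernel_lower_bound [OF S(1)] by blast
  have "(norm (T g))\<^sup>2 \<le> (1 - \<delta>) * inner g (T g)" if g: "inner g B = 0" for g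
  proof -
    define \<psi> where "\<psi> x = a x * evl g x" for x
    have \<psi>c: "continuous_on UNIV \<psi>"
      unfolding \<psi>_def [abs_def] by (intro continuous_intros continuous_a continuous_evl)
    define P where "P = inner g (T g)"
    \<comment> \<open>\<open>Q\<close> collects the terms with \<open>(\<psi> x)\<^sup>2\<close>
      when the square of a difference is integrated in \<open>x\<close>. Its pairing with
      \<open>B\<close> is \<open>P\<close> again: the Markov kernel preserves
      \<open>\<mu>\<close>.\<close>
    define Q where "Q = emb (\<lambda>x. a x * (\<psi> x)\<^sup>2)"
    have Qc: "continuous_on UNIV (\<lambda>x. a x * (\<psi> x)\<^sup>2)"
      by (intro continuous_intros continuous_a \<psi>c)
    have ic: "integrable \<mu> f" if "continuous_on UNIV f" for f :: "'a \<Rightarrow> real"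
      using that by (rule integrable_cont)
    have int_\<psi>: "(LINT x|\<mu>. \<psi> x) = 0"
      using g by (simp add: inner_B \<psi>_def)
    have int_\<psi>2: "(LINT x|\<mu>. (\<psi> x)\<^sup>2) = P"
      unfolding P_def inner_T \<psi>_def by (simp add: power2_eq_square ac_simps)
    have QB: "inner B Q = P"
    proof -
      have "a x * (\<psi> x)\<^sup>2 * evl B x = (\<psi> x)\<^sup>2" for x
        using a_pos [of x] by (simp add: evl_B)
      then show ?thesis
        unfolding Q_def inner_emb [OF Qc] by (simp only: int_\<psi>2)
    qed
    \<comment> \<open>The kernel \<open>k_mu\<close> dominates \<open>\<delta>\<close> on
      \<open>S\<close>, so \<open>\<delta> * (\<psi> x - \<psi> y)\<^sup>2\<close> can be compared
      with its weighted version and integrated in \<open>x\<close>. The left side simplifies because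
      \<open>\<psi>\<close> has mean zero; on the right the scaling equation turns the last term
      into \<open>(\<psi> y)\<^sup>2\<close>.\<close>
    have pointwise: "\<delta> * (P + (\<psi> y)\<^sup>2) \<le> a y * evl Q y - 2 * ((a y)\<^sup>2 * evl g y * evl (T g) y) + (\<psi> y)\<^sup>2"
      if y: "y \<in> S" for y
    proof -
      have "(LINT x|\<mu>. \<delta> * (\<psi> x - \<psi> y)\<^sup>2) \<le> (LINT x|\<mu>. a y * (a x * k_c \<epsilon> x y) * (\<psi> x - \<psi> y)\<^sup>2)"
      proof (rule integral_mono_AE)
        show "AE x in \<mu>. \<delta> * (\<psi> x - \<psi> y)\<^sup>2 \<le> a y * (a x * k_c \<epsilon> x y) * (\<psi> x - \<psi> y)\<^sup>2"
          using S(2)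
        proof eventually_elim
          case (elim x)
          have "1 * (1 * \<delta>) \<le> a y * (a x * k_c \<epsilon> x y)"
            using a_ge_1 [of x] a_ge_1 [of y] \<delta>(1) \<delta>(3) [OF elim y]
            by (intro mult_mono) auto
          then show ?case by (intro mult_right_mono) auto
        qed
      qed (intro ic continuous_intros \<psi>c continuous_a continuous_kc)+
      also have "(LINT x|\<mu>. \<delta> * (\<psi> x - \<psi> y)\<^sup>2) = \<delta> * (P + (\<psi> y)\<^sup>2)"
      proof -
        have "(LINT x|\<mu>. (\<psi> x - \<psi> y)\<^sup>2) = (LINT x|\<mu>. (\<psi> x)\<^sup>2 - 2 * \<psi> y * \<psi> x + (\<psi> y)\<^sup>2)"
          by (simp add: power2_diff algebra_simps)
        also have "\<dots> = P + (\<psi> y)\<^sup>2"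
          using int_\<psi> int_\<psi>2 by (simp add: ic continuous_intros \<psi>c prob_space)
        finally show ?thesis by simp
      qed
      also have "(LINT x|\<mu>. a y * (a x * k_c \<epsilon> x y) * (\<psi> x - \<psi> y)\<^sup>2) =
          (LINT x|\<mu>. a y * (a x * (\<psi> x)\<^sup>2 * k_c \<epsilon> x y) - 2 * \<psi> y * a y * ((a x)\<^sup>2 * evl g x * k_c \<epsilon> x y)
            + (\<psi> y)\<^sup>2 * a y * (a x * k_c \<epsilon> x y))"
        by (rule Bochner_Integration.integral_cong) (simp_all add: \<psi>_def power2_eq_square algebra_simps)
      also have "\<dots> = a y * evl Q y - 2 * \<psi> y * a y * evl (T g) y + (\<psi> y)\<^sup>2 * a y * (1 / a y)"
      proof -
        have i1: "integrable \<mu> (\<lambda>x. a x * (\<psi> x)\<^sup>2 * k_c \<epsilon> x y)"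
          and i2: "integrable \<mu> (\<lambda>x. (a x)\<^sup>2 * evl g x * k_c \<epsilon> x y)"
          and i3: "integrable \<mu> (\<lambda>x. a x * k_c \<epsilon> x y)"
          by (intro ic continuous_intros \<psi>c continuous_a continuous_kc continuous_evl)+
        show ?thesis
          unfolding evl_T Q_def evl_emb [OF Qc] a_eq [symmetric]
          using i1 i2 i3 by simp
      qed
      finally show ?thesis
        using a_pos [of y] by (simp add: \<psi>_def power2_eq_square algebra_simps)
    qed
    \<comment> \<open>Integrating in \<open>y\<close> too gives \<open>2 * \<delta> * P\<close> on
      the left and twice \<open>P - (norm (T g))\<^sup>2\<close> on the right.\<close>
    have "(LINT y|\<mu>. \<delta> * (P + (\<psi> y)\<^sup>2)) \<le>
        (LINT y|\<mu>. a y * evl Q y - 2 * ((a y)\<^sup>2 * evl g y * evl (T g) y) + (\<psi> y)\<^sup>2)"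
    proof (rule integral_mono_AE)
      show "AE y in \<mu>. \<delta> * (P + (\<psi> y)\<^sup>2) \<le> a y * evl Q y - 2 * ((a y)\<^sup>2 * evl g y * evl (T g) y) + (\<psi> y)\<^sup>2"
        using S(2) by eventually_elim (rule pointwise)
    qed (intro ic continuous_intros \<psi>c continuous_a continuous_evl)+
    also have "(LINT y|\<mu>. \<delta> * (P + (\<psi> y)\<^sup>2)) = \<delta> * (P + P)"
      using int_\<psi>2 by (simp add: ic continuous_intros \<psi>c prob_space)
    also have "(LINT y|\<mu>. a y * evl Q y - 2 * ((a y)\<^sup>2 * evl g y * evl (T g) y) + (\<psi> y)\<^sup>2) =
        inner Q B - 2 * inner (T g) (T g) + P"
    proof -
      have i1: "integrable \<mu> (\<lambda>y. a y * evl Q y)"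
        and i2: "integrable \<mu> (\<lambda>y. (a y)\<^sup>2 * evl g y * evl (T g) y)"
        and i3: "integrable \<mu> (\<lambda>y. (\<psi> y)\<^sup>2)"
        by (intro ic continuous_intros \<psi>c continuous_a continuous_evl)+
      show ?thesis
        unfolding inner_B inner_T [of "T g"] int_\<psi>2 [symmetric] using i1 i2 i3 by simp
    qed
    finally have "\<delta> * (P + P) \<le> P - 2 * inner (T g) (T g) + P"
      using QB by (simp add: inner_commute)
    then show ?thesis
      by (simp add: power2_norm_eq_inner P_def algebra_simps)
  qed
  with \<delta>(1,2) show ?thesis using that by blast
qed

lemma inner_T_self_nonneg: "inner g (T g) \<ge> 0"
  unfolding inner_T by (intro integral_nonneg_AE AE_I2) (simp add: mult.assoc)

lemma T_contraction:
  obtains c where "0 \<le> c" "c < 1" "\<And>g. inner g B = 0 \<Longrightarrow> norm (T g) \<le> c * norm g"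
proof -
  obtain \<delta> where \<delta>: "0 < \<delta>" "\<delta> \<le> 1"
    "\<And>g. inner g B = 0 \<Longrightarrow> (norm (T g))\<^sup>2 \<le> (1 - \<delta>) * inner g (T g)"
    using T_spectral_gap by blast
  have "norm (T g) \<le> (1 - \<delta>) * norm g" if "inner g B = 0" for g
  proof (cases "T g = 0")
    case False
    have "norm (T g) * norm (T g) \<le> (1 - \<delta>) * inner g (T g)"
      using \<delta>(3) [OF that] by (simp add: power2_eq_square)
    also have "\<dots> \<le> (1 - \<delta>) * (norm g * norm (T g))"
      using \<delta> by (intro mult_left_mono norm_cauchy_schwarz) auto
    finally have "norm (T g) * norm (T g) \<le> ((1 - \<delta>) * norm g) * norm (T g)"
      by (simp add: mult.assoc)
    then show ?thesis using False by simp
  qed (use \<delta> in simp)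
  then show ?thesis using \<delta> that [of "1 - \<delta>"] by simp
qed

text \<open>The component of \<open>P\<close> orthogonal to \<open>B\<close> is again fixed, yet
  strictly contracted, so it vanishes: the eigenvalue 1 is simple.\<close>

lemma T_fixed: assumes "T P = P" shows "P = inner P B *\<^sub>R B"
proof -
  obtain c where c: "0 \<le> c" "c < 1" "\<And>g. inner g B = 0 \<Longrightarrow> norm (T g) \<le> c * norm g"
    using T_contraction by blast
  define P0 where "P0 = P - inner P B *\<^sub>R B"
  have "inner P0 B = 0"
    using norm_B by (simp add: P0_def inner_diff_left flip: power2_norm_eq_inner)
  moreover have "T P0 = P0"
    by (simp add: P0_def T_diff T_scaleR T_B assms)
  ultimately have "norm P0 \<le> c * norm P0"
    using c(3) by metis
  then have "norm P0 = 0"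
    using c(2) mult_strict_right_mono [of c 1 "norm P0"] by fastforce
  then show ?thesis by (simp add: P0_def)
qed

section \<open>The resolvent and a closed form of the metric tensor\<close>

lemma resolvent_exists:
  assumes "inner h B = 0"
  obtains u where "inner u B = 0" "u - T u = h"
proof -
  obtain c where c: "0 \<le> c" "c < 1" "\<And>g. inner g B = 0 \<Longrightarrow> norm (T g) \<le> c * norm g"
    using T_contraction by blast
  let ?S = "{u. inner u B = 0}"
  have "closed ?S"
    by (intro closed_Collect_eq continuous_intros)
  then have "\<exists>!u\<in>?S. h + T u = u"
  proof (intro Banach_fix [OF _ _ c(1,2)])
    show "?S \<noteq> {}" by (auto intro: exI [of _ 0])
    show "(\<lambda>u. h + T u) ` ?S \<subseteq> ?S"
      using assms by (auto simp: inner_add_left T_orth)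
    show "dist (h + T x) (h + T y) \<le> c * dist x y" if "x \<in> ?S" "y \<in> ?S" for x y
      using that c(3) [of "x - y"] by (simp add: dist_norm inner_diff_left T_diff)
  qed (simp add: complete_eq_closed)
  then obtain u where "inner u B = 0" "h + T u = u" by blast
  then show ?thesis using that by (simp add: algebra_simps)
qed

text \<open>Multiplication by \<open>a\<close> intertwines \<open>T\<close> with
  \<open>K_op\<close>. The inversion problem on \<open>L2\<close> thereby becomes one in the Hilbert
  space, where translations act unitarily.\<close>

lemma K_op_eq: "K_op \<epsilon> \<mu> (\<lambda>x. a x * evl u x) y = a y * evl (T u) y"
proof -
  have "a x * evl u x * k_mu \<epsilon> \<mu> x y = a y * ((a x)\<^sup>2 * evl u x * k_c \<epsilon> x y)" for x
    by (simp add: k_mu_def power2_eq_square ac_simps)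
  then show ?thesis by (simp only: K_op_def evl_T integral_mult_right_zero)
qed

lemma L2_imp_integrable: assumes "in_L2 \<mu> f" shows "integrable \<mu> f"
proof (rule Bochner_Integration.integrable_bound)
  show "integrable \<mu> (\<lambda>x. 1 + (f x)\<^sup>2)"
    using assms by (simp add: in_L2_def)
  have "\<bar>f x\<bar> \<le> 1 + (f x)\<^sup>2" for x
    using zero_le_power2 [of "\<bar>f x\<bar> - 1/2"] by (simp add: power2_diff power_divide)
  then show "AE x in \<mu>. norm (f x) \<le> norm (1 + (f x)\<^sup>2)"
    by (simp add: abs_of_nonneg)
qed (use assms in \<open>simp add: in_L2_def\<close>)

lemma L2_cont: assumes "continuous_on UNIV f" shows "in_L2 \<mu> f"
  using integrable_cont [OF assms] assms
  by (auto simp: in_L2_def intro!: integrable_cont continuous_intros)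

text \<open>A representative of the inverse in \<open>L\<^sup>2(\<mu>)\<close> modulo constants is \<open>a u\<close> where \<open>u\<close> solves the
  corresponding equation in the Hilbert space; any other one differs by a constant.\<close>

lemma pairing_id_minus_K_inverse:
  assumes h: "inner h B = 0" and u: "u - T u = h"
  shows "(LINT x|\<mu>. a x * evl h x * id_minus_K_inverse \<epsilon> \<mu> (\<lambda>x. a x * evl h x) x) = inner h (T u)"
proof -
  define \<phi> where "\<phi> = (\<lambda>x. a x * evl h x)"
  define \<psi>0 where "\<psi>0 = (\<lambda>x. a x * evl u x)"
  define \<psi> where "\<psi> = id_minus_K_inverse \<epsilon> \<mu> \<phi>"
  have \<phi>c: "continuous_on UNIV \<phi>" and \<psi>0c: "continuous_on UNIV \<psi>0"
    unfolding \<phi>_def \<psi>0_def by (intro continuous_intros continuous_a continuous_evl)+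
  have K0: "\<psi>0 y - K_op \<epsilon> \<mu> \<psi>0 y = \<phi> y" for y
  proof -
    have "\<psi>0 y - K_op \<epsilon> \<mu> \<psi>0 y = a y * evl (u - T u) y"
      unfolding \<psi>0_def K_op_eq by (simp add: evl_diff algebra_simps)
    then show ?thesis by (simp add: u \<phi>_def)
  qed
  have "in_L2 \<mu> \<psi>0 \<and> (\<exists>c. AE y in \<mu>. \<psi>0 y - K_op \<epsilon> \<mu> \<psi>0 y = \<phi> y + c)"
    using K0 L2_cont [OF \<psi>0c] by (auto intro: exI [of _ 0])
  then have "in_L2 \<mu> \<psi> \<and> (\<exists>c. AE y in \<mu>. \<psi> y - K_op \<epsilon> \<mu> \<psi> y = \<phi> y + c)"
    unfolding \<psi>_def id_minus_K_inverse_def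
    by (rule someI [where P = "\<lambda>\<psi>. in_L2 \<mu> \<psi> \<and> (\<exists>c. AE y in \<mu>. \<psi> y - K_op \<epsilon> \<mu> \<psi> y = \<phi> y + c)"])
  then obtain c where \<psi>L2: "in_L2 \<mu> \<psi>" and K: "AE y in \<mu>. \<psi> y - K_op \<epsilon> \<mu> \<psi> y = \<phi> y + c"
    by blast
  define \<xi> where "\<xi> x = \<psi> x - \<psi>0 x" for x
  have \<psi>i: "integrable \<mu> \<psi>" using L2_imp_integrable [OF \<psi>L2] .
  have \<xi>i: "integrable \<mu> \<xi>"
    unfolding \<xi>_def [abs_def] using \<psi>i integrable_cont [OF \<psi>0c] by (rule Bochner_Integration.integrable_diff)
  \<comment> \<open>The chosen representative is only an \<open>L2\<close> function, so
    \<open>\<xi>\<close> need not belong to the space. Embedding \<open>a\<close> times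
    \<open>\<xi>\<close> repairs this: \<open>K_op\<close> applied to \<open>\<xi>\<close> is
    \<open>a\<close> times \<open>P\<close>, so \<open>\<xi>\<close> equals \<open>a\<close> times
    \<open>P\<close> up to the constant \<open>c\<close>, almost everywhere.\<close>
  define P where "P = (LINT x|\<mu>. \<xi> x *\<^sub>R (a x *\<^sub>R kx x))"
  have akc: "continuous_on UNIV (\<lambda>x. a x *\<^sub>R kx x)"
    by (intro continuous_intros continuous_a continuous_kx)
  have Pg: "inner P g = (LINT x|\<mu>. \<xi> x * (a x * evl g x))" for g
    unfolding P_def using integrable_mult_cont [OF \<xi>i akc]
    by (cases "g = 0") (simp_all add: inner_kx_left evl_zero mult.assoc flip: integral_inner_left)
  have evlP: "evl P y = (LINT x|\<mu>. \<xi> x * (a x * k_c \<epsilon> x y))" for y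
    by (simp add: evl_eq_inner [of P] Pg evl_kx kc_sym [of y])
  have \<xi>K: "AE y in \<mu>. \<xi> y = a y * evl P y + c"
    using K
  proof eventually_elim
    case (elim y)
    have kc: "continuous_on UNIV (\<lambda>x. k_mu \<epsilon> \<mu> x y)"
      unfolding k_mu_def by (intro continuous_intros continuous_a continuous_kc)
    have "K_op \<epsilon> \<mu> \<psi> y - K_op \<epsilon> \<mu> \<psi>0 y = (LINT x|\<mu>. \<xi> x * k_mu \<epsilon> \<mu> x y)"
      unfolding K_op_def \<xi>_def
      using integrable_mult_cont [OF \<psi>i kc] integrable_mult_cont [OF integrable_cont [OF \<psi>0c] kc]
      by (simp add: left_diff_distrib)
    also have "\<dots> = (LINT x|\<mu>. a y * (\<xi> x * (a x * k_c \<epsilon> x y)))"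
      by (simp add: k_mu_def ac_simps)
    also have "\<dots> = a y * evl P y"
      by (simp add: evlP)
    finally show ?case
      using elim K0 [of y] by (simp add: \<xi>_def)
  qed
  have aPc: "continuous_on UNIV (\<lambda>y. a y * evl P y)"
    by (intro continuous_intros continuous_a continuous_evl)
  \<comment> \<open>Integration removes the unknown constant, since the Markov operator preserves
    the integral.\<close>
  have "(LINT y|\<mu>. \<xi> y) = (LINT y|\<mu>. a y * evl P y + c)"
    using \<xi>i integrable_cont [OF aPc] by (intro integral_cong_AE \<xi>K) auto
  also have "\<dots> = inner P B + c"
    using integrable_cont [OF aPc] by (simp add: inner_B prob_space)
  also have "inner P B = (LINT y|\<mu>. \<xi> y)"
    unfolding Pg evl_B using a_pos by (simp add: less_imp_neq [symmetric])
  finally have "c = 0" by simp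
  then have \<xi>P: "AE y in \<mu>. \<xi> y = a y * evl P y"
    using \<xi>K by simp
  have "P = (LINT x|\<mu>. ((a x)\<^sup>2 * evl P x) *\<^sub>R kx x)"
  proof -
    have "(LINT x|\<mu>. \<xi> x *\<^sub>R (a x *\<^sub>R kx x)) = (LINT x|\<mu>. ((a x)\<^sup>2 * evl P x) *\<^sub>R kx x)"
    proof (rule integral_cong_AE)
      show "AE x in \<mu>. \<xi> x *\<^sub>R (a x *\<^sub>R kx x) = ((a x)\<^sup>2 * evl P x) *\<^sub>R kx x"
        using \<xi>P by eventually_elim (simp add: power2_eq_square ac_simps)
      show "(\<lambda>x. \<xi> x *\<^sub>R (a x *\<^sub>R kx x)) \<in> borel_measurable \<mu>"
        using integrable_mult_cont [OF \<xi>i akc] by (rule borel_measurable_integrable)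
      show "(\<lambda>x. ((a x)\<^sup>2 * evl P x) *\<^sub>R kx x) \<in> borel_measurable \<mu>"
        by (intro borel_measurable_integrable integrable_cont continuous_intros continuous_a continuous_evl continuous_kx)
    qed
    then show ?thesis by (simp only: P_def [symmetric])
  qed
  then have "T P = P" by (simp add: T_def emb_def)
  \<comment> \<open>\<open>P\<close> is a multiple of \<open>B\<close>, and \<open>a\<close> times
    \<open>B\<close> is identically 1, so \<open>\<xi>\<close> is almost everywhere
    constant.\<close>
  then have Pc: "P = inner P B *\<^sub>R B" by (rule T_fixed)
  have const: "a y * evl P y = inner P B" for y
    using a_pos [of y] by (subst Pc) (simp add: evl_scaleR evl_B)
  \<comment> \<open>The constant by which the two representatives differ pairs to zero with
    \<open>\<phi>\<close>, whose mean vanishes.\<close>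
  have "(LINT x|\<mu>. \<phi> x * \<psi> x) = (LINT x|\<mu>. \<phi> x * \<psi>0 x + \<phi> x * inner P B)"
  proof (rule integral_cong_AE)
    show "AE x in \<mu>. \<phi> x * \<psi> x = \<phi> x * \<psi>0 x + \<phi> x * inner P B"
      using \<xi>P
    proof eventually_elim
      case (elim x)
      then have "\<psi> x = \<psi>0 x + inner P B" by (simp add: const \<xi>_def)
      then show ?case by (simp add: distrib_left)
    qed
    show "(\<lambda>x. \<phi> x * \<psi> x) \<in> borel_measurable \<mu>"
      using integrable_cont [OF \<phi>c] \<psi>i by (intro borel_measurable_times) auto
    show "(\<lambda>x. \<phi> x * \<psi>0 x + \<phi> x * inner P B) \<in> borel_measurable \<mu>"
      by (intro borel_measurable_integrable integrable_cont continuous_intros \<phi>c \<psi>0c)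
  qed
  also have "\<dots> = (LINT x|\<mu>. \<phi> x * \<psi>0 x) + (LINT x|\<mu>. \<phi> x) * inner P B"
  proof -
    have "integrable \<mu> (\<lambda>x. \<phi> x * \<psi>0 x)" "integrable \<mu> \<phi>"
      by (intro integrable_cont continuous_intros \<phi>c \<psi>0c)+
    then show ?thesis by simp
  qed
  also have "(LINT x|\<mu>. \<phi> x) = 0"
    using h by (simp add: \<phi>_def inner_B)
  also have "(LINT x|\<mu>. \<phi> x * \<psi>0 x) = inner h (T u)"
    unfolding inner_T by (simp add: \<phi>_def \<psi>0_def power2_eq_square ac_simps)
  finally show ?thesis by (simp add: \<psi>_def \<phi>_def)
qed

lemma g_tilde_eq:
  assumes "inner h B = 0" "u - T u = h"
  shows "g_tilde \<epsilon> evl \<mu> h = \<epsilon> / 2 * inner h (u + T u)"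
proof -
  have "inner h (u + T u) = (norm h)\<^sup>2 + 2 * inner h (T u)"
  proof -
    have "u + T u = h + 2 *\<^sub>R T u" using assms(2) by (auto simp: scaleR_2)
    then show ?thesis by (simp add: inner_add_right power2_norm_eq_inner)
  qed
  then show ?thesis
    using pairing_id_minus_K_inverse [OF assms] by (simp add: g_tilde_def)
qed

text \<open>For \<open>h = u - T u\<close> the nonlocal part is
  \<open>inner u (T u) - (norm (T u))\<^sup>2\<close>, nonnegative by the spectral gap. This gives
  the coercivity behind the lower energy bound, and ensures that \<open>ennreal\<close> does not
  truncate the integrand of the energy.\<close>

lemma g_tilde_ge:
  assumes h: "inner h B = 0"
  shows "g_tilde \<epsilon> evl \<mu> h \<ge> \<epsilon> / 2 * (norm h)\<^sup>2"
proof -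
  obtain u where u: "inner u B = 0" "u - T u = h"
    using resolvent_exists [OF h] by blast
  obtain \<delta> where \<delta>: "0 < \<delta>" "\<delta> \<le> 1" "(norm (T u))\<^sup>2 \<le> (1 - \<delta>) * inner u (T u)"
    using T_spectral_gap u(1) by metis
  have "(1 - \<delta>) * inner u (T u) \<le> 1 * inner u (T u)"
    using \<delta> inner_T_self_nonneg by (intro mult_right_mono) auto
  then have "inner h (T u) \<ge> 0"
    using \<delta>(3) unfolding u(2) [symmetric] by (simp add: inner_diff_left power2_norm_eq_inner)
  moreover have "inner h (u + T u) = (norm h)\<^sup>2 + 2 * inner h (T u)"
  proof -
    have "u + T u = h + 2 *\<^sub>R T u" using u(2) by (auto simp: scaleR_2)
    then show ?thesis by (simp add: inner_add_right power2_norm_eq_inner)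
  qed
  ultimately show ?thesis
    unfolding g_tilde_eq [OF h u(2)] using eps_pos by (intro mult_left_mono) auto
qed

end

subsection \<open>Infinitesimal translations\<close>

context bounded_prob
begin

definition M :: "'a \<Rightarrow> 'h" where
  "M w = emb (\<lambda>x. a x * inner w x)"

definition N :: "'a \<Rightarrow> 'h" where
  "N w = (LINT x|\<mu>. a x *\<^sub>R nx w x)"

text \<open>The derivative of \<open>shift (s *\<^sub>R w) B\<close> at \<open>s = 0\<close>,
  obtained by differentiating each kernel function in the embedding; as a function it is minus the
  derivative of \<open>B\<close> along \<open>w\<close>.\<close>

definition \<Gamma> :: "'a \<Rightarrow> 'h" where
  "\<Gamma> w = (LINT x|\<mu>. a x *\<^sub>R dk w x)"

lemma continuous_M_integrand: "continuous_on UNIV (\<lambda>x. a x * inner w x)"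
  by (intro continuous_intros continuous_a)

lemma inner_M: "inner g (M w) = (LINT x|\<mu>. a x * inner w x * evl g x)"
  by (simp add: M_def inner_emb continuous_M_integrand)

lemma inner_N: "inner g (N w) = (LINT x|\<mu>. a x * inner g (nx w x))"
  unfolding inner_commute [of g] N_def
  by (subst inner_integral) (auto intro!: continuous_intros continuous_a continuous_nx)

lemma inner_\<Gamma>: "inner g (\<Gamma> w) = (LINT x|\<mu>. a x * inner g (dk w x))"
  unfolding inner_commute [of g] \<Gamma>_def
  by (subst inner_integral) (auto intro!: continuous_intros continuous_a continuous_dk)

lemma evl_N: "evl (N w) y = inner w y * evl B y"
proof -
  have "evl (N w) y = (LINT x|\<mu>. a x * evl (nx w x) y)"
    using inner_N [of "kx y" w] by (simp add: inner_kx_left)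
  also have "\<dots> = (LINT x|\<mu>. inner w y * (a x * k_c \<epsilon> x y))"
    by (simp add: evl_nx ac_simps)
  finally show ?thesis by (simp add: a_eq evl_B)
qed

lemma T_N: "T (N w) = M w"
proof -
  have "(\<lambda>x. (a x)\<^sup>2 * evl (N w) x) = (\<lambda>x. a x * inner w x)"
    using a_pos by (simp add: fun_eq_iff evl_N evl_B power2_eq_square less_imp_neq [symmetric])
  then show ?thesis by (simp add: T_def M_def)
qed

lemma N_eq: "N w = M w + (\<epsilon> / 2) *\<^sub>R \<Gamma> w"
proof -
  have "N w = (LINT x|\<mu>. (a x * inner w x) *\<^sub>R kx x + (\<epsilon> / 2) *\<^sub>R (a x *\<^sub>R dk w x))"
    unfolding N_def nx_def by (simp add: scaleR_right_distrib mult.commute)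
  also have "\<dots> = M w + (\<epsilon> / 2) *\<^sub>R \<Gamma> w"
  proof -
    have i: "integrable \<mu> (\<lambda>x. (a x * inner w x) *\<^sub>R kx x)" "integrable \<mu> (\<lambda>x. (\<epsilon> / 2) *\<^sub>R (a x *\<^sub>R dk w x))"
      by (intro integrable_cont continuous_intros continuous_a continuous_kx continuous_dk)+
    show ?thesis
      unfolding M_def emb_def \<Gamma>_def
      by (simp only: Bochner_Integration.integral_add [OF i] integral_scaleR_right)
  qed
  finally show ?thesis .
qed

lemma \<Gamma>_eq: "\<Gamma> w = (2 / \<epsilon>) *\<^sub>R (N w - M w)"
  using eps_pos by (simp add: N_eq)

text \<open>Translations keep \<open>B\<close> on the unit sphere, so the velocity is tangent to it.
  Algebraically: \<open>M\<close> is \<open>T\<close> applied to \<open>N\<close>, and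
  \<open>T\<close> is symmetric and fixes \<open>B\<close>.\<close>

lemma inner_\<Gamma>_B: "inner (\<Gamma> w) B = 0"
proof -
  have "inner (M w) B = inner (N w) B"
    using T_sym [of "N w" B] by (simp add: T_N T_B)
  then show ?thesis by (simp add: \<Gamma>_eq inner_diff_left)
qed

lemma inner_M_B: "inner (M w) B = inner w (LINT x|\<mu>. x)"
proof -
  have "inner B (M w) = (LINT x|\<mu>. inner w x)"
    unfolding inner_M evl_B using a_pos by (simp add: less_imp_neq [symmetric])
  also have "\<dots> = inner w (LINT x|\<mu>. x)"
    by (intro integral_inner_right integrable_cont continuous_intros)
  finally show ?thesis by (simp add: inner_commute)
qed

lemma evl_has_derivative_line:
  "((\<lambda>s. evl g (x + s *\<^sub>R w)) has_field_derivative inner g (dk w x)) (at 0)"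
proof -
  have "((\<lambda>s. inner g (kx (x + s *\<^sub>R w))) has_vector_derivative inner g (dk w (x + 0 *\<^sub>R w))) (at 0)"
    by (rule bounded_linear.has_vector_derivative [OF bounded_linear_inner_right kx_has_vector_derivative])
  then show ?thesis
    by (simp add: has_real_derivative_iff_has_vector_derivative evl_eq_inner [symmetric])
qed

text \<open>The derivative of the Gaussian is antisymmetric under exchange of its two arguments;
  hence the sign.\<close>

lemma inner_B_dk: "inner B (dk w x) = - evl (\<Gamma> w) x"
proof -
  have "inner B (dk w x) = (LINT z|\<mu>. a z * evl (dk w x) z)"
    using inner_B [of "dk w x"] by (simp add: inner_commute)
  also have "\<dots> = (LINT z|\<mu>. - (a z * evl (dk w z) x))"
    by (simp add: evl_dk kc_sym [of x] inner_diff_right algebra_simps)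
  also have "\<dots> = - evl (\<Gamma> w) x"
    using inner_\<Gamma> [of "kx x" w] by (simp add: inner_kx_left)
  finally show ?thesis .
qed

text \<open>As a function \<open>N w\<close> is \<open>inner w\<close> times \<open>B\<close>, so
  its derivative along \<open>w\<close> follows from the Leibniz rule. Differentiating the linear
  factor produces \<open>(norm w)\<^sup>2\<close>, the source of that term in the whole
  result.\<close>

lemma inner_N_nx: "inner (N w) (nx w x) = \<epsilon> / 2 * (norm w)\<^sup>2 * evl B x + inner w x * evl (M w) x"
proof -
  have "((\<lambda>s. evl (N w) (x + s *\<^sub>R w)) has_field_derivative
      (norm w)\<^sup>2 * evl B x + inner w x * inner B (dk w x)) (at 0)"
    unfolding evl_N
    by (rule derivative_eq_intros evl_has_derivative_line refl | simp add: inner_add_right power2_norm_eq_inner)+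
  then have "inner (N w) (dk w x) = (norm w)\<^sup>2 * evl B x - inner w x * evl (\<Gamma> w) x"
    using DERIV_unique [OF evl_has_derivative_line [of "N w" x w]] by (simp add: inner_B_dk)
  then have "inner (N w) (nx w x) =
      inner w x * evl (N w) x + \<epsilon> / 2 * ((norm w)\<^sup>2 * evl B x - inner w x * evl (\<Gamma> w) x)"
    by (simp add: nx_def inner_add_right flip: evl_eq_inner)
  then show ?thesis
    using eps_pos by (simp add: N_eq evl_simps algebra_simps)
qed

lemma norm_N_M: "inner (N w) (N w) - inner (M w) (M w) = \<epsilon> / 2 * (norm w)\<^sup>2"
proof -
  have "inner (N w) (N w) = (LINT x|\<mu>. \<epsilon> / 2 * (norm w)\<^sup>2 + a x * inner w x * evl (M w) x)"
    unfolding inner_N inner_N_nx using a_pos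
    by (simp add: evl_B distrib_left mult.assoc less_imp_neq [symmetric])
  also have "\<dots> = \<epsilon> / 2 * (norm w)\<^sup>2 + inner (M w) (M w)"
  proof -
    have "integrable \<mu> (\<lambda>x. a x * inner w x * evl (M w) x)"
      by (intro integrable_cont continuous_intros continuous_a continuous_evl)
    then show ?thesis by (simp add: inner_M prob_space)
  qed
  finally show ?thesis by simp
qed

text \<open>The resolvent equation for \<open>\<Gamma> w\<close> is solved explicitly by \<open>N w\<close>, the product of \<open>B\<close> with
  the linear function \<open>inner w\<close>, up to a multiple of \<open>B\<close>.\<close>

lemma g_tilde_add_\<Gamma>:
  assumes h: "inner h B = 0"
  shows "g_tilde \<epsilon> evl \<mu> (h + \<Gamma> w) = g_tilde \<epsilon> evl \<mu> h + 2 * inner (M w + N w) h + (norm w)\<^sup>2"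
proof -
  obtain u where u: "inner u B = 0" "u - T u = h"
    using resolvent_exists [OF h] by blast
  define v where "v = (2 / \<epsilon>) *\<^sub>R (N w - inner (N w) B *\<^sub>R B)"
  have Tv: "T v = (2 / \<epsilon>) *\<^sub>R (M w - inner (N w) B *\<^sub>R B)"
    by (simp add: v_def T_scaleR T_diff T_N T_B)
  have v: "v - T v = \<Gamma> w"
    unfolding Tv unfolding v_def \<Gamma>_eq by (simp add: scaleR_right_diff_distrib)
  have v2: "\<epsilon> / 2 * inner g (v + T v) = inner (M w + N w) g" if "inner g B = 0" for g
    unfolding Tv unfolding v_def using that eps_pos
    by (simp add: inner_add_right inner_diff_right inner_add_left inner_commute [of g] distrib_left)
  have h\<Gamma>: "inner (h + \<Gamma> w) B = 0"
    using h by (simp add: inner_add_left inner_\<Gamma>_B)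
  have uv: "(u + v) - T (u + v) = h + \<Gamma> w"
    using u(2) v by (simp add: T_add algebra_simps flip: u(2) v)
  \<comment> \<open>Both mixed terms equal \<open>inner u v - inner (T u) (T v)\<close>, because
    \<open>T\<close> is symmetric.\<close>
  have sym: "inner (\<Gamma> w) (u + T u) = inner h (v + T v)"
  proof -
    have "inner (\<Gamma> w) (u + T u) = inner v u - inner (T v) (T u)"
      unfolding v [symmetric] using T_sym [of v u]
      by (simp only: inner_diff_left inner_add_right)
    moreover have "inner h (v + T v) = inner u v - inner (T u) (T v)"
      unfolding u(2) [symmetric] using T_sym [of u v]
      by (simp only: inner_diff_left inner_add_right)
    ultimately show ?thesis
      by (simp add: inner_commute)
  qed
  have "g_tilde \<epsilon> evl \<mu> (h + \<Gamma> w) = \<epsilon> / 2 * inner (h + \<Gamma> w) (u + v + T (u + v))"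
    by (rule g_tilde_eq [OF h\<Gamma> uv])
  also have "inner (h + \<Gamma> w) (u + v + T (u + v)) =
      inner h (u + T u) + inner h (v + T v) + inner (\<Gamma> w) (u + T u) + inner (\<Gamma> w) (v + T v)"
    by (simp add: T_add inner_add_left inner_add_right)
  also have "\<epsilon> / 2 * \<dots> = \<epsilon> / 2 * inner h (u + T u) + 2 * (\<epsilon> / 2 * inner h (v + T v)) + \<epsilon> / 2 * inner (\<Gamma> w) (v + T v)"
    unfolding sym by (simp add: algebra_simps)
  also have "\<dots> = g_tilde \<epsilon> evl \<mu> h + 2 * inner (M w + N w) h + inner (M w + N w) (\<Gamma> w)"
    unfolding v2 [OF h] v2 [OF inner_\<Gamma>_B] g_tilde_eq [OF h u(2)] by simp
  \<comment> \<open>\<open>\<Gamma> w\<close> is a multiple of \<open>N w - M w\<close>, so pairing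
    it with the sum leaves a difference of squares.\<close>
  also have "inner (M w + N w) (\<Gamma> w) = 2 / \<epsilon> * (inner (N w) (N w) - inner (M w) (M w))"
    unfolding \<Gamma>_eq by (simp add: inner_add_left inner_diff_right inner_commute [of "M w" "N w"])
  also have "\<dots> = (norm w)\<^sup>2"
    unfolding norm_N_M using eps_pos by simp
  finally show ?thesis .
qed

end

subsection \<open>Translated measures\<close>

lemma borel_prob_translate: "borel_prob \<mu> \<Longrightarrow> borel_prob (distr \<mu> borel (\<lambda>x. x + p))"
  unfolding borel_prob_def
  by (auto intro!: prob_space.prob_space_distr simp: measurable_cong_sets [of \<mu> borel borel borel])

locale translated_prob = bounded_prob \<epsilon> evl \<mu>
  for \<epsilon> :: real
    and evl :: "'h::{real_inner,banach,second_countable_topology} \<Rightarrow> 'a::euclidean_space \<Rightarrow> real"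
    and \<mu> :: "'a measure" +
  fixes p :: 'a
begin

definition \<nu> :: "'a measure" where "\<nu> = distr \<mu> borel (\<lambda>x. x + p)"

lemma measurable_translate: "(\<lambda>x. x + p) \<in> \<mu> \<rightarrow>\<^sub>M borel"
  by (simp add: measurable_cong_sets [of \<mu> borel borel borel])

lemma bounded_support_translate: "bounded_support \<nu>"
proof -
  obtain S where S: "bounded S" "AE x in \<mu>. x \<in> S"
    using bounded_support by (auto simp: bounded_support_def)
  have c: "closure ((\<lambda>x. x + p) ` S) \<in> sets borel" by simp
  have "AE x in \<mu>. x + p \<in> closure ((\<lambda>x. x + p) ` S)"
    using S(2) by eventually_elim (rule subsetD [OF closure_subset imageI])
  then have "AE x in \<nu>. x \<in> closure ((\<lambda>x. x + p) ` S)"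
    unfolding \<nu>_def using c by (simp add: AE_distr_iff [OF measurable_translate])
  moreover have "bounded (closure ((\<lambda>x. x + p) ` S))"
    using S(1) bounded_translation [of S p] by (simp add: add.commute bounded_closure)
  ultimately show ?thesis
    by (auto simp: bounded_support_def)
qed

sublocale tr: bounded_prob \<epsilon> evl \<nu>
  by unfold_locales
    (use borel_prob borel_prob_translate bounded_support_translate in \<open>auto simp: \<nu>_def\<close>)

lemma integral_translate:
  fixes f :: "'a \<Rightarrow> 'b::{banach,second_countable_topology}"
  assumes "continuous_on UNIV f"
  shows "(LINT x|\<nu>. f x) = (LINT x|\<mu>. f (x + p))"
  unfolding \<nu>_def
  by (rule integral_distr [OF measurable_translate borel_measurable_continuous_onI [OF assms]])

lemma continuous_a_translate: "continuous_on UNIV (\<lambda>x. a (x - p))"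
  by (rule continuous_on_compose2 [OF continuous_a]) (auto intro!: continuous_intros)

lemma a_translate: "tr.a x = a (x - p)"
proof -
  have "tr.is_scaling (\<lambda>x. a (x - p))"
    unfolding tr.is_scaling_def
  proof (intro conjI allI continuous_a_translate)
    fix y
    have "(LINT x|\<nu>. a (x - p) * k_c \<epsilon> x y) = (LINT x|\<mu>. a x * k_c \<epsilon> (x + p) y)"
      by (subst integral_translate) (auto intro!: continuous_intros continuous_a_translate continuous_kc)
    also have "\<dots> = (LINT x|\<mu>. a x * k_c \<epsilon> x (y - p))"
      by (simp add: kc_eq diff_diff_eq2)
    finally show "(LINT x|\<nu>. a (x - p) * k_c \<epsilon> x y) = 1 / a (y - p)"
      by (simp add: a_eq)
  qed (rule a_pos)
  then show ?thesis
    using tr.a_eqI by metis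
qed

lemma B_translate: "tr.B = shift p B"
  by (rule evl_ext) (simp add: tr.evl_B evl_B evl_shift a_translate)

lemma T_translate: "tr.T (shift p g) = shift p (T g)"
proof (rule evl_ext)
  fix y
  have "evl (tr.T (shift p g)) y = (LINT x|\<mu>. (a x)\<^sup>2 * evl g x * k_c \<epsilon> (x + p) y)"
    unfolding tr.evl_T
    by (subst integral_translate, intro continuous_intros tr.continuous_a continuous_evl continuous_kc)
      (simp add: a_translate evl_shift)
  also have "\<dots> = evl (T g) (y - p)"
    by (simp add: evl_T kc_eq diff_diff_eq2)
  finally show "evl (tr.T (shift p g)) y = evl (shift p (T g)) y"
    by (simp add: evl_shift)
qed

text \<open>The unitary shift conjugates the operator \<open>T\<close> of \<open>\<mu>\<close> into
  that of the translate, so a solution of one resolvent equation shifts to a solution of the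
  other.\<close>

lemma g_tilde_translate:
  assumes h: "inner h B = 0"
  shows "g_tilde \<epsilon> evl \<nu> (shift p h) = g_tilde \<epsilon> evl \<mu> h"
proof -
  obtain u where u: "inner u B = 0" "u - T u = h"
    using resolvent_exists [OF h] by blast
  have "inner (shift p h) tr.B = 0"
    using h by (simp add: B_translate inner_shift)
  moreover have "shift p u - tr.T (shift p u) = shift p h"
    using u by (simp add: T_translate flip: shift_diff)
  ultimately have "g_tilde \<epsilon> evl \<nu> (shift p h) = \<epsilon> / 2 * inner (shift p h) (shift p u + tr.T (shift p u))"
    by (rule tr.g_tilde_eq)
  also have "\<dots> = \<epsilon> / 2 * inner h (u + T u)"
    by (simp add: T_translate inner_shift flip: shift_add)
  finally show ?thesis by (simp add: g_tilde_eq [OF h u(2)])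
qed

end

section \<open>Smooth cut-off functions\<close>

text \<open>Repeated differentiability through a chain of explicit derivatives. Unlike statements
  about \<open>deriv ^^ n\<close>, it passes to sums, products and reciprocals by a direct
  induction; \<open>Cn_iterated_deriv\<close> translates back.\<close>

primrec Cn :: "nat \<Rightarrow> (real \<Rightarrow> real) \<Rightarrow> bool" where
  "Cn 0 f \<longleftrightarrow> True"
| "Cn (Suc n) f \<longleftrightarrow> (\<exists>f'. (\<forall>x. (f has_field_derivative f' x) (at x)) \<and> Cn n f')"

lemma Cn_SucI: "(\<And>x. (f has_field_derivative f' x) (at x)) \<Longrightarrow> Cn n f' \<Longrightarrow> Cn (Suc n) f"
  by auto

lemma Cn_Suc_D: "Cn (Suc n) f \<Longrightarrow> Cn n f"
proof (induction n arbitrary: f)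
  case (Suc n)
  then obtain f' where f': "\<forall>x. (f has_field_derivative f' x) (at x)" "Cn (Suc n) f'" by auto
  then show ?case using Suc.IH [OF f'(2)] by auto
qed simp

lemma Cn_const: "Cn n (\<lambda>x. c)"
proof (induction n arbitrary: c)
  case (Suc n)
  show ?case by (rule Cn_SucI [OF DERIV_const Suc])
qed simp

lemma Cn_add: "Cn n f \<Longrightarrow> Cn n g \<Longrightarrow> Cn n (\<lambda>x. f x + g x)"
proof (induction n arbitrary: f g)
  case (Suc n)
  then obtain f' g' where f': "\<forall>x. (f has_field_derivative f' x) (at x)" "Cn n f'"
    and g': "\<forall>x. (g has_field_derivative g' x) (at x)" "Cn n g'" by auto
  have "\<forall>x. ((\<lambda>x. f x + g x) has_field_derivative f' x + g' x) (at x)"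
    using f' g' by (auto intro: DERIV_add)
  then show ?case using Suc.IH [OF f'(2) g'(2)] by auto
qed simp

lemma Cn_mult: "Cn n f \<Longrightarrow> Cn n g \<Longrightarrow> Cn n (\<lambda>x. f x * g x)"
proof (induction n arbitrary: f g)
  case (Suc n)
  then obtain f' g' where f': "\<forall>x. (f has_field_derivative f' x) (at x)" "Cn n f'"
    and g': "\<forall>x. (g has_field_derivative g' x) (at x)" "Cn n g'" by auto
  have "\<forall>x. ((\<lambda>x. f x * g x) has_field_derivative f' x * g x + g' x * f x) (at x)"
    using f' g' by (auto intro: DERIV_mult)
  moreover have "Cn n (\<lambda>x. f' x * g x + g' x * f x)"
    using Suc.IH f' g' Suc.prems by (intro Cn_add) (auto dest: Cn_Suc_D simp del: Cn.simps)
  ultimately show ?case by auto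
qed simp

lemma Cn_diff: "Cn n f \<Longrightarrow> Cn n g \<Longrightarrow> Cn n (\<lambda>x. f x - g x)"
  using Cn_add [of n f "\<lambda>x. (-1) * g x"] Cn_mult [OF Cn_const, of n g "-1"] by simp

lemma Cn_affine: "Cn n f \<Longrightarrow> Cn n (\<lambda>x. f (c * x + d))"
proof (induction n arbitrary: f)
  case (Suc n)
  then obtain f' where f': "\<forall>x. (f has_field_derivative f' x) (at x)" "Cn n f'" by auto
  have "((\<lambda>x. f (c * x + d)) has_field_derivative c * f' (c * x + d)) (at x)" for x
  proof -
    have "((\<lambda>x. c * x + d) has_field_derivative c) (at x)"
      by (auto intro!: derivative_eq_intros)
    then show ?thesis
      using DERIV_chain2 [of f "f' (c * x + d)" "\<lambda>x. c * x + d" x c UNIV] f' by (simp add: mult.commute)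
  qed
  moreover have "Cn n (\<lambda>x. c * f' (c * x + d))"
    using Suc.IH [OF f'(2)] by (intro Cn_mult Cn_const)
  ultimately show ?case by (rule Cn_SucI)
qed simp

lemma Cn_inverse: "Cn n f \<Longrightarrow> (\<And>x. f x \<noteq> 0) \<Longrightarrow> Cn n (\<lambda>x. inverse (f x))"
proof (induction n)
  case (Suc n)
  then obtain f' where f': "\<forall>x. (f has_field_derivative f' x) (at x)" "Cn n f'" by auto
  have "((\<lambda>x. inverse (f x)) has_field_derivative (- 1) * f' x * (inverse (f x) * inverse (f x))) (at x)" for x
    using DERIV_inverse_fun [of f "f' x" x UNIV] f' Suc.prems by (simp add: power2_eq_square)
  moreover have "Cn n (\<lambda>x. inverse (f x))"
    using Suc.IH Cn_Suc_D [OF Suc.prems(1)] Suc.prems(2) by blast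
  then have "Cn n (\<lambda>x. (- 1) * f' x * (inverse (f x) * inverse (f x)))"
    using f' by (intro Cn_mult Cn_const)
  ultimately show ?case by (rule Cn_SucI)
qed simp

lemma Cn_iterated_deriv: "(\<And>n. Cn n f) \<Longrightarrow> (deriv ^^ n) f differentiable_on UNIV"
proof (induction n arbitrary: f)
  case 0
  then have "Cn (Suc 0) f" by blast
  then show ?case
    by (auto simp: differentiable_on_def real_differentiable_def)
next
  case (Suc n)
  have "Cn m (deriv f)" for m
  proof -
    obtain f' where f': "\<forall>x. (f has_field_derivative f' x) (at x)" "Cn m f'"
      using Suc.prems [of "Suc m"] by auto
    then have "deriv f = f'" by (auto simp: fun_eq_iff intro: DERIV_imp_deriv)
    then show ?thesis using f' by simp
  qed
  then show ?case
    using Suc.IH [of "deriv f"] by (simp add: funpow_Suc_right del: funpow.simps)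
qed

text \<open>The classical flat function, with a polynomial in \<open>1 / x\<close> as prefactor so
  that the family is closed under differentiation: the derivative replaces \<open>p\<close> by
  \<open>[:0, 0, 1:] * (p - pderiv p)\<close>.\<close>

definition flat_exp :: "real poly \<Rightarrow> real \<Rightarrow> real" where
  "flat_exp p x = (if x > 0 then poly p (1 / x) * exp (- (1 / x)) else 0)"

lemma poly_times_exp_tendsto_0: "((\<lambda>y. poly p y * exp (- y)) \<longlongrightarrow> 0) at_top" for p :: "real poly"
proof -
  have "((\<lambda>y. \<Sum>i\<le>degree p. coeff p i * (y ^ i / exp y)) \<longlongrightarrow> (\<Sum>i\<le>degree p. coeff p i * 0)) at_top"
    by (intro tendsto_intros tendsto_power_div_exp_0)
  moreover have "poly p y * exp (- y) = (\<Sum>i\<le>degree p. coeff p i * (y ^ i / exp y))" for y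
    by (simp add: poly_altdef sum_distrib_right exp_minus divide_inverse mult.assoc)
  ultimately show ?thesis by simp
qed

lemma flat_exp_has_derivative:
  "(flat_exp p has_field_derivative flat_exp ([:0, 0, 1:] * (p - pderiv p)) x) (at x)"
proof -
  consider "x > 0" | "x < 0" | "x = 0" by linarith
  then show ?thesis
  proof cases
    case 1
    have *: "((\<lambda>x. poly p (1 / x) * exp (- (1 / x))) has_field_derivative
        flat_exp ([:0, 0, 1:] * (p - pderiv p)) x) (at x)"
      using 1 by (auto intro!: derivative_eq_intros DERIV_chain2 [OF poly_DERIV]
          simp: flat_exp_def field_simps power2_eq_square)
    have "\<forall>\<^sub>F y in nhds x. y > 0"
      using 1 by (intro order_tendstoD(1) [OF filterlim_ident]) auto
    then have ev: "\<forall>\<^sub>F y in nhds x. poly p (1 / y) * exp (- (1 / y)) = flat_exp p y"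
      by eventually_elim (simp add: flat_exp_def)
    show ?thesis
      by (rule iffD1 [OF DERIV_cong_ev [OF refl ev refl] *])
  next
    case 2
    have *: "((\<lambda>x. 0) has_field_derivative flat_exp ([:0, 0, 1:] * (p - pderiv p)) x) (at x)"
      using 2 by (auto simp: flat_exp_def)
    have "\<forall>\<^sub>F y in nhds x. y < 0"
      using 2 by (intro order_tendstoD(2) [OF filterlim_ident]) auto
    then have ev: "\<forall>\<^sub>F y in nhds x. 0 = flat_exp p y"
      by eventually_elim (simp add: flat_exp_def)
    show ?thesis
      by (rule iffD1 [OF DERIV_cong_ev [OF refl ev refl] *])
  next
    case 3
    \<comment> \<open>With \<open>y = 1 / h\<close> the right-hand quotient is
      \<open>y * poly p y * exp (- y)\<close>, which vanishes at infinity.\<close>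
    have "((\<lambda>h. flat_exp p h / h) \<longlongrightarrow> 0) (at_right 0)"
    proof -
      have "((\<lambda>h. poly ([:0, 1:] * p) (inverse h) * exp (- inverse h)) \<longlongrightarrow> 0) (at_right 0)"
        by (rule filterlim_compose [OF poly_times_exp_tendsto_0 filterlim_inverse_at_top_right])
      moreover have "\<forall>\<^sub>F h :: real in at_right 0. h > 0"
        by (simp add: eventually_at_right_less)
      then have "\<forall>\<^sub>F h in at_right 0. poly ([:0, 1:] * p) (inverse h) * exp (- inverse h) = flat_exp p h / h"
        by eventually_elim (simp add: flat_exp_def field_simps)
      ultimately show ?thesis by (rule Lim_transform_eventually)
    qed
    moreover have "((\<lambda>h. flat_exp p h / h) \<longlongrightarrow> 0) (at_left 0)"
    proof -
      have "\<forall>\<^sub>F h :: real in at_left 0. h < 0"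
        by (rule eventually_at_leftI [of "-1"]) auto
      then have "\<forall>\<^sub>F h in at_left 0. 0 = flat_exp p h / h"
        by eventually_elim (simp add: flat_exp_def)
      then show ?thesis by (rule Lim_transform_eventually [OF tendsto_const])
    qed
    ultimately have "((\<lambda>h. flat_exp p h / h) \<longlongrightarrow> 0) (at 0)"
      by (simp add: filterlim_at_split)
    then show ?thesis using 3 by (simp add: DERIV_def flat_exp_def)
  qed
qed

lemma Cn_flat_exp: "Cn n (flat_exp p)"
proof (induction n arbitrary: p)
  case (Suc n)
  show ?case by (rule Cn_SucI [OF flat_exp_has_derivative Suc])
qed simp

text \<open>A smooth passage from 0 left of -1 to 1 right of 1, whose derivative is a nonnegative
  bump. The difference of two rescaled steps has compact support, so it is a test function whose
  derivative is the difference of two bumps of mass one.\<close>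

definition smooth_step :: "real \<Rightarrow> real" where
  "smooth_step x = flat_exp 1 (1 + x) * inverse (flat_exp 1 (1 + x) + flat_exp 1 (1 - x))"

lemma flat_exp_1_nonneg: "flat_exp 1 x \<ge> 0" and flat_exp_1_pos: "x > 0 \<Longrightarrow> flat_exp 1 x > 0"
  and flat_exp_nonpos: "x \<le> 0 \<Longrightarrow> flat_exp p x = 0"
  by (auto simp: flat_exp_def)

lemma smooth_step_denominator: "flat_exp 1 (1 + x) + flat_exp 1 (1 - x) > 0"
  using flat_exp_1_pos [of "1 + x"] flat_exp_1_pos [of "1 - x"] flat_exp_1_nonneg [of "1 + x"] flat_exp_1_nonneg [of "1 - x"]
  by (cases "x > 0") (auto intro: add_pos_nonneg add_nonneg_pos)

lemma Cn_smooth_step: "Cn n smooth_step"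
proof -
  have 1: "Cn n (\<lambda>x. flat_exp 1 (1 + x))"
    using Cn_affine [OF Cn_flat_exp, of n 1 1 1] by (simp add: add.commute)
  have 2: "Cn n (\<lambda>x. flat_exp 1 (1 - x))"
    using Cn_affine [OF Cn_flat_exp, of n 1 "-1" 1] by simp
  show ?thesis
    unfolding smooth_step_def [abs_def]
    using smooth_step_denominator
    by (intro Cn_mult Cn_inverse Cn_add 1 2) (metis less_irrefl)
qed

lemma smooth_step_0: "x \<le> -1 \<Longrightarrow> smooth_step x = 0"
  and smooth_step_1: "x \<ge> 1 \<Longrightarrow> smooth_step x = 1"
proof -
  show "smooth_step x = 0" if "x \<le> -1"
    using that by (simp add: smooth_step_def flat_exp_nonpos)
  show "smooth_step x = 1" if "x \<ge> 1"
    using that flat_exp_1_pos [of "1 + x"] by (simp add: smooth_step_def flat_exp_nonpos [of "1 - x"])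
qed

lemma smooth_step_derivative:
  obtains \<eta> where "\<And>x. (smooth_step has_field_derivative \<eta> x) (at x)" "\<And>x. \<eta> x \<ge> 0"
    "\<And>x. \<bar>x\<bar> > 1 \<Longrightarrow> \<eta> x = 0" "continuous_on UNIV \<eta>"
proof -
  define e where "e = flat_exp ([:0, 0, 1:] * (1 - pderiv 1))"
  have e: "(flat_exp 1 has_field_derivative e x) (at x)" for x
    unfolding e_def by (rule flat_exp_has_derivative)
  have e0: "e x \<ge> 0" for x by (simp add: e_def flat_exp_def)
  let ?f = "\<lambda>x. flat_exp 1 (1 + x)" and ?g = "\<lambda>x. flat_exp 1 (1 - x)"
  define \<eta> where "\<eta> x = (e (1 + x) * ?g x + ?f x * e (1 - x)) / (?f x + ?g x)\<^sup>2" for x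
  have f: "(?f has_field_derivative e (1 + x)) (at x)" for x
  proof -
    have "((\<lambda>x. 1 + x) has_field_derivative 1) (at x)"
      by (auto intro!: derivative_eq_intros)
    then show ?thesis
      using DERIV_chain2 [of "flat_exp 1" "e (1 + x)" "\<lambda>x. 1 + x" x 1 UNIV] e by simp
  qed
  have g: "(?g has_field_derivative - e (1 - x)) (at x)" for x
  proof -
    have "((\<lambda>x. 1 - x) has_field_derivative -1) (at x)"
      by (auto intro!: derivative_eq_intros)
    then show ?thesis
      using DERIV_chain2 [of "flat_exp 1" "e (1 - x)" "\<lambda>x. 1 - x" x "-1" UNIV] e by simp
  qed
  have d: "(smooth_step has_field_derivative \<eta> x) (at x)" for x
  proof -
    have nz: "?f x + ?g x \<noteq> 0" using smooth_step_denominator [of x] by simp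
    have "((\<lambda>x. ?f x / (?f x + ?g x)) has_field_derivative
        (e (1 + x) * (?f x + ?g x) - ?f x * (e (1 + x) + - e (1 - x))) / ((?f x + ?g x) * (?f x + ?g x))) (at x)"
      by (intro DERIV_divide DERIV_add f g nz)
    moreover have "(\<lambda>x. ?f x / (?f x + ?g x)) = smooth_step"
      by (simp add: smooth_step_def fun_eq_iff divide_inverse)
    moreover have "(e (1 + x) * (?f x + ?g x) - ?f x * (e (1 + x) + - e (1 - x))) / ((?f x + ?g x) * (?f x + ?g x)) = \<eta> x"
      by (simp add: \<eta>_def power2_eq_square algebra_simps)
    ultimately show ?thesis by simp
  qed
  moreover have "\<eta> x \<ge> 0" for x
    unfolding \<eta>_def using e0 flat_exp_1_nonneg by (intro divide_nonneg_nonneg add_nonneg_nonneg mult_nonneg_nonneg) auto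
  moreover have "\<eta> x = 0" if "\<bar>x\<bar> > 1" for x
    using that by (cases "x > 0") (auto simp: \<eta>_def e_def flat_exp_nonpos)
  moreover have "continuous_on UNIV \<eta>"
  proof -
    obtain \<eta>' where \<eta>': "\<forall>x. (smooth_step has_field_derivative \<eta>' x) (at x)" "Cn 1 \<eta>'"
      using Cn_smooth_step [of "Suc 1"] unfolding Cn.simps(2) [of 1] by blast
    have "\<eta> = \<eta>'" using d \<eta>' DERIV_unique by blast
    moreover obtain \<eta>'' where "\<forall>x. (\<eta>' has_field_derivative \<eta>'' x) (at x)"
      using \<eta>'(2) by auto
    ultimately show ?thesis
      by (metis DERIV_isCont continuous_at_imp_continuous_on)
  qed
  ultimately show ?thesis using that by blast
qed

lemma test_function_difference_of_steps:
  assumes "0 < s" "s < 1" "0 < t" "t < 1" "0 < \<delta>" "\<delta> < s" "\<delta> < t" "s + \<delta> < 1" "t + \<delta> < 1"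
  shows "test_function (\<lambda>r. smooth_step ((r - s) / \<delta>) - smooth_step ((r - t) / \<delta>))"
    (is "test_function ?\<phi>")
  unfolding test_function_def
proof (intro conjI allI)
  have "Cn n (\<lambda>r. smooth_step (1 / \<delta> * r + - (s / \<delta>)))" for n s
    by (rule Cn_affine [OF Cn_smooth_step])
  then have "Cn n (\<lambda>r. smooth_step ((r - s) / \<delta>))" for n s
    by (simp add: diff_divide_distrib)
  then have "Cn n ?\<phi>" for n
    by (intro Cn_diff)
  then show "(deriv ^^ n) ?\<phi> differentiable_on UNIV" for n
    by (rule Cn_iterated_deriv)
  show "\<exists>a b. 0 < a \<and> b < 1 \<and> (\<forall>r. r \<notin> {a..b} \<longrightarrow> ?\<phi> r = 0)"
  proof (intro exI conjI allI impI)
    show "0 < min s t - \<delta>" "max s t + \<delta> < 1" using assms by auto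
    fix r assume "r \<notin> {min s t - \<delta>..max s t + \<delta>}"
    then have "(r - s \<le> - \<delta> \<and> r - t \<le> - \<delta>) \<or> (r - s \<ge> \<delta> \<and> r - t \<ge> \<delta>)"
      by auto
    then have "((r - s) / \<delta> \<le> -1 \<and> (r - t) / \<delta> \<le> -1) \<or> ((r - s) / \<delta> \<ge> 1 \<and> (r - t) / \<delta> \<ge> 1)"
      using assms(5) by (simp add: field_simps)
    then show "?\<phi> r = 0"
      by (auto simp: smooth_step_0 smooth_step_1)
  qed
qed

section \<open>Absolutely continuous paths\<close>

text \<open>Absolute continuity in integral form, with \<open>v\<close> as density of the
  increments. Half-open intervals concatenate without overlap.\<close>

definition ac_path :: "(real \<Rightarrow> 'h::{banach,second_countable_topology}) \<Rightarrow> (real \<Rightarrow> 'h) \<Rightarrow> bool" where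
  "ac_path \<beta> v \<longleftrightarrow> set_integrable lborel {0..1} v \<and>
     (\<forall>s t. 0 \<le> s \<longrightarrow> s \<le> t \<longrightarrow> t \<le> 1 \<longrightarrow> \<beta> t - \<beta> s = (LINT r:{s<..t}|lborel. v r))"

lemma ac_pathD:
  "ac_path \<beta> v \<Longrightarrow> 0 \<le> s \<Longrightarrow> s \<le> t \<Longrightarrow> t \<le> 1 \<Longrightarrow> \<beta> t - \<beta> s = (LINT r:{s<..t}|lborel. v r)"
  by (simp add: ac_path_def)

lemma ac_path_integrable: "ac_path \<beta> v \<Longrightarrow> set_integrable lborel {0..1} v"
  by (simp add: ac_path_def)

lemma set_integrable_Ioc:
  fixes f :: "real \<Rightarrow> 'h::{banach,second_countable_topology}"
  assumes "set_integrable lborel {0..1} f" "0 \<le> s" "t \<le> 1"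
  shows "set_integrable lborel {s<..t} f"
  by (rule set_integrable_subset [OF assms(1)]) (use assms in auto)

lemma set_integral_Ioc_combine:
  fixes f :: "real \<Rightarrow> 'h::{banach,second_countable_topology}"
  assumes "set_integrable lborel {0..1} f" "0 \<le> s" "s \<le> u" "u \<le> t" "t \<le> 1"
  shows "(LINT r:{s<..t}|lborel. f r) = (LINT r:{s<..u}|lborel. f r) + (LINT r:{u<..t}|lborel. f r)"
proof -
  have "{s<..t} = {s<..u} \<union> {u<..t}" using assms by auto
  then show ?thesis
    using assms by (simp add: set_integral_Un set_integrable_Ioc)
qed

lemma set_integral_norm_le:
  fixes f :: "real \<Rightarrow> 'h::{banach,second_countable_topology}" and g :: "real \<Rightarrow> real"
  assumes "set_integrable lborel A f" "set_integrable lborel A g"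
    and "\<And>r. r \<in> A \<Longrightarrow> norm (f r) \<le> g r"
  shows "norm (LINT r:A|lborel. f r) \<le> (LINT r:A|lborel. g r)"
  unfolding set_lebesgue_integral_def
proof (rule Bochner_Integration.integral_norm_bound_integral)
  show "norm (indicat_real A x *\<^sub>R f x) \<le> indicat_real A x *\<^sub>R g x" for x
    using assms(3) by (simp split: split_indicator)
qed (use assms in \<open>simp_all add: set_integrable_def\<close>)

lemma set_integral_endpoints:
  fixes f :: "real \<Rightarrow> 'h::{banach,second_countable_topology}"
  shows "(LINT r:{s<..t}|lborel. f r) = (LINT r:{s..t}|lborel. f r)"
    and "(LINT r:{s<..t}|lborel. f r) = (LINT r:{s<..<t}|lborel. f r)"
  by (rule set_integral_discrete_difference [where X = "{s, t}"]; auto)+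

lemma set_integrable_endpoints:
  fixes f :: "real \<Rightarrow> 'h::{banach,second_countable_topology}"
  shows "set_integrable lborel {s<..<t} f \<longleftrightarrow> set_integrable lborel {s..t} f"
  by (rule set_integrable_discrete_difference [where X = "{s, t}"]) auto

text \<open>A local estimate of higher order determines the increments: sum it over a fine partition.\<close>

lemma increment_eq_integral:
  fixes F \<rho> :: "real \<Rightarrow> 'h::{banach,second_countable_topology}" and g :: "real \<Rightarrow> real"
  assumes \<rho>: "set_integrable lborel {0..1} \<rho>" and g: "set_integrable lborel {0..1} g"
    and local: "\<And>e. e > 0 \<Longrightarrow> \<exists>d>0. \<forall>s t. 0 \<le> s \<longrightarrow> s \<le> t \<longrightarrow> t \<le> 1 \<longrightarrow> t - s < d \<longrightarrow>
        norm (F t - F s - (LINT r:{s<..t}|lborel. \<rho> r)) \<le> e * (LINT r:{s<..t}|lborel. g r)"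
    and st: "0 \<le> s" "s \<le> t" "t \<le> 1"
  shows "F t - F s = (LINT r:{s<..t}|lborel. \<rho> r)"
proof -
  let ?R = "\<lambda>s t. norm (F t - F s - (LINT r:{s<..t}|lborel. \<rho> r))"
  let ?G = "\<lambda>s t. LINT r:{s<..t}|lborel. g r"
  have main: "?R s t \<le> e * ?G s t" if e: "e > 0" for e
  proof -
    obtain d where d: "d > 0" "\<And>s t. 0 \<le> s \<Longrightarrow> s \<le> t \<Longrightarrow> t \<le> 1 \<Longrightarrow> t - s < d \<Longrightarrow> ?R s t \<le> e * ?G s t"
      using local [OF e] by blast
    obtain n where n: "n > 0" "(t - s) / real n < d"
    proof -
      obtain n :: nat where "real n > (t - s) / d" using reals_Archimedean2 by blast
      moreover have "real (Suc n) > real n" by simp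
      ultimately have "real (Suc n) > (t - s) / d" by linarith
      then show ?thesis
        using d(1) by (intro that [of "Suc n"]) (simp_all add: field_simps)
    qed
    define c where "c = (t - s) / real n"
    define x where "x k = s + real k * c" for k
    have x0: "x 0 = s" and xn: "x n = t"
      using n by (simp_all add: x_def c_def)
    have xS: "x (Suc k) - x k = (t - s) / real n" for k
      unfolding c_def [symmetric] by (simp add: x_def distrib_right)
    have xmono: "x k \<le> x (Suc k)" for k
      using xS [of k] st by (metis diff_ge_0_iff_ge divide_nonneg_nonneg of_nat_0_le_iff)
    have x_in: "s \<le> x k \<and> x k \<le> t" if "k \<le> n" for k
    proof -
      have "real k * ((t - s) / real n) \<le> real n * ((t - s) / real n)"
        using that st by (intro mult_right_mono) auto
      then show ?thesis using n st by (simp add: x_def c_def)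
    qed
    have "?R s (x k) \<le> e * ?G s (x k)" if "k \<le> n" for k
      using that
    proof (induction k)
      case 0
      then show ?case by (simp add: x0 set_lebesgue_integral_def)
    next
      case (Suc k)
      have k: "0 \<le> s" "s \<le> x k" "x k \<le> x (Suc k)" "x (Suc k) \<le> 1"
        using x_in [of k] x_in [of "Suc k"] xmono Suc.prems st by auto
      have "F (x (Suc k)) - F s - (LINT r:{s<..x (Suc k)}|lborel. \<rho> r) =
          (F (x k) - F s - (LINT r:{s<..x k}|lborel. \<rho> r)) +
          (F (x (Suc k)) - F (x k) - (LINT r:{x k<..x (Suc k)}|lborel. \<rho> r))"
        unfolding set_integral_Ioc_combine [OF \<rho> k] by simp
      then have "?R s (x (Suc k)) \<le> ?R s (x k) + ?R (x k) (x (Suc k))"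
        by (metis norm_triangle_ineq)
      also have "\<dots> \<le> e * ?G s (x k) + e * ?G (x k) (x (Suc k))"
        using Suc k st n xS [of k] by (intro add_mono Suc.IH d(2)) auto
      also have "\<dots> = e * ?G s (x (Suc k))"
        unfolding set_integral_Ioc_combine [OF g k] by (simp add: distrib_left)
      finally show ?case .
    qed
    from this [of n] show ?thesis by (simp add: xn)
  qed
  have "?R s t \<le> 0"
  proof (rule field_le_epsilon)
    fix e :: real assume e: "e > 0"
    \<comment> \<open>Dividing by \<open>1 + \<bar>?G s t\<bar>\<close> also covers the case in
      which the integral of \<open>g\<close> vanishes.\<close>
    have "?R s t \<le> e / (1 + \<bar>?G s t\<bar>) * ?G s t"
      using e by (intro main) (simp add: add_pos_nonneg)
    also have "\<dots> \<le> e / (1 + \<bar>?G s t\<bar>) * (1 + \<bar>?G s t\<bar>)"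
      using e by (intro mult_left_mono) auto
    also have "\<dots> = e" by simp
    finally show "?R s t \<le> 0 + e" by simp
  qed
  then show ?thesis by simp
qed

lemma set_integrable_bilinear_cont:
  fixes f :: "real \<Rightarrow> 'b::{banach,second_countable_topology}"
    and Y :: "real \<Rightarrow> 'c::{banach,second_countable_topology}"
    and pr :: "'b \<Rightarrow> 'c \<Rightarrow> 'd::{banach,second_countable_topology}"
  assumes pr: "bounded_bilinear pr" and f: "set_integrable lborel {0..1} f" and Y: "continuous_on {0..1} Y"
  shows "set_integrable lborel {0..1} (\<lambda>r. pr (f r) (Y r))"
proof -
  interpret bounded_bilinear pr by (rule pr)
  obtain K where K: "\<And>x y. norm (pr x y) \<le> norm x * norm y * K" "K > 0"
    using pos_bounded by blast
  have "compact (Y ` {0..1})"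
    by (intro compact_continuous_image Y) auto
  then obtain b where b: "\<And>r. r \<in> {0..1} \<Longrightarrow> norm (Y r) \<le> b"
    by (meson bounded_iff compact_imp_bounded imageI)
  have b0: "b \<ge> 0" using b [of 0] norm_ge_zero [of "Y 0"] by (simp del: norm_ge_zero)
  have fm: "(\<lambda>r. indicat_real {0..1} r *\<^sub>R f r) \<in> borel_measurable lborel"
    using f unfolding set_integrable_def by simp
  have Ym: "(\<lambda>r. indicat_real {0..1} r *\<^sub>R Y r) \<in> borel_measurable lborel"
    using borel_measurable_continuous_on_indicator [OF _ Y] by simp
  have "(\<lambda>r. pr (indicat_real {0..1} r *\<^sub>R f r) (indicat_real {0..1} r *\<^sub>R Y r)) \<in> borel_measurable lborel"
    by (rule borel_measurable_continuous_Pair [OF fm Ym])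
      (intro continuous_on continuous_intros)
  also have "(\<lambda>r. pr (indicat_real {0..1} r *\<^sub>R f r) (indicat_real {0..1} r *\<^sub>R Y r)) =
      (\<lambda>r. indicat_real {0..1} r *\<^sub>R pr (f r) (Y r))"
    by (auto simp: fun_eq_iff zero_left split: split_indicator)
  finally have m: "(\<lambda>r. indicat_real {0..1} r *\<^sub>R pr (f r) (Y r)) \<in> borel_measurable lborel" .
  show ?thesis
    unfolding set_integrable_def
  proof (rule Bochner_Integration.integrable_bound [OF _ m])
    show "integrable lborel (\<lambda>r. b * K * norm (indicat_real {0..1} r *\<^sub>R f r))"
      using f unfolding set_integrable_def by (intro integrable_mult_right integrable_norm)
    have "norm (pr (f r) (Y r)) \<le> b * K * norm (f r)" if "r \<in> {0..1}" for r
    proof -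
      have "norm (pr (f r) (Y r)) \<le> norm (f r) * norm (Y r) * K" by (rule K)
      also have "\<dots> \<le> norm (f r) * b * K"
        using b [OF that] K(2) by (intro mult_right_mono mult_left_mono) auto
      finally show ?thesis by (simp add: ac_simps)
    qed
    then show "AE r in lborel. norm (indicat_real {0..1} r *\<^sub>R pr (f r) (Y r))
        \<le> norm (b * K * norm (indicat_real {0..1} r *\<^sub>R f r))"
      using b0 K(2) by (auto split: split_indicator simp: abs_mult)
  qed
qed

lemma set_integral_bounded_linear:
  fixes f :: "real \<Rightarrow> 'b::{banach,second_countable_topology}"
    and L :: "'b \<Rightarrow> 'd::{banach,second_countable_topology}"
  assumes "bounded_linear L" "set_integrable lborel A f"
  shows "set_integrable lborel A (\<lambda>r. L (f r))"
    and "(LINT r:A|lborel. L (f r)) = L (LINT r:A|lborel. f r)"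
proof -
  interpret bounded_linear L by fact
  have "L (indicat_real A r *\<^sub>R f r) = indicat_real A r *\<^sub>R L (f r)" for r
    by (rule scaleR)
  then show "set_integrable lborel A (\<lambda>r. L (f r))" "(LINT r:A|lborel. L (f r)) = L (LINT r:A|lborel. f r)"
    using integrable_bounded_linear [OF assms(1), of lborel "\<lambda>r. indicat_real A r *\<^sub>R f r"]
      integral_bounded_linear [OF assms(1), of lborel "\<lambda>r. indicat_real A r *\<^sub>R f r"] assms(2)
    by (simp_all add: set_integrable_def set_lebesgue_integral_def)
qed

lemma uniformly_continuous_interval:
  fixes Y :: "real \<Rightarrow> 'c::real_normed_vector"
  assumes "continuous_on {0..1} Y" "e > 0"
  obtains d where "d > 0" "\<And>r t. r \<in> {0..1} \<Longrightarrow> t \<in> {0..1} \<Longrightarrow> \<bar>t - r\<bar> < d \<Longrightarrow> norm (Y t - Y r) < e"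
proof -
  have "uniformly_continuous_on {0..1} Y"
    using assms by (intro compact_uniformly_continuous) auto
  then show ?thesis
    using that assms(2) unfolding uniformly_continuous_on_def dist_norm real_norm_def by metis
qed

text \<open>The Leibniz rule without pointwise derivatives: the increment over a short interval
  splits exactly, with \<open>Y\<close> frozen at the right end and \<open>X\<close> at the left.
  Uniform continuity of \<open>X\<close> and \<open>Y\<close> bounds the error of unfreezing them by
  \<open>e\<close> times the integral of \<open>norm (x' r) + norm (y' r)\<close>.\<close>

lemma ac_path_bilinear:
  fixes X x' :: "real \<Rightarrow> 'b::{banach,second_countable_topology}"
    and Y y' :: "real \<Rightarrow> 'c::{banach,second_countable_topology}"
    and pr :: "'b \<Rightarrow> 'c \<Rightarrow> 'd::{banach,second_countable_topology}"
  assumes pr: "bounded_bilinear pr" and X: "ac_path X x'" "continuous_on {0..1} X"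
    and Y: "ac_path Y y'" "continuous_on {0..1} Y"
  shows "ac_path (\<lambda>t. pr (X t) (Y t)) (\<lambda>t. pr (x' t) (Y t) + pr (X t) (y' t))"
proof -
  interpret bounded_bilinear pr by (rule pr)
  obtain K where K: "\<And>x y. norm (pr x y) \<le> norm x * norm y * K" "K > 0"
    using pos_bounded by blast
  note ix = ac_path_integrable [OF X(1)] and iy = ac_path_integrable [OF Y(1)]
  have i1: "set_integrable lborel {0..1} (\<lambda>t. pr (x' t) (Y t))"
    by (rule set_integrable_bilinear_cont [OF pr ix Y(2)])
  have i2: "set_integrable lborel {0..1} (\<lambda>t. pr (X t) (y' t))"
    by (rule set_integrable_bilinear_cont [OF flip iy X(2)])
  have i12: "set_integrable lborel {0..1} (\<lambda>t. pr (x' t) (Y t) + pr (X t) (y' t))"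
    by (rule set_integral_add(1) [OF i1 i2])
  have ig: "set_integrable lborel {0..1} (\<lambda>r. norm (x' r) + norm (y' r))"
    by (intro set_integral_add(1) set_integrable_norm ix iy)
  have "pr (X t) (Y t) - pr (X s) (Y s) = (LINT r:{s<..t}|lborel. pr (x' r) (Y r) + pr (X r) (y' r))"
    if st: "0 \<le> s" "s \<le> t" "t \<le> 1" for s t
  proof (rule increment_eq_integral [OF i12 ig _ st])
    fix e :: real assume e: "e > 0"
    obtain d1 where d1: "d1 > 0" "\<And>r t. r \<in> {0..1} \<Longrightarrow> t \<in> {0..1} \<Longrightarrow> \<bar>t - r\<bar> < d1 \<Longrightarrow> norm (X t - X r) < e / K"
      using uniformly_continuous_interval [OF X(2)] e K(2) by (metis divide_pos_pos)
    obtain d2 where d2: "d2 > 0" "\<And>r t. r \<in> {0..1} \<Longrightarrow> t \<in> {0..1} \<Longrightarrow> \<bar>t - r\<bar> < d2 \<Longrightarrow> norm (Y t - Y r) < e / K"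
      using uniformly_continuous_interval [OF Y(2)] e K(2) by (metis divide_pos_pos)
    show "\<exists>d>0. \<forall>s t. 0 \<le> s \<longrightarrow> s \<le> t \<longrightarrow> t \<le> 1 \<longrightarrow> t - s < d \<longrightarrow>
        norm (pr (X t) (Y t) - pr (X s) (Y s) - (LINT r:{s<..t}|lborel. pr (x' r) (Y r) + pr (X r) (y' r)))
        \<le> e * (LINT r:{s<..t}|lborel. norm (x' r) + norm (y' r))"
    proof (intro exI conjI allI impI)
      show "0 < min d1 d2" using d1 d2 by simp
      fix s t :: real assume st: "0 \<le> s" "s \<le> t" "t \<le> 1" "t - s < min d1 d2"
      let ?A = "{s<..t}"
      note I = set_integrable_Ioc [OF _ st(1,3)]
      have "pr (X t) (Y t) - pr (X s) (Y s) = pr (X t - X s) (Y t) + pr (X s) (Y t - Y s)"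
        by (simp add: diff_left diff_right)
      also have "pr (X t - X s) (Y t) = (LINT r:?A|lborel. pr (x' r) (Y t))"
        unfolding ac_pathD [OF X(1) st(1-3)]
        by (rule set_integral_bounded_linear(2) [OF bounded_linear_left I [OF ix], symmetric])
      also have "pr (X s) (Y t - Y s) = (LINT r:?A|lborel. pr (X s) (y' r))"
        unfolding ac_pathD [OF Y(1) st(1-3)]
        by (rule set_integral_bounded_linear(2) [OF bounded_linear_right I [OF iy], symmetric])
      finally have 1: "pr (X t) (Y t) - pr (X s) (Y s) =
          (LINT r:?A|lborel. pr (x' r) (Y t)) + (LINT r:?A|lborel. pr (X s) (y' r))" .
      have j1: "set_integrable lborel ?A (\<lambda>r. pr (x' r) (Y t))"
        by (rule set_integral_bounded_linear(1) [OF bounded_linear_left I [OF ix]])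
      have j2: "set_integrable lborel ?A (\<lambda>r. pr (X s) (y' r))"
        by (rule set_integral_bounded_linear(1) [OF bounded_linear_right I [OF iy]])
      have 2: "pr (X t) (Y t) - pr (X s) (Y s) - (LINT r:?A|lborel. pr (x' r) (Y r) + pr (X r) (y' r)) =
          (LINT r:?A|lborel. (pr (x' r) (Y t) + pr (X s) (y' r)) - (pr (x' r) (Y r) + pr (X r) (y' r)))"
        unfolding 1 using j1 j2 I [OF i12] by simp
      also have "norm \<dots> \<le> (LINT r:?A|lborel. e * (norm (x' r) + norm (y' r)))"
      proof (rule set_integral_norm_le)
        show "set_integrable lborel ?A (\<lambda>r. (pr (x' r) (Y t) + pr (X s) (y' r)) - (pr (x' r) (Y r) + pr (X r) (y' r)))"
          using j1 j2 I [OF i12] by simp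
        show "set_integrable lborel ?A (\<lambda>r. e * (norm (x' r) + norm (y' r)))"
          using I [OF ig] by simp
        fix r assume r: "r \<in> ?A"
        have nX: "norm (X s - X r) \<le> e / K" and nY: "norm (Y t - Y r) \<le> e / K"
          using d1(2) [of r s] d2(2) [of r t] r st by auto
        have "(pr (x' r) (Y t) + pr (X s) (y' r)) - (pr (x' r) (Y r) + pr (X r) (y' r)) =
            pr (x' r) (Y t - Y r) + pr (X s - X r) (y' r)"
          by (simp add: diff_left diff_right)
        also have "norm \<dots> \<le> norm (x' r) * norm (Y t - Y r) * K + norm (X s - X r) * norm (y' r) * K"
          by (intro norm_triangle_mono K)
        also have "\<dots> \<le> norm (x' r) * (e / K) * K + (e / K) * norm (y' r) * K"
          using nX nY K(2) by (intro add_mono mult_right_mono mult_left_mono) auto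
        also have "\<dots> = e * (norm (x' r) + norm (y' r))"
          using K(2) by (simp add: field_simps)
        finally show "norm ((pr (x' r) (Y t) + pr (X s) (y' r)) - (pr (x' r) (Y r) + pr (X r) (y' r))) \<le>
            e * (norm (x' r) + norm (y' r))" .
      qed
      finally show "norm (pr (X t) (Y t) - pr (X s) (Y s) - (LINT r:?A|lborel. pr (x' r) (Y r) + pr (X r) (y' r)))
          \<le> e * (LINT r:?A|lborel. norm (x' r) + norm (y' r))"
        by simp
    qed
  qed
  then show ?thesis
    using i12 by (simp add: ac_path_def)
qed

text \<open>Taking \<open>X\<close> at the later and \<open>Y\<close> at the earlier time allows
  difference identities that hold exactly. Over a short interval both factors are nearly constant,
  so continuity of \<open>X\<close> and \<open>Y\<close> replaces their differentiability.\<close>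

lemma ac_path_chain:
  fixes \<beta> v X Y :: "real \<Rightarrow> 'h::{real_inner,banach,second_countable_topology}" and f :: "real \<Rightarrow> real"
  assumes \<beta>: "ac_path \<beta> v" and X: "continuous_on {0..1} X" and Y: "continuous_on {0..1} Y"
    and f: "\<And>s t. 0 \<le> s \<Longrightarrow> s \<le> t \<Longrightarrow> t \<le> 1 \<Longrightarrow> f t - f s = inner (X t + Y s) (\<beta> t - \<beta> s)"
  shows "ac_path f (\<lambda>t. inner (X t + Y t) (v t))"
proof -
  note iv = ac_path_integrable [OF \<beta>]
  have i1: "set_integrable lborel {0..1} (\<lambda>t. inner (X t + Y t) (v t))"
    using set_integrable_bilinear_cont [OF bounded_bilinear_inner iv, of "\<lambda>t. X t + Y t"] X Y
    by (simp add: inner_commute continuous_on_add)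
  have "f t - f s = (LINT r:{s<..t}|lborel. inner (X r + Y r) (v r))"
    if st: "0 \<le> s" "s \<le> t" "t \<le> 1" for s t
  proof (rule increment_eq_integral [OF i1 set_integrable_norm [OF iv] _ st])
    fix e :: real assume e: "e > 0"
    obtain d1 where d1: "d1 > 0" "\<And>r t. r \<in> {0..1} \<Longrightarrow> t \<in> {0..1} \<Longrightarrow> \<bar>t - r\<bar> < d1 \<Longrightarrow> norm (X t - X r) < e / 2"
      using uniformly_continuous_interval [OF X] e by (metis half_gt_zero)
    obtain d2 where d2: "d2 > 0" "\<And>r t. r \<in> {0..1} \<Longrightarrow> t \<in> {0..1} \<Longrightarrow> \<bar>t - r\<bar> < d2 \<Longrightarrow> norm (Y t - Y r) < e / 2"
      using uniformly_continuous_interval [OF Y] e by (metis half_gt_zero)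
    show "\<exists>d>0. \<forall>s t. 0 \<le> s \<longrightarrow> s \<le> t \<longrightarrow> t \<le> 1 \<longrightarrow> t - s < d \<longrightarrow>
        norm (f t - f s - (LINT r:{s<..t}|lborel. inner (X r + Y r) (v r)))
        \<le> e * (LINT r:{s<..t}|lborel. norm (v r))"
    proof (intro exI conjI allI impI)
      show "0 < min d1 d2" using d1 d2 by simp
      fix s t :: real assume st: "0 \<le> s" "s \<le> t" "t \<le> 1" "t - s < min d1 d2"
      let ?A = "{s<..t}"
      note I = set_integrable_Ioc [OF _ st(1,3)]
      have 1: "f t - f s = (LINT r:?A|lborel. inner (X t + Y s) (v r))"
        unfolding f [OF st(1-3)] ac_pathD [OF \<beta> st(1-3)]
        by (rule set_integral_bounded_linear(2) [OF bounded_linear_inner_right I [OF iv], symmetric])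
      have j1: "set_integrable lborel ?A (\<lambda>r. inner (X t + Y s) (v r))"
        by (rule set_integral_bounded_linear(1) [OF bounded_linear_inner_right I [OF iv]])
      have "f t - f s - (LINT r:?A|lborel. inner (X r + Y r) (v r)) =
          (LINT r:?A|lborel. inner (X t + Y s) (v r) - inner (X r + Y r) (v r))"
        unfolding 1 using j1 I [OF i1] by simp
      also have "norm \<dots> \<le> (LINT r:?A|lborel. e * norm (v r))"
      proof (rule set_integral_norm_le)
        show "set_integrable lborel ?A (\<lambda>r. inner (X t + Y s) (v r) - inner (X r + Y r) (v r))"
          using j1 I [OF i1] by (rule set_integral_diff(1))
        show "set_integrable lborel ?A (\<lambda>r. e * norm (v r))"
          using I [OF set_integrable_norm [OF iv]] by simp
        fix r assume r: "r \<in> ?A"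
        have nX: "norm (X t - X r) \<le> e / 2" and nY: "norm (Y s - Y r) \<le> e / 2"
          using d1(2) [of r t] d2(2) [of r s] r st by auto
        have "inner (X t + Y s) (v r) - inner (X r + Y r) (v r) = inner ((X t - X r) + (Y s - Y r)) (v r)"
          by (simp add: inner_add_left inner_diff_left)
        also have "norm \<dots> \<le> norm ((X t - X r) + (Y s - Y r)) * norm (v r)"
          by (simp add: Cauchy_Schwarz_ineq2)
        also have "\<dots> \<le> (e / 2 + e / 2) * norm (v r)"
          by (intro mult_right_mono norm_triangle_mono nX nY) auto
        finally show "norm (inner (X t + Y s) (v r) - inner (X r + Y r) (v r)) \<le> e * norm (v r)"
          by simp
      qed
      finally show "norm (f t - f s - (LINT r:?A|lborel. inner (X r + Y r) (v r))) \<le> e * (LINT r:?A|lborel. norm (v r))"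
        by simp
    qed
  qed
  then show ?thesis
    using i1 by (simp add: ac_path_def)
qed

text \<open>On a short interval both the increment of \<open>F\<close> and the integral of
  \<open>f\<close> differ from \<open>(t - s) *\<^sub>R f s\<close> by at most
  \<open>(t - s) * (e / 2)\<close>.\<close>

lemma ac_path_C1:
  fixes F f :: "real \<Rightarrow> 'h::{banach,second_countable_topology}"
  assumes F: "\<And>t. t \<in> {0..1} \<Longrightarrow> (F has_vector_derivative f t) (at t within {0..1})"
    and f: "continuous_on {0..1} f"
  shows "ac_path F f"
proof -
  have i: "set_integrable lborel {0..1} f"
    unfolding set_integrable_def using f by (intro borel_integrable_compact) auto
  have c1: "set_integrable lborel {0..1} (\<lambda>r :: real. 1 :: real)"
    unfolding set_integrable_def by (intro borel_integrable_compact) auto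
  have "F t - F s = (LINT r:{s<..t}|lborel. f r)" if st: "0 \<le> s" "s \<le> t" "t \<le> 1" for s t
  proof (rule increment_eq_integral [OF i c1 _ st])
    fix e :: real assume e: "e > 0"
    obtain d where d: "d > 0" "\<And>r t. r \<in> {0..1} \<Longrightarrow> t \<in> {0..1} \<Longrightarrow> \<bar>t - r\<bar> < d \<Longrightarrow> norm (f t - f r) < e / 2"
      using uniformly_continuous_interval [OF f] e by (metis half_gt_zero)
    show "\<exists>d>0. \<forall>s t. 0 \<le> s \<longrightarrow> s \<le> t \<longrightarrow> t \<le> 1 \<longrightarrow> t - s < d \<longrightarrow>
        norm (F t - F s - (LINT r:{s<..t}|lborel. f r)) \<le> e * (LINT r:{s<..t}|lborel. 1)"
    proof (intro exI conjI allI impI)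
      show "0 < d" by (rule d)
      fix s t :: real assume st: "0 \<le> s" "s \<le> t" "t \<le> 1" "t - s < d"
      let ?A = "{s<..t}"
      note I = set_integrable_Ioc [OF _ st(1,3)]
      have ic: "set_integrable lborel ?A (\<lambda>r. f s)"
        unfolding set_integrable_def by (rule integrable_scaleR_left) (use st in auto)
      have Ic: "(LINT r:?A|lborel. f s) = (t - s) *\<^sub>R f s"
        using st by (simp add: set_lebesgue_integral_def)
      have I1: "(LINT r:?A|lborel. 1) = t - s"
        using st by (simp add: set_lebesgue_integral_def)
      have "norm (F t - F s - (t - s) *\<^sub>R f s) \<le> norm (t - s) * (e / 2)"
      proof (rule vector_differentiable_bound_linearization [where S = "{s..t}"])
        show "(F has_vector_derivative f x) (at x within {s..t})" if "x \<in> {s..t}" for x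
          using F [of x] that st by (auto intro: has_vector_derivative_within_subset)
        show "closed_segment s t \<subseteq> {s..t}" using st by (simp add: closed_segment_eq_real_ivl)
        show "norm (f x - f s) \<le> e / 2" if "x \<in> {s..t}" for x
          using d(2) [of s x] that st by auto
        show "s \<in> {s..t}" using st by simp
      qed
      moreover have "norm (LINT r:?A|lborel. f r - f s) \<le> (LINT r:?A|lborel. e / 2)"
      proof (rule set_integral_norm_le)
        show "set_integrable lborel ?A (\<lambda>r. f r - f s)"
          using I [OF i] ic by (rule set_integral_diff(1))
        show "set_integrable lborel ?A (\<lambda>r. e / 2)"
          using I [OF c1] set_integrable_mult_right [of "e / 2" lborel ?A "\<lambda>r. 1"] by simp
        show "norm (f r - f s) \<le> e / 2" if "r \<in> ?A" for r
          using d(2) [of s r] that st by auto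
      qed
      moreover have "(LINT r:?A|lborel. f r - f s) = (LINT r:?A|lborel. f r) - (t - s) *\<^sub>R f s"
        using I [OF i] ic Ic by simp
      moreover have "(LINT r:?A|lborel. e / 2) = (t - s) * (e / 2)"
        using st by (simp add: set_lebesgue_integral_def)
      ultimately show "norm (F t - F s - (LINT r:?A|lborel. f r)) \<le> e * (LINT r:?A|lborel. 1)"
        using norm_triangle_ineq4 [of "F t - F s - (t - s) *\<^sub>R f s" "(LINT r:?A|lborel. f r) - (t - s) *\<^sub>R f s"] st
        unfolding I1 by (simp add: algebra_simps)
    qed
  qed
  then show ?thesis using i by (simp add: ac_path_def)
qed

section \<open>Sobolev paths\<close>

lemma L2_path_integrable:
  assumes "L2_path v"
  shows "set_integrable lborel {0..1} v"
proof -
  have m: "(\<lambda>t. indicat_real {0<..<1} t *\<^sub>R v t) \<in> borel_measurable lborel"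
    using assms by (simp add: L2_path_def set_borel_measurable_def)
  have i: "set_integrable lborel {0<..<1} (\<lambda>t :: real. 1 + (norm (v t))\<^sup>2)"
  proof (rule set_integral_add(1))
    show "set_integrable lborel {0<..<1} (\<lambda>t :: real. 1 :: real)"
      by (simp add: set_integrable_def)
    show "set_integrable lborel {0<..<1} (\<lambda>t. (norm (v t))\<^sup>2)"
      using assms by (simp add: L2_path_def)
  qed
  have le: "norm (v t) \<le> 1 + (norm (v t))\<^sup>2" for t
    using zero_le_power2 [of "norm (v t) - 1/2"] by (simp add: power2_diff power_divide)
  have "set_integrable lborel {0<..<1} v"
    unfolding set_integrable_def
  proof (rule Bochner_Integration.integrable_bound [OF _ m])
    show "integrable lborel (\<lambda>t. indicat_real {0<..<1} t *\<^sub>R (1 + (norm (v t))\<^sup>2))"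
      using i by (simp only: set_integrable_def)
    show "AE t in lborel. norm (indicat_real {0<..<1} t *\<^sub>R v t)
        \<le> norm (indicat_real {0<..<1} t *\<^sub>R (1 + (norm (v t))\<^sup>2))"
      using le by (auto split: split_indicator simp: abs_of_nonneg)
  qed
  then show ?thesis by (simp only: set_integrable_endpoints)
qed

lemma test_functionD:
  assumes "test_function \<phi>"
  shows "(\<phi> has_field_derivative deriv \<phi> t) (at t)" "continuous_on UNIV (deriv \<phi>)" "\<phi> 0 = 0" "\<phi> 1 = 0"
proof -
  have d: "(deriv ^^ n) \<phi> differentiable_on UNIV" for n
    using assms by (simp add: test_function_def)
  show "(\<phi> has_field_derivative deriv \<phi> t) (at t)"
    using d [of 0] by (simp add: differentiable_on_def DERIV_deriv_iff_real_differentiable)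
  show "continuous_on UNIV (deriv \<phi>)"
    using differentiable_imp_continuous_on [OF d [of 1]] by simp
  obtain l u where "0 < l" "u < 1" "\<forall>t. t \<notin> {l..u} \<longrightarrow> \<phi> t = 0"
    using assms by (auto simp: test_function_def)
  then show "\<phi> 0 = 0" "\<phi> 1 = 0" by auto
qed

lemma ac_path_test_function: "test_function \<phi> \<Longrightarrow> ac_path \<phi> (deriv \<phi>)"
  using test_functionD [of \<phi>]
  by (intro ac_path_C1)
    (auto simp: has_real_derivative_iff_has_vector_derivative intro: has_vector_derivative_at_within continuous_on_subset)

lemma set_integrable_01_open:
  fixes f :: "real \<Rightarrow> 'h::{banach,second_countable_topology}"
  shows "set_integrable lborel {0..1} f \<Longrightarrow> set_integrable lborel {0<..<1} f"
  by (simp add: set_integrable_endpoints)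

text \<open>Integration by parts: the Leibniz rule for \<open>\<phi> t *\<^sub>R \<beta> t\<close>
  over the whole interval, where the test function kills both boundary terms.\<close>

lemma ac_path_imp_weak_derivative:
  assumes \<beta>: "ac_path \<beta> v" "continuous_on {0..1} \<beta>" and v: "L2_path v"
  shows "L2_weak_derivative \<beta> v"
  unfolding L2_weak_derivative_def
proof (intro conjI v allI impI)
  fix \<phi> assume \<phi>: "test_function \<phi>"
  note D = test_functionD [OF \<phi>]
  have \<phi>c: "continuous_on {0..1} \<phi>"
    using D(1) by (meson DERIV_isCont continuous_at_imp_continuous_on)
  have i1: "set_integrable lborel {0<..<1} (\<lambda>t. deriv \<phi> t *\<^sub>R \<beta> t)"
    using set_integrable_bilinear_cont [OF bounded_bilinear_scaleR ac_path_integrable [OF ac_path_test_function [OF \<phi>]] \<beta>(2)]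
    by (rule set_integrable_01_open)
  have i2: "set_integrable lborel {0<..<1} (\<lambda>t. \<phi> t *\<^sub>R v t)"
    using set_integrable_bilinear_cont [OF bounded_bilinear.flip [OF bounded_bilinear_scaleR] ac_path_integrable [OF \<beta>(1)] \<phi>c]
    by (rule set_integrable_01_open)
  have "ac_path (\<lambda>t. \<phi> t *\<^sub>R \<beta> t) (\<lambda>t. deriv \<phi> t *\<^sub>R \<beta> t + \<phi> t *\<^sub>R v t)"
    by (rule ac_path_bilinear [OF bounded_bilinear_scaleR ac_path_test_function [OF \<phi>] \<phi>c \<beta>])
  from ac_pathD [OF this, of 0 1]
  have "0 = (LINT t:{0<..1}|lborel. deriv \<phi> t *\<^sub>R \<beta> t + \<phi> t *\<^sub>R v t)"
    by (simp add: D)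
  also have "\<dots> = (LINT t:{0<..<1}|lborel. deriv \<phi> t *\<^sub>R \<beta> t) + (LINT t:{0<..<1}|lborel. \<phi> t *\<^sub>R v t)"
    unfolding set_integral_endpoints(2) by (rule set_integral_add(2) [OF i1 i2])
  finally show "(LINT t:{0<..<1}|lborel. deriv \<phi> t *\<^sub>R \<beta> t) = - (LINT t:{0<..<1}|lborel. \<phi> t *\<^sub>R v t)"
    by (simp add: eq_neg_iff_add_eq_0)
qed

section \<open>Weakly differentiable continuous paths are absolutely continuous\<close>

lemma continuous_indefinite_integral:
  fixes v :: "real \<Rightarrow> 'h::{banach,second_countable_topology}"
  assumes v: "set_integrable lborel {0..1} v"
  shows "continuous_on {0..1} (\<lambda>t. LINT r:{0<..t}|lborel. v r)"
  unfolding continuous_on_sequentially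
proof (intro allI ballI impI, elim conjE)
  fix x :: "nat \<Rightarrow> real" and l assume l: "l \<in> {0..1}" and x: "\<forall>n. x n \<in> {0..1}" "x \<longlonglongrightarrow> l"
  show "((\<lambda>t. LINT r:{0<..t}|lborel. v r) \<circ> x) \<longlonglongrightarrow> (LINT r:{0<..l}|lborel. v r)"
    unfolding o_def set_lebesgue_integral_def
  proof (rule integral_dominated_convergence)
    show "integrable lborel (\<lambda>r. norm (indicat_real {0..1} r *\<^sub>R v r))"
      using v unfolding set_integrable_def by (rule integrable_norm)
    have m: "(\<lambda>r. indicat_real {0<..t} r *\<^sub>R v r) \<in> borel_measurable lborel" if "t \<le> 1" for t
      using set_integrable_Ioc [OF v, of 0 t] that unfolding set_integrable_def by auto
    show "(\<lambda>r. indicat_real {0<..l} r *\<^sub>R v r) \<in> borel_measurable lborel"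
      using l by (intro m) auto
    show "(\<lambda>r. indicat_real {0<..x n} r *\<^sub>R v r) \<in> borel_measurable lborel" for n
      using x(1) by (intro m) auto
    show "AE r in lborel. norm (indicat_real {0<..x n} r *\<^sub>R v r) \<le> norm (indicat_real {0..1} r *\<^sub>R v r)" for n
      using x(1) [rule_format, of n] by (auto split: split_indicator)
    have "AE r in lborel. r \<noteq> l"
      by (rule AE_lborel_singleton)
    then show "AE r in lborel. (\<lambda>n. indicat_real {0<..x n} r *\<^sub>R v r) \<longlonglongrightarrow> indicat_real {0<..l} r *\<^sub>R v r"
    proof eventually_elim
      case (elim r)
      have "\<forall>\<^sub>F n in sequentially. (r \<le> x n) = (r \<le> l)"
      proof (cases "r < l")
        case True
        have "\<forall>\<^sub>F n in sequentially. r < x n" using order_tendstoD(1) [OF x(2) True] .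
        then show ?thesis by eventually_elim (use True in auto)
      next
        case False
        then have "\<forall>\<^sub>F n in sequentially. x n < r" using order_tendstoD(2) [OF x(2), of r] elim by simp
        then show ?thesis by eventually_elim (use False elim in auto)
      qed
      then have "\<forall>\<^sub>F n in sequentially. indicat_real {0<..l} r *\<^sub>R v r = indicat_real {0<..x n} r *\<^sub>R v r"
        by eventually_elim (simp split: split_indicator)
      then show ?case by (rule Lim_transform_eventually [OF tendsto_const])
    qed
  qed
qed

lemma ac_path_indefinite_integral:
  fixes v :: "real \<Rightarrow> 'h::{banach,second_countable_topology}"
  assumes v: "set_integrable lborel {0..1} v"
  shows "ac_path (\<lambda>t. LINT r:{0<..t}|lborel. v r) v"
  unfolding ac_path_def
proof (intro conjI v allI impI)
  fix s t :: real assume "0 \<le> s" "s \<le> t" "t \<le> 1"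
  then show "(LINT r:{0<..t}|lborel. v r) - (LINT r:{0<..s}|lborel. v r) = (LINT r:{s<..t}|lborel. v r)"
    using set_integral_Ioc_combine [OF v, of 0 s t] by simp
qed

text \<open>A difference of two steep steps at \<open>s\<close> and \<open>t\<close> is a test
  function; testing with it shows that the averages of \<open>D\<close> against two bumps of mass
  one, around \<open>s\<close> and around \<open>t\<close>, coincide. As the bumps shrink, these
  averages approach \<open>D s\<close> and \<open>D t\<close>.\<close>

lemma du_Bois_Reymond:
  fixes D :: "real \<Rightarrow> 'h::{banach,second_countable_topology}"
  assumes D: "continuous_on {0..1} D"
    and orth: "\<And>\<phi>. test_function \<phi> \<Longrightarrow> (LINT t:{0<..<1}|lborel. deriv \<phi> t *\<^sub>R D t) = 0"
    and s: "0 < s" "s < 1" and t: "0 < t" "t < 1"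
  shows "D s = D t"
proof -
  obtain \<eta> where \<eta>: "\<And>x. (smooth_step has_field_derivative \<eta> x) (at x)" "\<And>x. \<eta> x \<ge> 0"
    "\<And>x. \<bar>x\<bar> > 1 \<Longrightarrow> \<eta> x = 0" "continuous_on UNIV \<eta>"
    using smooth_step_derivative by blast
  have main: "norm (D s - D t) \<le> 2 * e" if e: "e > 0" for e
  proof -
    obtain d where d: "d > 0" "\<And>r t. r \<in> {0..1} \<Longrightarrow> t \<in> {0..1} \<Longrightarrow> \<bar>t - r\<bar> < d \<Longrightarrow> norm (D t - D r) < e"
      using uniformly_continuous_interval [OF D e] by blast
    \<comment> \<open>The width keeps both bumps inside the open unit interval and below the
      continuity modulus \<open>d\<close>; taking half of the minimum makes all inequalities
      strict.\<close>
    define m where "m = min d (min (min s t) (min (1 - s) (1 - t)))"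
    define \<delta> where "\<delta> = m / 2"
    have "0 < m" "m \<le> d" "m \<le> s" "m \<le> t" "m \<le> 1 - s" "m \<le> 1 - t"
      using d(1) s t by (auto simp: m_def)
    then have \<delta>: "0 < \<delta>" "\<delta> < d" "\<delta> < s" "\<delta> < t" "s + \<delta> < 1" "t + \<delta> < 1"
      unfolding \<delta>_def by linarith+
    define p where "p u r = \<eta> ((r - u) / \<delta>) / \<delta>" for u r
    have p_cont: "continuous_on {0..1} (p u)" for u
      unfolding p_def using \<delta>(1)
      by (intro continuous_intros continuous_on_compose2 [OF \<eta>(4)]) auto
    have p_deriv: "((\<lambda>r. smooth_step ((r - u) / \<delta>)) has_field_derivative p u r) (at r)" for u r
    proof -
      have "((\<lambda>r. (r - u) / \<delta>) has_field_derivative 1 / \<delta>) (at r)"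
        using \<delta>(1) by (auto intro!: derivative_eq_intros)
      then show ?thesis
        using DERIV_chain2 [of smooth_step "\<eta> ((r - u) / \<delta>)" "\<lambda>r. (r - u) / \<delta>" r "1 / \<delta>" UNIV] \<eta>(1)
        by (simp add: p_def)
    qed
    have p_int: "set_integrable lborel {0..1} (p u)" for u
      unfolding set_integrable_def by (intro borel_integrable_compact p_cont) auto
    have p_one: "(LINT r:{0<..<1}|lborel. p u r) = 1" if u: "\<delta> < u" "u + \<delta> < 1" for u
    proof -
      have "ac_path (\<lambda>r. smooth_step ((r - u) / \<delta>)) (p u)"
        using p_deriv by (intro ac_path_C1 p_cont)
          (auto simp: has_real_derivative_iff_has_vector_derivative intro: has_vector_derivative_at_within)
      from ac_pathD [OF this, of 0 1]
      have "(LINT r:{0<..1}|lborel. p u r) = smooth_step ((1 - u) / \<delta>) - smooth_step ((0 - u) / \<delta>)"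
        by simp
      also have "\<dots> = 1"
        using u \<delta>(1) by (simp add: smooth_step_0 smooth_step_1 field_simps)
      finally show ?thesis by (simp only: set_integral_endpoints(2))
    qed
    define J where "J u = (LINT r:{0<..<1}|lborel. p u r *\<^sub>R D r)" for u
    have pD_int: "set_integrable lborel {0<..<1} (\<lambda>r. p u r *\<^sub>R D r)" for u
      by (intro set_integrable_01_open set_integrable_bilinear_cont [OF bounded_bilinear_scaleR p_int D])
    have J: "norm (J u - D u) \<le> e" if u: "\<delta> < u" "u + \<delta> < 1" for u
    proof -
      have c_int: "set_integrable lborel {0<..<1} (\<lambda>r. p u r *\<^sub>R D u)"
        by (intro set_integrable_01_open set_integrable_bilinear_cont [OF bounded_bilinear_scaleR p_int]) auto
      have "(LINT r:{0<..<1}|lborel. p u r *\<^sub>R D u) = D u"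
        using p_one [OF u] set_integral_bounded_linear(2) [OF bounded_linear_scaleR_left set_integrable_01_open [OF p_int [of u]], of "D u"]
        by simp
      then have "J u - D u = (LINT r:{0<..<1}|lborel. p u r *\<^sub>R D r - p u r *\<^sub>R D u)"
        unfolding J_def using pD_int c_int by simp
      also have "norm \<dots> \<le> (LINT r:{0<..<1}|lborel. e * p u r)"
      proof (rule set_integral_norm_le)
        show "set_integrable lborel {0<..<1} (\<lambda>r. p u r *\<^sub>R D r - p u r *\<^sub>R D u)"
          using pD_int c_int by (rule set_integral_diff(1))
        show "set_integrable lborel {0<..<1} (\<lambda>r. e * p u r)"
          using set_integrable_01_open [OF p_int [of u]] by simp
        fix r :: real assume r: "r \<in> {0<..<1}"
        have p0: "p u r \<ge> 0" using \<eta>(2) \<delta>(1) by (simp add: p_def)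
        show "norm (p u r *\<^sub>R D r - p u r *\<^sub>R D u) \<le> e * p u r"
        proof (cases "\<bar>r - u\<bar> < d")
          case True
          then have "norm (D r - D u) \<le> e"
            using d(2) [of u r] r u \<delta>(1) by auto
          then have "p u r * norm (D r - D u) \<le> p u r * e"
            using p0 by (intro mult_left_mono)
          moreover have "norm (p u r *\<^sub>R D r - p u r *\<^sub>R D u) = p u r * norm (D r - D u)"
            using p0 by (simp flip: scaleR_right_diff_distrib)
          ultimately show ?thesis by (simp add: mult.commute)
        next
          case False
          then have "\<bar>(r - u) / \<delta>\<bar> > 1" using \<delta>(1,2) by (simp add: less_divide_eq)
          then have "p u r = 0" by (simp add: p_def \<eta>(3))
          then show ?thesis by simp
        qed
      qed
      also have "\<dots> = e" using p_one [OF u] by simp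
      finally show ?thesis .
    qed
    have "J s = J t"
    proof -
      let ?\<phi> = "\<lambda>r. smooth_step ((r - s) / \<delta>) - smooth_step ((r - t) / \<delta>)"
      have \<phi>: "test_function ?\<phi>"
        using s t \<delta> by (intro test_function_difference_of_steps) auto
      have "deriv ?\<phi> r = p s r - p t r" for r
        by (intro DERIV_imp_deriv DERIV_diff p_deriv)
      then have "0 = (LINT r:{0<..<1}|lborel. p s r *\<^sub>R D r - p t r *\<^sub>R D r)"
        using orth [OF \<phi>] by (simp add: scaleR_left_diff_distrib)
      then show ?thesis
        unfolding J_def using pD_int by simp
    qed
    moreover have "norm (J s - D s) \<le> e" "norm (J t - D t) \<le> e"
      using \<delta> by (auto intro: J)
    ultimately show ?thesis
      using norm_triangle_ineq4 [of "J t - D t" "J s - D s"] by simp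
  qed
  then have "norm (D s - D t) \<le> 0 + e" if "e > 0" for e
    using main [of "e / 2"] that by simp
  then have "norm (D s - D t) \<le> 0"
    by (rule field_le_epsilon)
  then show ?thesis by simp
qed

text \<open>The primitive \<open>W\<close> of \<open>v\<close> has the same weak derivative, so
  \<open>\<beta> - W\<close> is constant in the interior by du Bois-Reymond, and up to the endpoints
  by continuity.\<close>

lemma weak_derivative_imp_ac_path:
  assumes w: "L2_weak_derivative \<beta> v" and \<beta>: "continuous_on {0..1} \<beta>"
  shows "ac_path \<beta> v"
proof -
  have v: "L2_path v" using w by (simp add: L2_weak_derivative_def)
  note iv = L2_path_integrable [OF v]
  define W where "W t = (LINT r:{0<..t}|lborel. v r)" for t
  have W: "ac_path W v" "continuous_on {0..1} W"
    unfolding W_def [abs_def]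
    using ac_path_indefinite_integral [OF iv] continuous_indefinite_integral [OF iv] by auto
  have wW: "L2_weak_derivative W v"
    by (rule ac_path_imp_weak_derivative [OF W v])
  define D where "D t = \<beta> t - W t" for t
  have Dc: "continuous_on {0..1} D"
    unfolding D_def by (intro continuous_intros \<beta> W)
  have orth: "(LINT t:{0<..<1}|lborel. deriv \<phi> t *\<^sub>R D t) = 0" if \<phi>: "test_function \<phi>" for \<phi>
  proof -
    have i: "set_integrable lborel {0<..<1} (\<lambda>t. deriv \<phi> t *\<^sub>R X t)"
      if "continuous_on {0..1} X" for X :: "real \<Rightarrow> 'a"
      by (intro set_integrable_01_open set_integrable_bilinear_cont [OF bounded_bilinear_scaleR] that
          ac_path_integrable [OF ac_path_test_function [OF \<phi>]])
    have "(LINT t:{0<..<1}|lborel. deriv \<phi> t *\<^sub>R D t) =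
        (LINT t:{0<..<1}|lborel. deriv \<phi> t *\<^sub>R \<beta> t) - (LINT t:{0<..<1}|lborel. deriv \<phi> t *\<^sub>R W t)"
      unfolding D_def scaleR_right_diff_distrib by (rule set_integral_diff(2) [OF i [OF \<beta>] i [OF W(2)]])
    then show ?thesis
      using w wW \<phi> by (simp add: L2_weak_derivative_def)
  qed
  have Dconst: "D t = D (1/2)" if "t \<in> {0..1}" for t
  proof (rule continuous_constant_on_closure [of "{0<..<1}"])
    show "continuous_on (closure {0<..<1}) D" using Dc by simp
    show "D x = D (1/2)" if "x \<in> {0<..<1}" for x
      using that by (intro du_Bois_Reymond [OF Dc orth]) auto
    show "t \<in> closure {0<..<1}" using that by simp
  qed
  have "\<beta> t - \<beta> s = W t - W s" if "0 \<le> s" "s \<le> t" "t \<le> 1" for s t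
  proof -
    have "\<beta> t - W t = \<beta> s - W s"
      using Dconst [of s] Dconst [of t] that by (simp add: D_def)
    then have "\<beta> t = \<beta> s - W s + W t"
      by (metis diff_add_cancel)
    then show ?thesis by simp
  qed
  then show ?thesis
    using W(1) by (simp add: ac_path_def)
qed

text \<open>The difference of the densities integrates to zero over half-open intervals. These form
  an intersection-stable generator, so it integrates to zero over every Borel set. This identifies
  the weak derivative, selected by choice in \<open>weak_deriv\<close>, almost everywhere.\<close>

lemma ac_path_derivative_unique:
  assumes v: "ac_path \<beta> v" and v': "ac_path \<beta> v'"
  shows "AE t in lborel. t \<in> {0<..<1} \<longrightarrow> v t = v' t"
proof -
  define d where "d r = v r - v' r" for r
  have id: "set_integrable lborel {0..1} d"
    unfolding d_def using ac_path_integrable [OF v] ac_path_integrable [OF v'] by (rule set_integral_diff(1))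
  define f where "f r = indicat_real {0<..1} r *\<^sub>R d r" for r
  have f: "integrable lborel f"
    using set_integrable_Ioc [OF id, of 0 1] unfolding f_def [abs_def] set_integrable_def by simp
  have fA: "set_integrable lborel A f" if "A \<in> sets borel" for A
    unfolding set_integrable_def using that f by (intro integrable_mult_indicator) auto
  have Ioc: "(LINT r:{s<..t}|lborel. f r) = 0" for s t
  proof -
    let ?s = "max s 0" and ?t = "min t 1"
    have "indicat_real {s<..t} r *\<^sub>R f r = indicat_real {?s<..?t} r *\<^sub>R d r" for r
      by (simp add: f_def split: split_indicator)
    then have eq: "(LINT r:{s<..t}|lborel. f r) = (LINT r:{?s<..?t}|lborel. d r)"
      by (simp add: set_lebesgue_integral_def)
    show ?thesis
    proof (cases "?s \<le> ?t")
      case True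
      then have st: "0 \<le> ?s" "?s \<le> ?t" "?t \<le> 1" by auto
      have "(LINT r:{?s<..?t}|lborel. d r) = (LINT r:{?s<..?t}|lborel. v r) - (LINT r:{?s<..?t}|lborel. v' r)"
        unfolding d_def
        by (intro set_integral_diff(2) set_integrable_Ioc ac_path_integrable [OF v] ac_path_integrable [OF v'] st)
      then show ?thesis
        using ac_pathD [OF v st] ac_pathD [OF v' st] eq by simp
    next
      case False
      then have "{?s<..?t} = {}" by (simp only: greaterThanAtMost_empty_iff not_le)
      then show ?thesis unfolding eq by (simp only: set_lebesgue_integral_def) simp
    qed
  qed
  have f_total: "(LINT r|lborel. f r) = 0"
  proof -
    have "(LINT r|lborel. f r) = (LINT r:{0<..1}|lborel. f r)"
      unfolding set_lebesgue_integral_def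
      by (intro Bochner_Integration.integral_cong) (auto simp: f_def split: split_indicator)
    then show ?thesis using Ioc by simp
  qed
  have "(LINT r:A|lborel. f r) = 0" if A: "A \<in> sets lborel" for A
  proof -
    let ?G = "range (\<lambda>(a, b). {a<..b::real})"
    have "Int_stable ?G"
    proof (rule Int_stableI)
      fix a b assume "a \<in> ?G" "b \<in> ?G"
      then obtain i j k l where "a = {i<..j}" "b = {k<..l}" by auto
      then have "a \<inter> b = {max i k<..min j l}" by auto
      then show "a \<inter> b \<in> ?G" by auto
    qed
    moreover have "?G \<subseteq> Pow UNIV" by simp
    moreover have "A \<in> sigma_sets UNIV ?G"
      using A by (simp add: borel_sigma_sets_Ioc)
    ultimately show ?thesis
    proof (induction rule: sigma_sets_induct_disjoint)
      case (basic A)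
      then show ?case using Ioc by auto
    next
      case empty
      show ?case by (simp add: set_lebesgue_integral_def)
    next
      case (compl A)
      then have A: "A \<in> sets borel" by (simp add: borel_sigma_sets_Ioc)
      have "(LINT r:UNIV - A|lborel. f r) + (LINT r:A|lborel. f r) = (LINT r:(UNIV - A) \<union> A|lborel. f r)"
        using A by (intro set_integral_Un [symmetric] fA) auto
      also have "\<dots> = 0"
        using f_total by (simp add: set_lebesgue_integral_def)
      finally show ?case using compl by simp
    next
      case (union A)
      then have A: "A i \<in> sets borel" for i by (auto simp: borel_sigma_sets_Ioc)
      have "(LINT r:(\<Union>i. A i)|lborel. f r) = (\<Sum>i. (LINT r:A i|lborel. f r))"
        using A union(1) by (intro lebesgue_integral_countable_add fA) (auto simp: disjoint_family_on_def)
      then show ?case using union by simp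
    qed
  qed
  then have "AE r in lborel. f r = 0"
    by (intro sigma_finite_measure.density_zero [OF sigma_finite_lborel] f)
  then show ?thesis
    by eventually_elim (auto simp: f_def d_def split: split_indicator_asm)
qed

lemma H1_path_ac:
  assumes "H1_path \<beta>"
  shows "ac_path \<beta> (weak_deriv \<beta>)" "L2_path (weak_deriv \<beta>)" "continuous_on {0..1} \<beta>"
proof -
  have "L2_weak_derivative \<beta> (weak_deriv \<beta>)"
  proof -
    obtain v where "L2_weak_derivative \<beta> v" using assms by (auto simp: H1_path_def)
    then show ?thesis
      unfolding weak_deriv_def by (rule someI [where P = "L2_weak_derivative \<beta>"])
  qed
  then show "ac_path \<beta> (weak_deriv \<beta>)" "L2_path (weak_deriv \<beta>)" "continuous_on {0..1} \<beta>"
    using assms weak_derivative_imp_ac_path by (auto simp: H1_path_def L2_weak_derivative_def)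
qed

lemma continuous_imp_L2_path:
  assumes "continuous_on {0..1} \<beta>"
  shows "L2_path \<beta>"
  unfolding L2_path_def
proof
  have "(\<lambda>t. indicat_real {0<..<1} t *\<^sub>R \<beta> t) \<in> borel_measurable borel"
    using assms by (intro borel_measurable_continuous_on_indicator) (auto intro: continuous_on_subset)
  then show "set_borel_measurable lborel {0<..<1} \<beta>"
    by (simp add: set_borel_measurable_def)
  have "set_integrable lborel {0..1} (\<lambda>t. (norm (\<beta> t))\<^sup>2)"
    unfolding set_integrable_def using assms by (intro borel_integrable_compact continuous_intros) auto
  then show "set_integrable lborel {0<..<1} (\<lambda>t. (norm (\<beta> t))\<^sup>2)"
    by (rule set_integrable_01_open)
qed

lemma ac_path_H1:
  assumes "ac_path \<beta> v" "continuous_on {0..1} \<beta>" "L2_path v"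
  shows "H1_path \<beta>" "AE t in lborel. t \<in> {0<..<1} \<longrightarrow> weak_deriv \<beta> t = v t"
proof -
  show H: "H1_path \<beta>"
    using ac_path_imp_weak_derivative [OF assms] continuous_imp_L2_path assms
    by (auto simp: H1_path_def)
  show "AE t in lborel. t \<in> {0<..<1} \<longrightarrow> weak_deriv \<beta> t = v t"
    by (rule ac_path_derivative_unique [OF H1_path_ac(1) [OF H] assms(1)])
qed

section \<open>Lower integrals\<close>

text \<open>No measurability of \<open>g\<close> is needed, as \<open>nn_integral\<close> is a supremum over simple functions
  below the integrand.  This spares us from proving the integrand of the energy measurable.\<close>

lemma nn_integral_add_real:
  fixes g :: "'b \<Rightarrow> ennreal" and r :: "'b \<Rightarrow> real"
  assumes r: "r \<in> borel_measurable M"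
  shows "(\<integral>\<^sup>+x. g x + ennreal (r x) \<partial>M) = (\<integral>\<^sup>+x. g x \<partial>M) + (\<integral>\<^sup>+x. ennreal (r x) \<partial>M)"
proof (rule antisym)
  have rm: "(\<lambda>x. ennreal (r x)) \<in> borel_measurable M" using r by simp
  show "(\<integral>\<^sup>+x. g x + ennreal (r x) \<partial>M) \<le> (\<integral>\<^sup>+x. g x \<partial>M) + (\<integral>\<^sup>+x. ennreal (r x) \<partial>M)"
    unfolding nn_integral_def [of M "\<lambda>x. g x + ennreal (r x)"]
  proof (rule SUP_least, clarify)
    fix s assume s: "simple_function M s" "s \<le> (\<lambda>x. g x + ennreal (r x))"
    have sm: "s \<in> borel_measurable M" using s(1) by (rule borel_measurable_simple_function)
    have "integral\<^sup>S M s = (\<integral>\<^sup>+x. s x \<partial>M)" using s(1) by (rule nn_integral_eq_simple_integral [symmetric])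
    \<comment> \<open>The truncated difference \<open>s x - ennreal (r x)\<close> is a measurable
      minorant of \<open>g\<close>, to which ordinary additivity applies.\<close>
    also have "\<dots> \<le> (\<integral>\<^sup>+x. (s x - ennreal (r x)) + ennreal (r x) \<partial>M)"
    proof (rule nn_integral_mono)
      show "s x \<le> (s x - ennreal (r x)) + ennreal (r x)" for x
      proof (cases "ennreal (r x) \<le> s x")
        case False
        then have "s x \<le> 0 + ennreal (r x)" by simp
        also have "\<dots> \<le> (s x - ennreal (r x)) + ennreal (r x)" by (intro add_right_mono) simp
        finally show ?thesis .
      qed (simp add: diff_add_cancel_ennreal)
    qed
    also have "\<dots> = (\<integral>\<^sup>+x. s x - ennreal (r x) \<partial>M) + (\<integral>\<^sup>+x. ennreal (r x) \<partial>M)"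
      using sm rm by (intro nn_integral_add) auto
    also have "(\<integral>\<^sup>+x. s x - ennreal (r x) \<partial>M) \<le> (\<integral>\<^sup>+x. g x \<partial>M)"
    proof (rule nn_integral_mono)
      show "s x - ennreal (r x) \<le> g x" for x
        using le_funD [OF s(2), of x] by (simp add: ennreal_minus_le_iff add.commute)
    qed
    finally show "integral\<^sup>S M s \<le> (\<integral>\<^sup>+x. g x \<partial>M) + (\<integral>\<^sup>+x. ennreal (r x) \<partial>M)"
      by (simp add: add_right_mono)
  qed
  show "(\<integral>\<^sup>+x. g x \<partial>M) + (\<integral>\<^sup>+x. ennreal (r x) \<partial>M) \<le> (\<integral>\<^sup>+x. g x + ennreal (r x) \<partial>M)"
  proof -
    let ?S = "{s. simple_function M s \<and> s \<le> g}"
    have ne: "?S \<noteq> {}"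
      by (auto intro!: exI [of _ "\<lambda>_. 0"] simp: le_fun_def)
    have "(\<integral>\<^sup>+x. g x \<partial>M) + (\<integral>\<^sup>+x. ennreal (r x) \<partial>M) =
        (SUP s\<in>?S. integral\<^sup>S M s + (\<integral>\<^sup>+x. ennreal (r x) \<partial>M))"
      unfolding nn_integral_def [of M g] using ne by (simp add: ennreal_SUP_add_left)
    also have "\<dots> \<le> (\<integral>\<^sup>+x. g x + ennreal (r x) \<partial>M)"
    proof (rule SUP_least, clarify)
      fix s assume s: "simple_function M s" "s \<le> g"
      have "integral\<^sup>S M s + (\<integral>\<^sup>+x. ennreal (r x) \<partial>M) = (\<integral>\<^sup>+x. s x + ennreal (r x) \<partial>M)"
        using s(1) rm by (simp add: nn_integral_eq_simple_integral nn_integral_add borel_measurable_simple_function)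
      also have "\<dots> \<le> (\<integral>\<^sup>+x. g x + ennreal (r x) \<partial>M)"
        using s(2) by (intro nn_integral_mono add_right_mono) (simp add: le_fun_def)
      finally show "integral\<^sup>S M s + (\<integral>\<^sup>+x. ennreal (r x) \<partial>M) \<le> (\<integral>\<^sup>+x. g x + ennreal (r x) \<partial>M)" .
    qed
    finally show ?thesis .
  qed
qed

text \<open>The increment \<open>\<rho>\<close> may change sign while \<open>ennreal\<close> has no
  negative values. So its negative part is added on one side and its positive part on the other; the
  integral of the negative part is finite and cancels even if the remaining integrals are
  infinite.\<close>

lemma nn_integral_add_signed:
  fixes g g' \<rho> :: "real \<Rightarrow> real"
  assumes ae: "AE t in lborel. t \<in> A \<longrightarrow> g' t = g t + \<rho> t \<and> 0 \<le> g t \<and> 0 \<le> g' t"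
    and \<rho>: "set_integrable lborel A \<rho>" and R: "(LINT t:A|lborel. \<rho> t) = R" "R \<ge> 0"
  shows "(\<integral>\<^sup>+t\<in>A. ennreal (g' t) \<partial>lborel) = (\<integral>\<^sup>+t\<in>A. ennreal (g t) \<partial>lborel) + ennreal R"
proof -
  define P where "P t = max 0 (indicat_real A t *\<^sub>R \<rho> t)" for t
  define N where "N t = max 0 (- (indicat_real A t *\<^sub>R \<rho> t))" for t
  have i: "integrable lborel (\<lambda>t. indicat_real A t *\<^sub>R \<rho> t)"
    using \<rho> by (simp add: set_integrable_def)
  have P: "integrable lborel P" and N: "integrable lborel N"
    unfolding P_def [abs_def] N_def [abs_def] using i by auto
  have PN: "(LINT t|lborel. P t) = (LINT t|lborel. N t) + R"
  proof -
    have "(LINT t|lborel. P t) - (LINT t|lborel. N t) = (LINT t|lborel. P t - N t)"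
      using P N by simp
    also have "(\<lambda>t. P t - N t) = (\<lambda>t. indicat_real A t *\<^sub>R \<rho> t)"
      by (auto simp: P_def N_def fun_eq_iff)
    finally show ?thesis using R(1) by (simp add: set_lebesgue_integral_def)
  qed
  have N0: "(LINT t|lborel. N t) \<ge> 0"
    by (intro integral_nonneg_AE AE_I2) (simp add: N_def)
  have iP: "(\<integral>\<^sup>+t. ennreal (P t) \<partial>lborel) = ennreal (LINT t|lborel. P t)"
    and iN: "(\<integral>\<^sup>+t. ennreal (N t) \<partial>lborel) = ennreal (LINT t|lborel. N t)"
    by (intro nn_integral_eq_integral P N AE_I2; simp add: P_def N_def)+
  have "(\<integral>\<^sup>+t. ennreal (g' t) * indicator A t + ennreal (N t) \<partial>lborel) =
      (\<integral>\<^sup>+t. ennreal (g t) * indicator A t + ennreal (P t) \<partial>lborel)"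
  proof (rule nn_integral_cong_AE)
    show "AE t in lborel. ennreal (g' t) * indicator A t + ennreal (N t) = ennreal (g t) * indicator A t + ennreal (P t)"
      using ae
    proof eventually_elim
      case (elim t)
      show ?case
      proof (cases "t \<in> A")
        case True
        then have "g' t + N t = g t + P t"
          using elim by (auto simp: N_def P_def max_def)
        moreover have "ennreal (g' t + N t) = ennreal (g' t) + ennreal (N t)"
          using elim True by (intro ennreal_plus) (auto simp: N_def)
        moreover have "ennreal (g t + P t) = ennreal (g t) + ennreal (P t)"
          using elim True by (intro ennreal_plus) (auto simp: P_def)
        ultimately show ?thesis
          using True by simp
      qed (simp add: N_def P_def)
    qed
  qed
  then have "(\<integral>\<^sup>+t\<in>A. ennreal (g' t) \<partial>lborel) + ennreal (LINT t|lborel. N t) =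
      (\<integral>\<^sup>+t\<in>A. ennreal (g t) \<partial>lborel) + ennreal (LINT t|lborel. P t)"
    using P N by (simp add: nn_integral_add_real iP iN borel_measurable_integrable)
  then have "ennreal (LINT t|lborel. N t) + (\<integral>\<^sup>+t\<in>A. ennreal (g' t) \<partial>lborel) =
      ennreal (LINT t|lborel. N t) + ((\<integral>\<^sup>+t\<in>A. ennreal (g t) \<partial>lborel) + ennreal R)"
    unfolding PN using N0 R(2) by (simp add: ac_simps)
  then show ?thesis
    by (simp add: ennreal_add_left_cancel)
qed

section \<open>Injectivity of the embedding of measures\<close>

inductive exp_combination :: "('a::euclidean_space \<Rightarrow> real) \<Rightarrow> bool" where
  "exp_combination (\<lambda>x. c * exp (inner z x))"
| "exp_combination f \<Longrightarrow> exp_combination g \<Longrightarrow> exp_combination (\<lambda>x. f x + g x)"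

lemma exp_combination_mult:
  assumes "exp_combination f" "exp_combination g"
  shows "exp_combination (\<lambda>x. f x * g x)"
  using assms
proof (induction f)
  case (1 c z)
  from 1 show ?case
  proof (induction g)
    case (1 d y)
    have "(\<lambda>x. c * exp (inner z x) * (d * exp (inner y x))) = (\<lambda>x. c * d * exp (inner (z + y) x))"
      by (simp add: fun_eq_iff inner_add_left exp_add)
    then show ?case by (simp only: exp_combination.intros)
  next
    case (2 f g)
    then show ?case by (simp only: distrib_left exp_combination.intros)
  qed
next
  case (2 f1 f2)
  then show ?case by (simp only: distrib_right exp_combination.intros)
qed

text \<open>Stone-Weierstrass: sums of exponentials form an algebra, contain the constants through
  \<open>z = 0\<close>, and separate \<open>x\<close> from \<open>y\<close> through
  \<open>z = x - y\<close>.\<close>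

lemma exp_combination_dense:
  fixes f :: "'a::euclidean_space \<Rightarrow> real"
  assumes "compact K" "continuous_on K f" "e > 0"
  obtains g where "exp_combination g" "\<And>x. x \<in> K \<Longrightarrow> \<bar>f x - g x\<bar> < e"
proof -
  have "\<exists>g. exp_combination g \<and> (\<forall>x\<in>K. \<bar>f x - g x\<bar> < e)"
  proof (rule Stone_Weierstrass_HOL [OF assms(1) _ _ _ _ _ assms(2,3)])
    show "exp_combination (\<lambda>x::'a. c)" for c
      using exp_combination.intros(1) [of c 0] by simp
    show "continuous_on K g" if "exp_combination g" for g
      using that by induction (auto intro!: continuous_intros)
    show "exp_combination (\<lambda>x. g x + h x)" if "exp_combination g \<and> exp_combination h" for g h :: "'a \<Rightarrow> real"
      using that by (auto intro: exp_combination.intros)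
    show "exp_combination (\<lambda>x. g x * h x)" if "exp_combination g \<and> exp_combination h" for g h :: "'a \<Rightarrow> real"
      using that by (auto intro: exp_combination_mult)
    show "\<exists>g. exp_combination g \<and> g x \<noteq> g y" if "x \<in> K \<and> y \<in> K \<and> x \<noteq> y" for x y
    proof (intro exI conjI)
      show "exp_combination (\<lambda>u. 1 * exp (inner (x - y) u))"
        by (rule exp_combination.intros)
      have "inner (x - y) (x - y) \<noteq> 0" using that by simp
      then show "1 * exp (inner (x - y) x) \<noteq> 1 * exp (inner (x - y) y)"
        by (simp add: inner_diff_right)
    qed
  qed
  then show ?thesis using that by blast
qed

text \<open>The indicator of a closed set is the pointwise limit of
  \<open>max 0 (1 - real n * infdist x C)\<close>, since the distance is positive off
  \<open>C\<close>. Dominated convergence gives equality on closed sets, an intersection-stable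
  generator of the Borel sets.\<close>

lemma prob_eqI_continuous:
  fixes \<mu> \<nu> :: "'a::euclidean_space measure"
  assumes \<mu>: "borel_prob \<mu>" and \<nu>: "borel_prob \<nu>"
    and eq: "\<And>f. continuous_on UNIV f \<Longrightarrow> (\<And>x. 0 \<le> f x) \<Longrightarrow> (\<And>x. f x \<le> 1) \<Longrightarrow>
      (LINT x|\<mu>. f x) = (LINT x|\<nu>. f x :: real)"
  shows "\<mu> = \<nu>"
proof -
  interpret \<mu>: prob_space \<mu> using \<mu> by (simp add: borel_prob_def)
  interpret \<nu>: prob_space \<nu> using \<nu> by (simp add: borel_prob_def)
  have s: "sets \<mu> = sets borel" "sets \<nu> = sets borel"
    using \<mu> \<nu> by (auto simp: borel_prob_def)
  have closed_eq: "emeasure \<mu> C = emeasure \<nu> C" if C: "closed C" for C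
  proof (cases "C = {}")
    case False
    define f where "f n x = max 0 (1 - real n * infdist x C)" for n x
    have fc: "continuous_on UNIV (f n)" for n
      unfolding f_def by (intro continuous_intros continuous_on_infdist)
    have f01: "0 \<le> f n x" "f n x \<le> 1" for n x
      by (auto simp: f_def infdist_nonneg)
    have lim: "(\<lambda>n. f n x) \<longlonglongrightarrow> indicat_real C x" for x
    proof (cases "x \<in> C")
      case True
      then show ?thesis by (simp add: f_def)
    next
      case False
      then have pos: "infdist x C > 0"
        using C \<open>C \<noteq> {}\<close> in_closed_iff_infdist_zero [of C x] infdist_nonneg [of x C] by force
      have "\<forall>\<^sub>F n in sequentially. 0 = f n x"
      proof -
        obtain n0 :: nat where n0: "real n0 > 1 / infdist x C" using reals_Archimedean2 by blast
        have "0 = f n x" if "n \<ge> n0" for n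
        proof -
          have "real n > 1 / infdist x C" using n0 that by (meson less_le_trans of_nat_mono)
          then have "real n * infdist x C > 1" using pos by (simp add: divide_less_eq)
          then show ?thesis by (simp add: f_def)
        qed
        then show ?thesis by (auto simp: eventually_sequentially)
      qed
      then show ?thesis using False by (auto intro: Lim_transform_eventually)
    qed
    have conv: "(\<lambda>n. LINT x|M. f n x) \<longlonglongrightarrow> (LINT x|M. indicat_real C x)"
      if "sets M = sets borel" "prob_space M" for M
    proof (rule integral_dominated_convergence [where w = "\<lambda>_. 1"])
      interpret prob_space M by fact
      show "integrable M (\<lambda>_. 1 :: real)" by simp
      show "f n \<in> borel_measurable M" for n
        using borel_measurable_continuous_onI [OF fc] measurable_cong_sets [OF that(1) refl] by blast
      show "indicat_real C \<in> borel_measurable M"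
        using C that(1) borel_measurable_indicator [of C M] by simp
    qed (use lim f01 in auto)
    have "(LINT x|\<mu>. indicat_real C x) = (LINT x|\<nu>. indicat_real C x)"
    proof (rule LIMSEQ_unique)
      show "(\<lambda>n. LINT x|\<mu>. f n x) \<longlonglongrightarrow> (LINT x|\<mu>. indicat_real C x)"
        by (rule conv [OF s(1) \<mu>.prob_space_axioms])
      show "(\<lambda>n. LINT x|\<mu>. f n x) \<longlonglongrightarrow> (LINT x|\<nu>. indicat_real C x)"
        unfolding eq [OF fc f01] by (rule conv [OF s(2) \<nu>.prob_space_axioms])
    qed
    then have "measure \<mu> C = measure \<nu> C"
      using C s by simp
    then show ?thesis
      by (simp add: \<mu>.emeasure_eq_measure \<nu>.emeasure_eq_measure)
  qed simp
  show ?thesis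
  proof (rule measure_eqI_generator_eq [where E = "Collect closed" and \<Omega> = UNIV and A = "\<lambda>_. UNIV"])
    show "Int_stable (Collect (closed :: 'a set \<Rightarrow> bool))"
      by (auto intro: Int_stableI)
    show "sets \<mu> = sigma_sets UNIV (Collect closed)" "sets \<nu> = sigma_sets UNIV (Collect closed)"
      using s by (simp_all add: borel_eq_closed)
    show "emeasure \<mu> UNIV \<noteq> \<infinity>" by simp
  qed (use closed_eq in auto)
qed

context gaussian_rkhs
begin

text \<open>The scalings of both measures agree, as they are the reciprocals of the two embeddings.
  Expanding the square in the Gaussian kernel, the weighted measures have the same
  exponential moments.\<close>

lemma B_map_inj:
  assumes \<mu>: "borel_prob \<mu>" "bounded_support \<mu>" and \<nu>: "borel_prob \<nu>" "bounded_support \<nu>"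
    and eq: "B_map \<epsilon> evl \<mu> = B_map \<epsilon> evl \<nu>"
  shows "\<mu> = \<nu>"
proof -
  interpret \<mu>: bounded_prob \<epsilon> evl \<mu> using \<mu> by unfold_locales
  interpret \<nu>: bounded_prob \<epsilon> evl \<nu> using \<nu> by unfold_locales
  have a: "\<nu>.a = \<mu>.a"
    using \<mu>.evl_B \<nu>.evl_B eq by (metis (no_types) ext inverse_eq_divide inverse_inverse_eq)
  \<comment> \<open>The part of \<open>a x * k_c \<epsilon> x y\<close> that depends on
    \<open>x\<close> alone; up to a factor depending on \<open>y\<close>, only the exponential of
    the mixed term remains.\<close>
  define W where "W x = \<mu>.a x * exp (- (norm x)\<^sup>2 / \<epsilon>)" for x
  have Wpos: "W x > 0" for x using \<mu>.a_pos by (simp add: W_def)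
  have Wc: "continuous_on UNIV W"
    unfolding W_def [abs_def] using eps_pos by (intro continuous_intros \<mu>.continuous_a) auto
  have mom: "(LINT x|\<mu>. W x * exp (inner z x)) = (LINT x|\<nu>. W x * exp (inner z x))" for z
  proof -
    \<comment> \<open>With this base point the mixed term \<open>2 * inner x y / \<epsilon>\<close>
      of the Gaussian equals \<open>inner z x\<close>.\<close>
    define y where "y = (\<epsilon> / 2) *\<^sub>R z"
    have "W x * exp (inner z x) = exp ((norm y)\<^sup>2 / \<epsilon>) * (\<mu>.a x * k_c \<epsilon> x y)" for x
    proof -
      have "(norm (x - y))\<^sup>2 = (norm x)\<^sup>2 + (norm y)\<^sup>2 - 2 * inner x y"
        unfolding power2_norm_eq_inner by (simp add: inner_diff_left inner_diff_right inner_commute)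
      moreover have "2 * inner x y = \<epsilon> * inner z x"
        by (simp add: y_def inner_commute)
      ultimately have "- (norm x)\<^sup>2 / \<epsilon> + inner z x = (norm y)\<^sup>2 / \<epsilon> + - (norm (x - y))\<^sup>2 / \<epsilon>"
        using eps_pos by (simp add: field_simps)
      then have "exp (- (norm x)\<^sup>2 / \<epsilon>) * exp (inner z x) = exp ((norm y)\<^sup>2 / \<epsilon>) * k_c \<epsilon> x y"
        unfolding kc_eq by (simp only: exp_add [symmetric])
      then show ?thesis by (simp add: W_def ac_simps)
    qed
    then show ?thesis
      using \<mu>.a_eq [of y] \<nu>.a_eq [of y] by (simp add: a)
  qed
  have W_exp: "(LINT x|\<mu>. W x * g x) = (LINT x|\<nu>. W x * g x) \<and> continuous_on UNIV g"
    if "exp_combination g" for g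
    using that
  proof induction
    case (1 c z)
    have eq: "W x * (c * exp (inner z x)) = c * (W x * exp (inner z x))" for x by simp
    show ?case
      unfolding eq by (auto simp: mom intro!: continuous_intros)
  next
    case (2 f g)
    then show ?case
      using \<mu>.integrable_cont [of "\<lambda>x. W x * f x"] \<mu>.integrable_cont [of "\<lambda>x. W x * g x"]
        \<nu>.integrable_cont [of "\<lambda>x. W x * f x"] \<nu>.integrable_cont [of "\<lambda>x. W x * g x"] Wc
      by (simp add: distrib_left continuous_on_mult continuous_on_add)
  qed
  obtain S S' where S: "bounded S" "AE x in \<mu>. x \<in> S" and S': "bounded S'" "AE x in \<nu>. x \<in> S'"
    using \<mu>(2) \<nu>(2) by (auto simp: bounded_support_def)
  define K where "K = closure (S \<union> S')"
  have K: "compact K" "AE x in \<mu>. x \<in> K" "AE x in \<nu>. x \<in> K"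
  proof -
    show "compact K" using S S' by (auto simp: K_def compact_closure intro!: compact_Un)
    have "S \<subseteq> K" "S' \<subseteq> K" using closure_subset [of "S \<union> S'"] by (auto simp: K_def)
    then show "AE x in \<mu>. x \<in> K" "AE x in \<nu>. x \<in> K"
      using S(2) S'(2) by (auto elim!: eventually_mono)
  qed
  have close: "\<bar>(LINT x|M. W x * f x) - (LINT x|M. W x * g x)\<bar> \<le> e * (LINT x|M. W x)"
    if M: "bounded_prob \<epsilon> evl M" "AE x in M. x \<in> K" and f: "continuous_on UNIV f"
      and g: "continuous_on UNIV g" "\<And>x. x \<in> K \<Longrightarrow> \<bar>f x - g x\<bar> < e" for M f g e
  proof -
    interpret M: bounded_prob \<epsilon> evl M by fact
    have i: "integrable M (\<lambda>x. W x * f x)" "integrable M (\<lambda>x. W x * g x)" "integrable M W"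
      by (intro M.integrable_cont continuous_intros Wc f g)+
    have "(LINT x|M. W x * f x) - (LINT x|M. W x * g x) = (LINT x|M. W x * f x - W x * g x)"
      using i by simp
    also have "\<bar>\<dots>\<bar> \<le> (LINT x|M. \<bar>W x * f x - W x * g x\<bar>)"
      by (rule integral_abs_bound)
    also have "\<dots> \<le> (LINT x|M. e * W x)"
    proof (rule integral_mono_AE)
      show "AE x in M. \<bar>W x * f x - W x * g x\<bar> \<le> e * W x"
        using M(2)
      proof eventually_elim
        case (elim x)
        have "\<bar>W x * f x - W x * g x\<bar> = W x * \<bar>f x - g x\<bar>"
          using Wpos [of x] by (simp add: abs_mult flip: right_diff_distrib)
        also have "\<dots> \<le> W x * e"
          using g(2) [OF elim] Wpos [of x] by (intro mult_left_mono) auto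
        finally show ?case by (simp add: mult.commute)
      qed
    qed (use i in auto)
    finally show ?thesis using i by simp
  qed
  have W_eq: "(LINT x|\<mu>. W x * f x) = (LINT x|\<nu>. W x * f x)" if f: "continuous_on UNIV f" for f
  proof -
    \<comment> \<open>The approximation errors are \<open>e / c\<close> times the two masses of
      \<open>W\<close>; their sum stays below \<open>e\<close>, and the summand 1 keeps
      \<open>c\<close> positive.\<close>
    define c where "c = 1 + (LINT x|\<mu>. W x) + (LINT x|\<nu>. W x)"
    have W0: "(LINT x|\<mu>. W x) \<ge> 0" "(LINT x|\<nu>. W x) \<ge> 0"
      by (intro integral_nonneg_AE AE_I2 less_imp_le [OF Wpos])+
    have "\<bar>(LINT x|\<mu>. W x * f x) - (LINT x|\<nu>. W x * f x)\<bar> \<le> 0 + e" if e: "e > 0" for e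
    proof -
      have ec: "e / c > 0" using e W0 by (simp add: c_def)
      obtain g where g: "exp_combination g" "\<And>x. x \<in> K \<Longrightarrow> \<bar>f x - g x\<bar> < e / c"
        using exp_combination_dense [OF K(1) continuous_on_subset [OF f] ec] by (metis subset_UNIV)
      have "\<bar>(LINT x|\<mu>. W x * f x) - (LINT x|\<mu>. W x * g x)\<bar> \<le> e / c * (LINT x|\<mu>. W x)"
        using g W_exp by (intro close [OF \<mu>.bounded_prob_axioms K(2) f]) auto
      moreover have "\<bar>(LINT x|\<nu>. W x * f x) - (LINT x|\<nu>. W x * g x)\<bar> \<le> e / c * (LINT x|\<nu>. W x)"
        using g W_exp by (intro close [OF \<nu>.bounded_prob_axioms K(3) f]) auto
      moreover have "(LINT x|\<mu>. W x * g x) = (LINT x|\<nu>. W x * g x)"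
        using W_exp [OF g(1)] by blast
      ultimately have "\<bar>(LINT x|\<mu>. W x * f x) - (LINT x|\<nu>. W x * f x)\<bar> \<le>
          e / c * (LINT x|\<mu>. W x) + e / c * (LINT x|\<nu>. W x)"
        by linarith
      also have "\<dots> = e / c * (c - 1)" by (simp add: c_def distrib_left)
      also have "\<dots> \<le> e / c * c" using ec by (intro mult_left_mono) auto
      also have "\<dots> = e" using W0 by (simp add: c_def)
      finally show ?thesis by simp
    qed
    then have "\<bar>(LINT x|\<mu>. W x * f x) - (LINT x|\<nu>. W x * f x)\<bar> \<le> 0"
      by (rule field_le_epsilon)
    then show ?thesis by simp
  qed
  show ?thesis
  proof (rule prob_eqI_continuous [OF \<mu>(1) \<nu>(1)])
    fix f :: "'a \<Rightarrow> real" assume f: "continuous_on UNIV f"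
    \<comment> \<open>The weight is positive and continuous, so it can be divided out of the test
      function.\<close>
    have "continuous_on UNIV (\<lambda>x. f x / W x)"
      using Wpos by (intro continuous_intros f Wc) (metis less_irrefl)
    from W_eq [OF this] show "(LINT x|\<mu>. f x) = (LINT x|\<nu>. f x)"
      using Wpos by (simp add: less_imp_neq [symmetric])
  qed
qed

end

section \<open>Moving along a path\<close>

context bounded_prob
begin

lemma norm_integral_le:
  fixes V :: "'a \<Rightarrow> 'h"
  assumes V: "continuous_on UNIV V" and le: "AE x in \<mu>. norm (V x) \<le> C"
  shows "norm (LINT x|\<mu>. V x) \<le> C"
proof -
  have "norm (LINT x|\<mu>. V x) \<le> (LINT x|\<mu>. norm (V x))"
    by (rule integral_norm_bound)
  also have "\<dots> \<le> (LINT x|\<mu>. C)"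
    using le by (intro integral_mono_AE integrable_cont continuous_on_norm V) auto
  finally show ?thesis by (simp add: prob_space)
qed

text \<open>In the integral for \<open>inner g (M w)\<close> the linear factor may be attached to
  \<open>g\<close> instead of to the density; this trades \<open>M w\<close> for
  \<open>B\<close>.\<close>

lemma inner_M_eq_inner_B:
  assumes "\<And>y. evl h y = inner w y * evl g y"
  shows "inner g (M w) = inner h B"
  by (simp add: inner_M inner_B assms mult.assoc)

text \<open>Multiplying by \<open>inner w\<close> turns each \<open>kx x\<close> in the embedding
  into \<open>nx w x\<close>, so the product stays in the space. Its norm bound uses only constants
  that can be chosen common to all times of a path, as the continuity of \<open>Mt\<close>
  requires.\<close>

lemma linear_times_M_exists:
  assumes S: "AE x in \<mu>. x \<in> S" and A: "\<And>x. x \<in> S \<Longrightarrow> a x \<le> A" and L: "\<And>x. x \<in> S \<Longrightarrow> \<bar>inner w x\<bar> \<le> L"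
    and n: "\<And>x. x \<in> S \<Longrightarrow> norm (nx w x) \<le> n"
  obtains h where "\<And>y. evl h y = inner w y * evl (M w) y" "norm h \<le> A * L * n"
proof
  let ?h = "LINT x|\<mu>. (a x * inner w x) *\<^sub>R nx w x"
  have c: "continuous_on UNIV (\<lambda>x. (a x * inner w x) *\<^sub>R nx w x)"
    by (intro continuous_intros continuous_a continuous_nx)
  show "evl ?h y = inner w y * evl (M w) y" for y
  proof -
    have "evl ?h y = (LINT x|\<mu>. inner ((a x * inner w x) *\<^sub>R nx w x) (kx y))"
      using inner_integral [OF c] by (simp add: evl_eq_inner [of ?h])
    also have "\<dots> = (LINT x|\<mu>. inner w y * (a x * inner w x * k_c \<epsilon> x y))"
    proof (rule Bochner_Integration.integral_cong [OF refl])
      fix x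
      have "inner ((a x * inner w x) *\<^sub>R nx w x) (kx y) = a x * inner w x * evl (nx w x) y"
        by (simp add: evl_eq_inner [of "nx w x"])
      then show "inner ((a x * inner w x) *\<^sub>R nx w x) (kx y) = inner w y * (a x * inner w x * k_c \<epsilon> x y)"
        by (simp add: evl_nx)
    qed
    finally show ?thesis by (simp add: M_def evl_emb continuous_M_integrand)
  qed
  show "norm ?h \<le> A * L * n"
  proof (rule norm_integral_le [OF c])
    show "AE x in \<mu>. norm ((a x * inner w x) *\<^sub>R nx w x) \<le> A * L * n"
      using S
    proof eventually_elim
      case (elim x)
      have "norm ((a x * inner w x) *\<^sub>R nx w x) = a x * \<bar>inner w x\<bar> * norm (nx w x)"
        using a_pos [of x] by (simp add: abs_mult)
      also have "\<dots> \<le> A * L * n"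
        using A [OF elim] L [OF elim] n [OF elim] a_pos [of x]
        by (intro mult_mono) (auto intro: less_imp_le order_trans [of 0 "a x"] order_trans [of 0 "\<bar>inner w x\<bar>"] mult_nonneg_nonneg)
      finally show ?case .
    qed
  qed
qed

text \<open>The remainder estimate for a single kernel function, integrated with weight
  \<open>a\<close>; it is uniform over all measures on \<open>S\<close> with the same bound
  \<open>A\<close>.\<close>

lemma \<Gamma>_difference_quotient:
  assumes S: "AE x in \<mu>. x \<in> S" and A: "\<And>x. x \<in> S \<Longrightarrow> a x \<le> A"
  shows "norm (shift (s *\<^sub>R w) B - B - s *\<^sub>R \<Gamma> w) \<le> A * (2 * ((norm w)\<^sup>2 / \<epsilon>) * s\<^sup>2)"
proof -
  have c1: "continuous_on UNIV (\<lambda>x. a x *\<^sub>R kx (x + s *\<^sub>R w))"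
    by (intro continuous_intros continuous_a continuous_on_compose2 [OF continuous_kx]) auto
  have c2: "continuous_on UNIV (\<lambda>x. a x *\<^sub>R kx x)"
    by (intro continuous_intros continuous_a continuous_kx)
  have c3: "continuous_on UNIV (\<lambda>x. s *\<^sub>R (a x *\<^sub>R dk w x))"
    by (intro continuous_intros continuous_a continuous_dk)
  have "shift (s *\<^sub>R w) B = (LINT x|\<mu>. shift (s *\<^sub>R w) (a x *\<^sub>R kx x))"
    unfolding B_eq_emb emb_def
    by (rule integral_bounded_linear [OF bounded_linear_shift integrable_cont [OF c2], symmetric])
  also have "\<dots> = (LINT x|\<mu>. a x *\<^sub>R kx (x + s *\<^sub>R w))"
    by (simp add: shift_scaleR shift_kx)
  finally have "shift (s *\<^sub>R w) B - B - s *\<^sub>R \<Gamma> w =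
      (LINT x|\<mu>. a x *\<^sub>R kx (x + s *\<^sub>R w)) - (LINT x|\<mu>. a x *\<^sub>R kx x) - (LINT x|\<mu>. s *\<^sub>R (a x *\<^sub>R dk w x))"
    by (simp only: B_eq_emb emb_def \<Gamma>_def integral_scaleR_right)
  also have "\<dots> = (LINT x|\<mu>. a x *\<^sub>R kx (x + s *\<^sub>R w) - a x *\<^sub>R kx x - s *\<^sub>R (a x *\<^sub>R dk w x))"
    by (simp only: Bochner_Integration.integral_diff integrable_cont [OF c1] integrable_cont [OF c2] integrable_cont [OF c3]
        Bochner_Integration.integrable_diff)
  also have "norm \<dots> \<le> A * (2 * ((norm w)\<^sup>2 / \<epsilon>) * s\<^sup>2)"
  proof (rule norm_integral_le)
    show "continuous_on UNIV (\<lambda>x. a x *\<^sub>R kx (x + s *\<^sub>R w) - a x *\<^sub>R kx x - s *\<^sub>R (a x *\<^sub>R dk w x))"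
      by (intro continuous_on_diff c1 c2 c3)
    show "AE x in \<mu>. norm (a x *\<^sub>R kx (x + s *\<^sub>R w) - a x *\<^sub>R kx x - s *\<^sub>R (a x *\<^sub>R dk w x)) \<le> A * (2 * ((norm w)\<^sup>2 / \<epsilon>) * s\<^sup>2)"
      using S
    proof eventually_elim
      case (elim x)
      have "a x *\<^sub>R kx (x + s *\<^sub>R w) - a x *\<^sub>R kx x - s *\<^sub>R (a x *\<^sub>R dk w x) =
          a x *\<^sub>R (kx (x + s *\<^sub>R w) - kx x - s *\<^sub>R dk w x)"
        by (simp add: scaleR_right_diff_distrib mult.commute)
      also have "norm \<dots> = a x * norm (kx (x + s *\<^sub>R w) - kx x - s *\<^sub>R dk w x)"
        using a_pos [of x] by simp
      also have "\<dots> \<le> A * (2 * ((norm w)\<^sup>2 / \<epsilon>) * s\<^sup>2)"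
        using A [OF elim] a_pos [of x] kx_remainder [of x s w] by (intro mult_mono) auto
      finally show ?case .
    qed
  qed
  finally show ?thesis .
qed

end

text \<open>An interpolation estimate with a free parameter \<open>r\<close>. Choosing
  \<open>r\<close> proportional to the tolerance makes the first term small, and continuity of
  \<open>\<beta>\<close> then takes care of the second despite the factor
  \<open>2 / r\<close>.\<close>

lemma continuous_on_modulus:
  fixes G :: "real \<Rightarrow> 'h::real_normed_vector" and \<beta> :: "real \<Rightarrow> 'k::real_normed_vector"
  assumes \<beta>: "continuous_on X \<beta>" and C: "C > 0"
    and le: "\<And>s t r. s \<in> X \<Longrightarrow> t \<in> X \<Longrightarrow> r > 0 \<Longrightarrow> norm (G t - G s) \<le> C * r + 2 / r * norm (\<beta> t - \<beta> s)"
  shows "continuous_on X G"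
  unfolding continuous_on_iff
proof (intro ballI allI impI)
  fix s and e :: real assume s: "s \<in> X" and e: "e > 0"
  define r where "r = e / (4 * C)"
  have r: "r > 0" "C * r = e / 4" using e C by (auto simp: r_def)
  have "e * r / 4 > 0" using e r by simp
  then obtain d where d: "d > 0" "\<And>t. t \<in> X \<Longrightarrow> dist t s < d \<Longrightarrow> dist (\<beta> t) (\<beta> s) < e * r / 4"
    using \<beta> s unfolding continuous_on_iff by metis
  have "dist (G t) (G s) < e" if t: "t \<in> X" "dist t s < d" for t
  proof -
    have "2 / r * norm (\<beta> t - \<beta> s) \<le> 2 / r * (e * r / 4)"
      using d(2) [OF t] r by (intro mult_left_mono) (auto simp: dist_norm)
    also have "\<dots> = e / 2" using r by simp
    finally show ?thesis
      using le [OF s t(1) r(1)] r(2) e by (simp add: dist_norm)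
  qed
  then show "\<exists>d>0. \<forall>t\<in>X. dist t s < d \<longrightarrow> dist (G t) (G s) < e"
    using d(1) by blast
qed

lemma ac_path_cong: "ac_path \<beta> v \<Longrightarrow> (\<And>t. t \<in> {0..1} \<Longrightarrow> \<beta>' t = \<beta> t) \<Longrightarrow> ac_path \<beta>' v"
  by (auto simp: ac_path_def)

section \<open>Vector fields along an admissible path and the derivative of the mean\<close>

locale admissible_path = gaussian_rkhs \<epsilon> evl
  for \<epsilon> :: real
    and evl :: "'h::{real_inner,banach,second_countable_topology} \<Rightarrow> 'a::euclidean_space \<Rightarrow> real" +
  fixes \<mu> :: "real \<Rightarrow> 'a measure"
  assumes admissible: "admissible \<epsilon> evl \<mu>"
begin

definition \<beta> :: "real \<Rightarrow> 'h" where "\<beta> t = B_map \<epsilon> evl (\<mu> t)"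
definition v :: "real \<Rightarrow> 'h" where "v = weak_deriv \<beta>"
definition Mt :: "'a \<Rightarrow> real \<Rightarrow> 'h" where "Mt w t = bounded_prob.M \<epsilon> evl (\<mu> t) w"
definition Nt :: "'a \<Rightarrow> real \<Rightarrow> 'h" where "Nt w t = bounded_prob.N \<epsilon> evl (\<mu> t) w"
definition \<Gamma>t :: "'a \<Rightarrow> real \<Rightarrow> 'h" where "\<Gamma>t w t = bounded_prob.\<Gamma> \<epsilon> evl (\<mu> t) w"

lemma H1: "H1_path \<beta>"
  using admissible by (simp add: admissible_def \<beta>_def [abs_def])

lemmas ac = H1_path_ac(1) [OF H1, folded v_def]
  and L2 = H1_path_ac(2) [OF H1, folded v_def]
  and continuous_\<beta> = H1_path_ac(3) [OF H1]

lemma bounded_prob_at: "t \<in> {0..1} \<Longrightarrow> bounded_prob \<epsilon> evl (\<mu> t)"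
  using admissible by unfold_locales (auto simp: admissible_def bounded_support_def)

lemma uniform_bounds:
  obtains S A R where "bounded S" "A > 0" "R > 0" "\<And>x. x \<in> S \<Longrightarrow> norm x \<le> R"
    "\<And>t. t \<in> {0..1} \<Longrightarrow> AE x in \<mu> t. x \<in> S"
    "\<And>t x. t \<in> {0..1} \<Longrightarrow> x \<in> S \<Longrightarrow> a_fun \<epsilon> (\<mu> t) x \<le> A"
proof -
  obtain S where S: "bounded S" "\<And>t. t \<in> {0..1} \<Longrightarrow> AE x in \<mu> t. x \<in> S"
    using admissible by (auto simp: admissible_def)
  interpret b0: bounded_prob \<epsilon> evl "\<mu> 0" by (rule bounded_prob_at) simp
  obtain \<delta> where \<delta>: "0 < \<delta>" "\<delta> \<le> 1" "\<And>x y. x \<in> S \<Longrightarrow> y \<in> S \<Longrightarrow> \<delta> \<le> k_c \<epsilon> x y"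
    using b0.kernel_lower_bound [OF S(1)] by blast
  obtain R where R: "R > 0" "\<And>x. x \<in> S \<Longrightarrow> norm x \<le> R"
    using S(1) by (meson bounded_pos)
  have "a_fun \<epsilon> (\<mu> t) x \<le> 1 / \<delta>" if "t \<in> {0..1}" "x \<in> S" for t x
    using bounded_prob.a_le [OF bounded_prob_at [OF that(1)] S(2) [OF that(1)] that(2) \<delta>(1,3)] .
  then show ?thesis
    using that [OF S(1), of "1 / \<delta>" R] \<delta>(1) R S(2) by simp
qed

text \<open>Pair the difference \<open>d\<close> of two values of \<open>Mt w\<close> with itself
  and move the linear factor onto \<open>d\<close>: the result is
  \<open>inner (Rt t - Rt s) (\<beta> t - \<beta> s)\<close>, where \<open>Rt\<close> is the linear
  function times \<open>Mt w\<close>. As \<open>Rt\<close> is bounded, the squared norm of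
  \<open>d\<close> is controlled by the increment of \<open>\<beta>\<close>.\<close>

lemma continuous_Mt: "continuous_on {0..1} (Mt w)"
proof -
  obtain S A R where b: "bounded S" "A > 0" "R > 0" "\<And>x. x \<in> S \<Longrightarrow> norm x \<le> R"
    "\<And>t. t \<in> {0..1} \<Longrightarrow> AE x in \<mu> t. x \<in> S"
    "\<And>t x. t \<in> {0..1} \<Longrightarrow> x \<in> S \<Longrightarrow> a_fun \<epsilon> (\<mu> t) x \<le> A"
    using uniform_bounds by blast
  define L where "L = norm w * R"
  have L: "\<bar>inner w x\<bar> \<le> L" if "x \<in> S" for x
    using Cauchy_Schwarz_ineq2 [of w x] mult_left_mono [OF b(4) [OF that] norm_ge_zero [of w]]
    by (simp add: L_def)
  have "compact (nx w ` closure S)"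
    using b(1) by (intro compact_continuous_image continuous_on_subset [OF continuous_nx]) (auto simp: compact_closure)
  then obtain n where n': "\<And>x. x \<in> closure S \<Longrightarrow> norm (nx w x) \<le> n"
    by (meson bounded_iff compact_imp_bounded imageI)
  have n: "norm (nx w x) \<le> \<bar>n\<bar>" if "x \<in> S" for x
    using n' [of x] that closure_subset [of S] by force
  define C where "C = 1 + 2 * (A * L * \<bar>n\<bar>)"
  have "A * L * \<bar>n\<bar> \<ge> 0" using b by (simp add: L_def)
  then have C: "C > 0" by (simp add: C_def)
  have "\<exists>h. (\<forall>y. evl h y = inner w y * evl (Mt w t) y) \<and> norm h \<le> A * L * \<bar>n\<bar>" if "t \<in> {0..1}" for t
    unfolding Mt_def
    by (rule bounded_prob.linear_times_M_exists [OF bounded_prob_at [OF that] b(5) [OF that] b(6) [OF that] L n]) auto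
  then obtain Rt where Rt: "\<And>t y. t \<in> {0..1} \<Longrightarrow> evl (Rt t) y = inner w y * evl (Mt w t) y"
    "\<And>t. t \<in> {0..1} \<Longrightarrow> norm (Rt t) \<le> A * L * \<bar>n\<bar>"
    by metis
  have sq: "(norm (Mt w t - Mt w s))\<^sup>2 \<le> C * norm (\<beta> t - \<beta> s)" if s: "s \<in> {0..1}" and t: "t \<in> {0..1}" for s t
  proof -
    interpret s: bounded_prob \<epsilon> evl "\<mu> s" by (rule bounded_prob_at [OF s])
    interpret t: bounded_prob \<epsilon> evl "\<mu> t" by (rule bounded_prob_at [OF t])
    let ?d = "Mt w t - Mt w s"
    have h: "evl (Rt t - Rt s) y = inner w y * evl ?d y" for y
      using s t by (simp add: evl_diff Rt right_diff_distrib)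
    have "(norm ?d)\<^sup>2 = inner ?d (Mt w t) - inner ?d (Mt w s)"
      unfolding power2_norm_eq_inner by (rule inner_diff_right)
    also have "\<dots> = inner (Rt t - Rt s) (\<beta> t) - inner (Rt t - Rt s) (\<beta> s)"
      using t.inner_M_eq_inner_B [OF h] s.inner_M_eq_inner_B [OF h] by (simp add: Mt_def \<beta>_def)
    also have "\<dots> = inner (Rt t - Rt s) (\<beta> t - \<beta> s)" by (simp add: inner_diff_right)
    also have "\<dots> \<le> norm (Rt t - Rt s) * norm (\<beta> t - \<beta> s)" by (rule norm_cauchy_schwarz)
    also have "\<dots> \<le> C * norm (\<beta> t - \<beta> s)"
      using norm_triangle_ineq4 [of "Rt t" "Rt s"] Rt(2) [OF s] Rt(2) [OF t]
      by (intro mult_right_mono) (auto simp: C_def)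
    finally show ?thesis .
  qed
  show ?thesis
  proof (rule continuous_on_modulus [OF continuous_\<beta> C])
    fix s t r :: real assume st: "s \<in> {0..1}" "t \<in> {0..1}" and r: "r > 0"
    let ?x = "norm (Mt w t - Mt w s)" and ?b = "norm (\<beta> t - \<beta> s)"
    show "?x \<le> C * r + 2 / r * ?b"
    \<comment> \<open>If the difference exceeds \<open>C * r\<close>, dividing the quadratic bound
      by it leaves an estimate linear in the increment of \<open>\<beta>\<close>.\<close>
    proof (cases "?x \<le> C * r")
      case True
      moreover have "2 / r * ?b \<ge> 0" using r by simp
      ultimately show ?thesis by linarith
    next
      case False
      then have "(C * r) * ?x \<le> ?x * ?x" by (intro mult_right_mono) auto
      also have "\<dots> \<le> C * ?b" using sq [OF st] by (simp add: power2_eq_square)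
      finally have "C * (r * ?x) \<le> C * ?b" by (simp add: mult.assoc)
      then have "r * ?x \<le> ?b" using C by simp
      then have "?x \<le> ?b / r" using r by (simp add: pos_le_divide_eq mult.commute)
      also have "\<dots> \<le> 2 / r * ?b" using r by (simp add: divide_right_mono)
      finally show ?thesis using C r by (simp add: add_increasing)
    qed
  qed
qed

text \<open>\<open>\<Gamma>t\<close> is compared with the difference quotient of the shift at step
  \<open>r\<close>. Since shifts are isometries, the quotient changes in time by at most
  \<open>2 / r\<close> times the increment of \<open>\<beta>\<close>, while the two Taylor errors
  together cost \<open>2 * K * r\<close>.\<close>

lemma continuous_\<Gamma>t: "continuous_on {0..1} (\<Gamma>t w)"
proof -
  obtain S A R where b: "bounded S" "A > 0" "R > 0" "\<And>x. x \<in> S \<Longrightarrow> norm x \<le> R"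
    "\<And>t. t \<in> {0..1} \<Longrightarrow> AE x in \<mu> t. x \<in> S"
    "\<And>t x. t \<in> {0..1} \<Longrightarrow> x \<in> S \<Longrightarrow> a_fun \<epsilon> (\<mu> t) x \<le> A"
    using uniform_bounds by blast
  define K where "K = A * (2 * ((norm w)\<^sup>2 / \<epsilon>))"
  have K: "K \<ge> 0" using b eps_pos by (simp add: K_def)
  have q: "norm (shift (r *\<^sub>R w) (\<beta> t) - \<beta> t - r *\<^sub>R \<Gamma>t w t) \<le> K * r\<^sup>2" if "t \<in> {0..1}" for t r
    using bounded_prob.\<Gamma>_difference_quotient [OF bounded_prob_at [OF that] b(5) [OF that] b(6) [OF that], of r w]
    by (simp add: \<beta>_def \<Gamma>t_def K_def mult.assoc)
  show ?thesis
  proof (rule continuous_on_modulus [OF continuous_\<beta>])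
    show "2 * K + 1 > 0" using K by simp
    fix s t r :: real assume st: "s \<in> {0..1}" "t \<in> {0..1}" and r: "r > 0"
    let ?Q = "\<lambda>t. shift (r *\<^sub>R w) (\<beta> t) - \<beta> t - r *\<^sub>R \<Gamma>t w t" and ?b = "norm (\<beta> t - \<beta> s)"
    have "r *\<^sub>R (\<Gamma>t w t - \<Gamma>t w s) = (shift (r *\<^sub>R w) (\<beta> t - \<beta> s) - (\<beta> t - \<beta> s)) - (?Q t - ?Q s)"
      by (simp add: shift_diff scaleR_right_diff_distrib)
    then have "r * norm (\<Gamma>t w t - \<Gamma>t w s) = norm ((shift (r *\<^sub>R w) (\<beta> t - \<beta> s) - (\<beta> t - \<beta> s)) - (?Q t - ?Q s))"
      using r by (metis norm_scaleR abs_of_pos)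
    also have "\<dots> \<le> norm (shift (r *\<^sub>R w) (\<beta> t - \<beta> s) - (\<beta> t - \<beta> s)) + norm (?Q t - ?Q s)"
      by (rule norm_triangle_ineq4)
    also have "\<dots> \<le> (norm (shift (r *\<^sub>R w) (\<beta> t - \<beta> s)) + ?b) + (norm (?Q t) + norm (?Q s))"
      by (intro add_mono norm_triangle_ineq4)
    also have "\<dots> \<le> (?b + ?b) + (K * r\<^sup>2 + K * r\<^sup>2)"
      using q st by (intro add_mono) auto
    finally have "r * norm (\<Gamma>t w t - \<Gamma>t w s) \<le> r * (2 * K * r + 2 / r * ?b)"
      using r by (simp add: power2_eq_square algebra_simps)
    then have "norm (\<Gamma>t w t - \<Gamma>t w s) \<le> 2 * K * r + 2 / r * ?b"
      using r by simp
    also have "\<dots> \<le> (2 * K + 1) * r + 2 / r * ?b"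
      using r by (simp add: distrib_right)
    finally show "norm (\<Gamma>t w t - \<Gamma>t w s) \<le> (2 * K + 1) * r + 2 / r * ?b" .
  qed
qed

lemma Nt_eq: "t \<in> {0..1} \<Longrightarrow> Nt w t = Mt w t + (\<epsilon> / 2) *\<^sub>R \<Gamma>t w t"
  unfolding Nt_def Mt_def \<Gamma>t_def by (rule bounded_prob.N_eq [OF bounded_prob_at])

lemma continuous_Nt: "continuous_on {0..1} (Nt w)"
proof -
  have "continuous_on {0..1} (\<lambda>t. Mt w t + (\<epsilon> / 2) *\<^sub>R \<Gamma>t w t)"
    by (intro continuous_intros continuous_Mt continuous_\<Gamma>t)
  then show ?thesis
    by (subst continuous_on_cong [OF refl Nt_eq]) auto
qed

text \<open>The mean is \<open>inner (Mt w t) (\<beta> t)\<close>, and on the diagonal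
  \<open>Mt\<close> may be replaced by \<open>Nt\<close>. Off the diagonal
  \<open>inner (Mt w t) (\<beta> s) = inner (Nt w s) (\<beta> t)\<close>, as both attach the linear
  function to the same integral. Expanding the product of \<open>Mt w t + Nt w s\<close> with the
  increment of \<open>\<beta>\<close> therefore leaves just the difference of the means.\<close>

lemma ac_path_mean: "ac_path (\<lambda>t. inner w (LINT x|\<mu> t. x)) (\<lambda>t. inner (Mt w t + Nt w t) (v t))"
proof (rule ac_path_chain [OF ac continuous_Mt continuous_Nt])
  fix s t :: real assume "0 \<le> s" "s \<le> t" "t \<le> 1"
  then interpret s: bounded_prob \<epsilon> evl "\<mu> s" + t: bounded_prob \<epsilon> evl "\<mu> t"
    by (auto intro: bounded_prob_at)
  have mean: "inner (Mt w s) (\<beta> s) = inner w (LINT x|\<mu> s. x)" "inner (Mt w t) (\<beta> t) = inner w (LINT x|\<mu> t. x)"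
    using s.inner_M_B t.inner_M_B by (simp_all add: Mt_def \<beta>_def)
  have "inner (\<beta> s) (Mt w t) = inner (Nt w s) (\<beta> t)" "inner (\<beta> s) (Mt w s) = inner (Nt w s) (\<beta> s)"
    using t.inner_M_eq_inner_B [OF s.evl_N] s.inner_M_eq_inner_B [OF s.evl_N]
    by (simp_all add: Mt_def Nt_def \<beta>_def)
  then show "inner w (LINT x|\<mu> t. x) - inner w (LINT x|\<mu> s. x) = inner (Mt w t + Nt w s) (\<beta> t - \<beta> s)"
    unfolding mean [symmetric]
    by (simp add: inner_add_left inner_diff_right inner_commute [of "\<beta> s"])
qed

lemma norm_\<beta>: "t \<in> {0..1} \<Longrightarrow> norm (\<beta> t) = 1"
  unfolding \<beta>_def by (rule bounded_prob.norm_B [OF bounded_prob_at])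

text \<open>The path stays on the unit sphere. The difference form of half its squared norm is
  constantly zero, and the density of a constant path is unique almost everywhere.\<close>

lemma v_orthogonal: "AE t in lborel. t \<in> {0<..<1} \<longrightarrow> inner (v t) (\<beta> t) = 0"
proof -
  have "ac_path (\<lambda>t. 0) (\<lambda>t. inner ((1/2) *\<^sub>R \<beta> t + (1/2) *\<^sub>R \<beta> t) (v t))"
  proof (rule ac_path_chain [OF ac])
    fix s t :: real assume "0 \<le> s" "s \<le> t" "t \<le> 1"
    then have "inner (\<beta> s) (\<beta> s) = 1" "inner (\<beta> t) (\<beta> t) = 1"
      using norm_\<beta> [of s] norm_\<beta> [of t] by (simp_all add: dot_square_norm)
    then show "0 - 0 = inner ((1/2) *\<^sub>R \<beta> t + (1/2) *\<^sub>R \<beta> s) (\<beta> t - \<beta> s)"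
      by (simp add: inner_add_left inner_diff_right inner_commute [of "\<beta> s" "\<beta> t"])
  qed (intro continuous_intros continuous_\<beta>)+
  moreover have "ac_path (\<lambda>t. 0 :: real) (\<lambda>t. 0)"
    by (auto simp: ac_path_def set_integrable_def)
  ultimately have "AE t in lborel. t \<in> {0<..<1} \<longrightarrow> inner ((1/2) *\<^sub>R \<beta> t + (1/2) *\<^sub>R \<beta> t) (v t) = 0"
    by (rule ac_path_derivative_unique)
  then show ?thesis
    by eventually_elim (simp add: inner_commute flip: scaleR_add_left)
qed

lemma energy_lower_bound:
  assumes st: "0 \<le> s" "s \<le> t" "t \<le> 1"
  shows "ennreal (\<epsilon> / 2 * (norm (\<beta> t - \<beta> s))\<^sup>2) \<le> energy \<epsilon> evl \<mu>"
proof -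
  let ?\<Delta> = "norm (\<beta> t - \<beta> s)"
  define E where "E = (LINT r:{0<..<1}|lborel. (norm (v r))\<^sup>2)"
  have i2: "set_integrable lborel {0<..<1} (\<lambda>r. (norm (v r))\<^sup>2)"
    using L2 by (simp add: L2_path_def)
  then have i2': "set_integrable lborel {0..1} (\<lambda>r. (norm (v r))\<^sup>2)"
    by (simp add: set_integrable_endpoints)
  note I2 = set_integrable_Ioc [OF i2' st(1,3)]
  have i1: "set_integrable lborel {s<..t} (\<lambda>r. norm (v r))"
    using set_integrable_norm [OF set_integrable_Ioc [OF ac_path_integrable [OF ac] st(1,3)]] .
  have ic: "set_integrable lborel {s<..t} (\<lambda>r. ?\<Delta>\<^sup>2)"
    unfolding set_integrable_def by (rule integrable_scaleR_left) (use st in auto)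
  have "2 * ?\<Delta> * ?\<Delta> \<le> 2 * ?\<Delta> * (LINT r:{s<..t}|lborel. norm (v r))"
    unfolding ac_pathD [OF ac st]
    using set_integral_norm_le [OF set_integrable_Ioc [OF ac_path_integrable [OF ac] st(1,3)] i1]
    by (intro mult_left_mono) auto
  also have "\<dots> = (LINT r:{s<..t}|lborel. 2 * ?\<Delta> * norm (v r))"
    by simp
  also have "\<dots> \<le> (LINT r:{s<..t}|lborel. ?\<Delta>\<^sup>2 + (norm (v r))\<^sup>2)"
  proof (rule set_integral_mono)
    show "2 * ?\<Delta> * norm (v r) \<le> ?\<Delta>\<^sup>2 + (norm (v r))\<^sup>2" for r
      using sum_squares_bound [of ?\<Delta> "norm (v r)"] by simp
    show "set_integrable lborel {s<..t} (\<lambda>r. 2 * ?\<Delta> * norm (v r))"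
      using i1 by simp
    show "set_integrable lborel {s<..t} (\<lambda>r. ?\<Delta>\<^sup>2 + (norm (v r))\<^sup>2)"
      by (rule set_integral_add(1) [OF ic I2])
  qed
  also have "\<dots> = (t - s) * ?\<Delta>\<^sup>2 + (LINT r:{s<..t}|lborel. (norm (v r))\<^sup>2)"
    unfolding set_integral_add(2) [OF ic I2] using st by (simp add: set_lebesgue_integral_def)
  also have "\<dots> \<le> 1 * ?\<Delta>\<^sup>2 + E"
  proof (intro add_mono mult_right_mono)
    have "(LINT r:{s<..t}|lborel. (norm (v r))\<^sup>2) \<le> (LINT r:{0<..1}|lborel. (norm (v r))\<^sup>2)"
      unfolding set_lebesgue_integral_def
    proof (rule integral_mono)
      show "integrable lborel (\<lambda>r. indicat_real {s<..t} r *\<^sub>R (norm (v r))\<^sup>2)"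
        "integrable lborel (\<lambda>r. indicat_real {0<..1} r *\<^sub>R (norm (v r))\<^sup>2)"
        using I2 set_integrable_Ioc [OF i2', of 0 1] by (simp_all add: set_integrable_def)
    qed (use st in \<open>auto split: split_indicator\<close>)
    then show "(LINT r:{s<..t}|lborel. (norm (v r))\<^sup>2) \<le> E"
      unfolding E_def set_integral_endpoints(2) .
  qed (use st in auto)
  finally have \<Delta>E: "?\<Delta>\<^sup>2 \<le> E" by (simp add: power2_eq_square)
  have "ennreal (\<epsilon> / 2 * E) = (\<integral>\<^sup>+r. ennreal (indicat_real {0<..<1} r *\<^sub>R (\<epsilon> / 2 * (norm (v r))\<^sup>2)) \<partial>lborel)"
  proof -
    have "set_integrable lborel {0<..<1} (\<lambda>r. \<epsilon> / 2 * (norm (v r))\<^sup>2)"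
      using i2 by simp
    then have "(\<integral>\<^sup>+r. ennreal (indicat_real {0<..<1} r *\<^sub>R (\<epsilon> / 2 * (norm (v r))\<^sup>2)) \<partial>lborel) =
        ennreal (LINT r:{0<..<1}|lborel. \<epsilon> / 2 * (norm (v r))\<^sup>2)"
      unfolding set_lebesgue_integral_def set_integrable_def
      using eps_pos by (intro nn_integral_eq_integral) auto
    then show ?thesis by (simp add: E_def)
  qed
  also have "\<dots> \<le> energy \<epsilon> evl \<mu>"
    unfolding energy_def
  proof (rule nn_integral_mono_AE)
    show "AE r in lborel. ennreal (indicat_real {0<..<1} r *\<^sub>R (\<epsilon> / 2 * (norm (v r))\<^sup>2)) \<le>
        ennreal (g_tilde \<epsilon> evl (\<mu> r) (weak_deriv (\<lambda>s. B_map \<epsilon> evl (\<mu> s)) r)) * indicator {0<..<1} r"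
      using v_orthogonal
    proof eventually_elim
      case (elim r)
      show ?case
      proof (cases "r \<in> {0<..<1}")
        case True
        then have "\<epsilon> / 2 * (norm (v r))\<^sup>2 \<le> g_tilde \<epsilon> evl (\<mu> r) (v r)"
          using bounded_prob.g_tilde_ge [OF bounded_prob_at, of r "v r"] elim by (simp add: \<beta>_def)
        then show ?thesis
          using True by (simp add: v_def \<beta>_def [abs_def] ennreal_leI)
      qed simp
    qed
  qed
  finally have "ennreal (\<epsilon> / 2 * E) \<le> energy \<epsilon> evl \<mu>" .
  moreover have "ennreal (\<epsilon> / 2 * ?\<Delta>\<^sup>2) \<le> ennreal (\<epsilon> / 2 * E)"
    using \<Delta>E eps_pos by (intro ennreal_leI mult_left_mono) auto
  ultimately show ?thesis by (rule order_trans [rotated])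
qed

end

section \<open>The energy of a path translated at constant velocity\<close>

locale translated_path = admissible_path \<epsilon> evl \<mu>
  for \<epsilon> :: real
    and evl :: "'h::{real_inner,banach,second_countable_topology} \<Rightarrow> 'a::euclidean_space \<Rightarrow> real"
    and \<mu> :: "real \<Rightarrow> 'a measure" +
  fixes \<nu> :: "real \<Rightarrow> 'a measure" and p w :: 'a
  assumes \<nu>: "\<And>t. t \<in> {0..1} \<Longrightarrow> \<nu> t = distr (\<mu> t) borel (\<lambda>x. x + (p + t *\<^sub>R w))"
begin

definition q :: "real \<Rightarrow> 'a" where "q t = p + t *\<^sub>R w"
definition \<beta>' :: "real \<Rightarrow> 'h" where "\<beta>' t = shift (q t) (\<beta> t)"
definition v' :: "real \<Rightarrow> 'h" where "v' t = shift (q t) (v t + \<Gamma>t w t)"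

lemma translated_prob_at: "t \<in> {0..1} \<Longrightarrow> translated_prob \<epsilon> evl (\<mu> t)"
  unfolding translated_prob_def by (rule bounded_prob_at)

lemma \<nu>_eq: "t \<in> {0..1} \<Longrightarrow> \<nu> t = translated_prob.\<nu> (\<mu> t) (q t)"
  by (simp add: \<nu> q_def translated_prob.\<nu>_def [OF translated_prob_at])

lemma B_\<nu>: "t \<in> {0..1} \<Longrightarrow> B_map \<epsilon> evl (\<nu> t) = \<beta>' t"
  by (simp add: \<nu>_eq translated_prob.B_translate [OF translated_prob_at] \<beta>'_def \<beta>_def)

lemma continuous_q: "continuous_on A q"
  unfolding q_def [abs_def] by (intro continuous_intros)

lemma continuous_\<beta>': "continuous_on {0..1} \<beta>'"
proof -
  have "continuous_on {0..1} (\<lambda>t. (\<lambda>(p, h). shift p h) (q t, \<beta> t))"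
    by (rule continuous_on_compose2 [OF continuous_shift]) (auto intro!: continuous_intros continuous_q continuous_\<beta>)
  then show ?thesis by (simp add: \<beta>'_def [abs_def])
qed

lemma L2_v': "L2_path v'"
proof -
  have \<Gamma>c: "continuous_on {0<..<1} (\<Gamma>t w)"
    by (rule continuous_on_subset [OF continuous_\<Gamma>t]) auto
  have m1: "(\<lambda>t. indicat_real {0<..<1} t *\<^sub>R v t) \<in> borel_measurable borel"
    using L2 by (simp add: L2_path_def set_borel_measurable_def)
  have m2: "(\<lambda>t. indicat_real {0<..<1} t *\<^sub>R \<Gamma>t w t) \<in> borel_measurable borel"
    using \<Gamma>c by (intro borel_measurable_continuous_on_indicator) auto
  have mq: "q \<in> borel_measurable borel"
    by (rule borel_measurable_continuous_onI [OF continuous_q])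
  \<comment> \<open>The indicator is placed inside the shift, which is linear, so that joint
    continuity of \<open>shift\<close> applies to two measurable maps.\<close>
  have "(\<lambda>t. shift (q t) (indicat_real {0<..<1} t *\<^sub>R v t + indicat_real {0<..<1} t *\<^sub>R \<Gamma>t w t)) \<in> borel_measurable borel"
    using continuous_shift
    by (intro borel_measurable_continuous_Pair [OF mq borel_measurable_add [OF m1 m2]]) (simp add: case_prod_unfold)
  also have "(\<lambda>t. shift (q t) (indicat_real {0<..<1} t *\<^sub>R v t + indicat_real {0<..<1} t *\<^sub>R \<Gamma>t w t)) =
      (\<lambda>t. indicat_real {0<..<1} t *\<^sub>R v' t)"
    by (simp add: v'_def fun_eq_iff shift_scaleR flip: scaleR_add_right)
  finally have m: "(\<lambda>t. indicat_real {0<..<1} t *\<^sub>R v' t) \<in> borel_measurable borel" .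
  have "set_integrable lborel {0<..<1} (\<lambda>t. (norm (v' t))\<^sup>2)"
    unfolding set_integrable_def
  proof (rule Bochner_Integration.integrable_bound)
    have "set_integrable lborel {0<..<1} (\<lambda>t. (norm (\<Gamma>t w t))\<^sup>2)"
      using continuous_imp_L2_path [OF continuous_\<Gamma>t] by (simp add: L2_path_def)
    then have "set_integrable lborel {0<..<1} (\<lambda>t. 2 * (norm (v t))\<^sup>2 + 2 * (norm (\<Gamma>t w t))\<^sup>2)"
      using L2 by (intro set_integral_add(1)) (simp_all add: L2_path_def)
    then show "integrable lborel (\<lambda>t. indicat_real {0<..<1} t *\<^sub>R (2 * (norm (v t))\<^sup>2 + 2 * (norm (\<Gamma>t w t))\<^sup>2))"
      by (simp only: set_integrable_def)
    have "(\<lambda>t. (norm (indicat_real {0<..<1} t *\<^sub>R v' t))\<^sup>2) \<in> borel_measurable borel"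
      by (rule measurable_compose [OF m]) (intro borel_measurable_continuous_onI continuous_intros)
    also have "(\<lambda>t. (norm (indicat_real {0<..<1} t *\<^sub>R v' t))\<^sup>2) = (\<lambda>t. indicat_real {0<..<1} t *\<^sub>R (norm (v' t))\<^sup>2)"
      by (auto simp: fun_eq_iff split: split_indicator)
    finally show "(\<lambda>t. indicat_real {0<..<1} t *\<^sub>R (norm (v' t))\<^sup>2) \<in> borel_measurable lborel"
      by simp
    have "(norm (v' t))\<^sup>2 \<le> 2 * (norm (v t))\<^sup>2 + 2 * (norm (\<Gamma>t w t))\<^sup>2" for t
    proof -
      have "(norm (v' t))\<^sup>2 \<le> (norm (v t) + norm (\<Gamma>t w t))\<^sup>2"
        unfolding v'_def norm_shift by (intro power_mono norm_triangle_ineq) auto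
      also have "\<dots> \<le> 2 * (norm (v t))\<^sup>2 + 2 * (norm (\<Gamma>t w t))\<^sup>2"
        using sum_squares_bound [of "norm (v t)" "norm (\<Gamma>t w t)"] by (simp add: power2_sum)
      finally show ?thesis .
    qed
    then show "AE t in lborel. norm (indicat_real {0<..<1} t *\<^sub>R (norm (v' t))\<^sup>2)
        \<le> norm (indicat_real {0<..<1} t *\<^sub>R (2 * (norm (v t))\<^sup>2 + 2 * (norm (\<Gamma>t w t))\<^sup>2))"
      by (auto split: split_indicator)
  qed
  then show ?thesis
    using m by (simp add: L2_path_def set_borel_measurable_def)
qed

text \<open>Evaluation at \<open>y\<close> turns \<open>\<beta>' t\<close> into
  \<open>inner (\<beta> t) (kx (y - q t))\<close>. The motion now sits in a continuously
  differentiable curve of kernel functions with velocity \<open>- w\<close>, so the bilinear Leibniz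
  rule applies. Evaluations separate points, which recovers the identity in the Hilbert
  space.\<close>

lemma ac_\<beta>': "ac_path \<beta>' v'"
  unfolding ac_path_def
proof (intro conjI allI impI)
  show iv': "set_integrable lborel {0..1} v'"
    by (rule L2_path_integrable [OF L2_v'])
  fix s t :: real assume st: "0 \<le> s" "s \<le> t" "t \<le> 1"
  show "\<beta>' t - \<beta>' s = (LINT r:{s<..t}|lborel. v' r)"
  proof (rule evl_ext)
    fix y
    define \<kappa> where "\<kappa> t = kx (y - q t)" for t
    define \<kappa>' where "\<kappa>' t = dk (- w) (y - q t)" for t
    have y: "(y - p) + t *\<^sub>R (- w) = y - q t" for t
      by (simp add: q_def)
    have \<kappa>'c: "continuous_on {0..1} \<kappa>'" and \<kappa>c: "continuous_on {0..1} \<kappa>"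
      unfolding \<kappa>'_def \<kappa>_def
      by (auto intro!: continuous_intros continuous_q continuous_on_compose2 [OF continuous_dk] continuous_on_compose2 [OF continuous_kx])
    have \<kappa>: "ac_path \<kappa> \<kappa>'"
      using \<kappa>'c unfolding \<kappa>_def \<kappa>'_def y [symmetric]
      by (intro ac_path_C1 has_vector_derivative_at_within [OF kx_has_vector_derivative])
    have "ac_path (\<lambda>t. inner (\<beta> t) (\<kappa> t)) (\<lambda>t. inner (v t) (\<kappa> t) + inner (\<beta> t) (\<kappa>' t))"
      by (rule ac_path_bilinear [OF bounded_bilinear_inner ac continuous_\<beta> \<kappa> \<kappa>c])
    note D = ac_pathD [OF this st]
    have ev: "inner (\<beta> r) (\<kappa> r) = evl (\<beta>' r) y" for r
      by (simp add: \<kappa>_def \<beta>'_def evl_shift flip: evl_eq_inner)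
    have dneg: "dk (- w) x = - dk w x" for x
      by (rule evl_ext) (simp add: evl_dk evl_minus)
    have ev': "inner (v r) (\<kappa> r) + inner (\<beta> r) (\<kappa>' r) = evl (v' r) y" if "r \<in> {s<..t}" for r
    proof -
      have "r \<in> {0..1}" using that st by auto
      then have "inner (\<beta> r) (dk w (y - q r)) = - evl (\<Gamma>t w r) (y - q r)"
        unfolding \<beta>_def \<Gamma>t_def by (rule bounded_prob.inner_B_dk [OF bounded_prob_at])
      then show ?thesis
        by (simp add: \<kappa>_def \<kappa>'_def v'_def evl_shift evl_add dneg flip: evl_eq_inner)
    qed
    have "evl (LINT r:{s<..t}|lborel. v' r) y = (LINT r:{s<..t}|lborel. inner (v' r) (kx y))"
      unfolding evl_eq_inner [of "LINT r:{s<..t}|lborel. v' r"]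
      by (rule set_integral_bounded_linear(2) [OF bounded_linear_inner_left set_integrable_Ioc [OF iv' st(1,3)], symmetric])
    also have "\<dots> = (LINT r:{s<..t}|lborel. inner (v r) (\<kappa> r) + inner (\<beta> r) (\<kappa>' r))"
      by (rule set_lebesgue_integral_cong) (auto simp: ev' simp flip: evl_eq_inner)
    also have "\<dots> = evl (\<beta>' t) y - evl (\<beta>' s) y"
      unfolding D [symmetric] ev ..
    finally show "evl (\<beta>' t - \<beta>' s) y = evl (LINT r:{s<..t}|lborel. v' r) y"
      by (simp add: evl_diff)
  qed
qed

lemma H1_\<nu>: "H1_path (\<lambda>t. B_map \<epsilon> evl (\<nu> t))"
  and weak_deriv_\<nu>: "AE t in lborel. t \<in> {0<..<1} \<longrightarrow> weak_deriv (\<lambda>t. B_map \<epsilon> evl (\<nu> t)) t = v' t"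
proof -
  have 1: "ac_path (\<lambda>t. B_map \<epsilon> evl (\<nu> t)) v'"
    by (rule ac_path_cong [OF ac_\<beta>' B_\<nu>])
  have 2: "continuous_on {0..1} (\<lambda>t. B_map \<epsilon> evl (\<nu> t))"
    by (subst continuous_on_cong [OF refl B_\<nu>]) (auto intro: continuous_\<beta>')
  show "H1_path (\<lambda>t. B_map \<epsilon> evl (\<nu> t))"
    "AE t in lborel. t \<in> {0<..<1} \<longrightarrow> weak_deriv (\<lambda>t. B_map \<epsilon> evl (\<nu> t)) t = v' t"
    by (rule ac_path_H1 [OF 1 2 L2_v'])+
qed

lemma admissible_\<nu>: "admissible \<epsilon> evl \<nu>"
  unfolding admissible_def
proof (intro conjI H1_\<nu> ballI)
  show "borel_prob (\<nu> t)" if "t \<in> {0..1}" for t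
    using admissible that by (simp add: \<nu> borel_prob_translate admissible_def)
  obtain S where S: "bounded S" "\<And>t. t \<in> {0..1} \<Longrightarrow> AE x in \<mu> t. x \<in> S"
    using admissible by (auto simp: admissible_def)
  obtain R where R: "\<And>x. x \<in> S \<Longrightarrow> norm x \<le> R"
    using S(1) by (meson bounded_iff)
  let ?C = "cball 0 (R + (norm p + norm w)) :: 'a set"
  have "AE x in \<nu> t. x \<in> ?C" if t: "t \<in> {0..1}" for t
  proof -
    have "AE x in \<mu> t. x + (p + t *\<^sub>R w) \<in> ?C"
      using S(2) [OF t]
    proof eventually_elim
      case (elim x)
      have "norm (t *\<^sub>R w) \<le> norm w" using t by (simp add: mult_left_le_one_le)
      then have "norm (x + (p + t *\<^sub>R w)) \<le> R + (norm p + norm w)"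
        using R [OF elim] by (intro norm_triangle_mono) auto
      then show ?case by simp
    qed
    moreover have "(\<lambda>x. x + (p + t *\<^sub>R w)) \<in> \<mu> t \<rightarrow>\<^sub>M borel"
      using admissible t by (simp add: measurable_cong_sets [of "\<mu> t" borel borel borel] admissible_def borel_prob_def)
    ultimately show ?thesis
      unfolding \<nu> [OF t] by (subst AE_distr_iff) auto
  qed
  then show "\<exists>S. bounded S \<and> (\<forall>t\<in>{0..1}. AE x in \<nu> t. x \<in> S)"
    by (intro exI [of _ ?C]) simp
qed

text \<open>At almost every time the metric is first pulled back by the unitary shift and then
  expanded in \<open>\<Gamma>t\<close>; the cross term integrates to the change of the mean. The
  sign condition on \<open>R\<close> suits \<open>ennreal\<close>, and holds for lifted centered
  paths, whose means agree at both ends.\<close>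

lemma energy_\<nu>:
  assumes R: "R = 2 * inner w ((LINT x|\<mu> 1. x) - (LINT x|\<mu> 0. x)) + (norm w)\<^sup>2" "R \<ge> 0"
  shows "energy \<epsilon> evl \<nu> = energy \<epsilon> evl \<mu> + ennreal R"
  unfolding energy_def
proof (rule nn_integral_add_signed [where \<rho> = "\<lambda>t. 2 * inner (Mt w t + Nt w t) (v t) + (norm w)\<^sup>2"])
  show "AE t in lborel. t \<in> {0<..<1} \<longrightarrow>
      g_tilde \<epsilon> evl (\<nu> t) (weak_deriv (\<lambda>s. B_map \<epsilon> evl (\<nu> s)) t) =
      g_tilde \<epsilon> evl (\<mu> t) (weak_deriv (\<lambda>s. B_map \<epsilon> evl (\<mu> s)) t) + (2 * inner (Mt w t + Nt w t) (v t) + (norm w)\<^sup>2) \<and>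
      0 \<le> g_tilde \<epsilon> evl (\<mu> t) (weak_deriv (\<lambda>s. B_map \<epsilon> evl (\<mu> s)) t) \<and>
      0 \<le> g_tilde \<epsilon> evl (\<nu> t) (weak_deriv (\<lambda>s. B_map \<epsilon> evl (\<nu> s)) t)"
    using v_orthogonal weak_deriv_\<nu>
  proof eventually_elim
    case (elim t)
    show ?case
    proof
      assume t: "t \<in> {0<..<1}"
      then have t': "t \<in> {0..1}" by auto
      interpret tr: translated_prob \<epsilon> evl "\<mu> t" "q t"
        by (rule translated_prob_at [OF t'])
      have orth: "inner (v t) tr.B = 0" using elim t by (simp add: \<beta>_def)
      have orth': "inner (v t + \<Gamma>t w t) tr.B = 0"
        using orth tr.inner_\<Gamma>_B by (simp add: inner_add_left \<Gamma>t_def)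
      have wd: "weak_deriv (\<lambda>s. B_map \<epsilon> evl (\<nu> s)) t = shift (q t) (v t + \<Gamma>t w t)"
        using elim t by (simp add: v'_def)
      have wd0: "weak_deriv (\<lambda>s. B_map \<epsilon> evl (\<mu> s)) t = v t"
        by (simp add: v_def \<beta>_def [abs_def])
      have nonneg: "g_tilde \<epsilon> evl (\<mu> t) h \<ge> 0" if "inner h tr.B = 0" for h
        using tr.g_tilde_ge [OF that] eps_pos
        by (meson order_trans mult_nonneg_nonneg half_gt_zero less_imp_le zero_le_power2)
      have "g_tilde \<epsilon> evl (\<nu> t) (shift (q t) (v t + \<Gamma>t w t)) = g_tilde \<epsilon> evl (\<mu> t) (v t + \<Gamma>t w t)"
        unfolding \<nu>_eq [OF t'] by (rule tr.g_tilde_translate [OF orth'])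
      moreover have "g_tilde \<epsilon> evl (\<mu> t) (v t + \<Gamma>t w t) =
          g_tilde \<epsilon> evl (\<mu> t) (v t) + (2 * inner (Mt w t + Nt w t) (v t) + (norm w)\<^sup>2)"
        using tr.g_tilde_add_\<Gamma> [OF orth, of w] by (simp add: Mt_def Nt_def \<Gamma>t_def)
      ultimately show "g_tilde \<epsilon> evl (\<nu> t) (weak_deriv (\<lambda>s. B_map \<epsilon> evl (\<nu> s)) t) =
          g_tilde \<epsilon> evl (\<mu> t) (weak_deriv (\<lambda>s. B_map \<epsilon> evl (\<mu> s)) t) + (2 * inner (Mt w t + Nt w t) (v t) + (norm w)\<^sup>2) \<and>
          0 \<le> g_tilde \<epsilon> evl (\<mu> t) (weak_deriv (\<lambda>s. B_map \<epsilon> evl (\<mu> s)) t) \<and>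
          0 \<le> g_tilde \<epsilon> evl (\<nu> t) (weak_deriv (\<lambda>s. B_map \<epsilon> evl (\<nu> s)) t)"
        unfolding wd wd0 using nonneg [OF orth] nonneg [OF orth'] by simp
    qed
  qed
  have i1: "set_integrable lborel {0<..<1} (\<lambda>t. inner (Mt w t + Nt w t) (v t))"
    by (rule set_integrable_01_open [OF ac_path_integrable [OF ac_path_mean]])
  have i2: "set_integrable lborel {0<..<1} (\<lambda>t :: real. (norm w)\<^sup>2)"
    unfolding set_integrable_def by (rule integrable_scaleR_left) auto
  have i1': "set_integrable lborel {0<..<1} (\<lambda>t. 2 * inner (Mt w t + Nt w t) (v t))"
    using i1 by simp
  show "set_integrable lborel {0<..<1} (\<lambda>t. 2 * inner (Mt w t + Nt w t) (v t) + (norm w)\<^sup>2)"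
    by (rule set_integral_add(1) [OF i1' i2])
  have "(LINT t:{0<..<1}|lborel. inner (Mt w t + Nt w t) (v t)) = inner w (LINT x|\<mu> 1. x) - inner w (LINT x|\<mu> 0. x)"
    using ac_pathD [OF ac_path_mean, of 0 1 w] by (simp only: set_integral_endpoints(2))
  moreover have "(LINT t:{0<..<1::real}|lborel. (norm w)\<^sup>2) = (norm w)\<^sup>2"
    by (simp add: set_lebesgue_integral_def)
  ultimately show "(LINT t:{0<..<1}|lborel. 2 * inner (Mt w t + Nt w t) (v t) + (norm w)\<^sup>2) = R"
    unfolding set_integral_add(2) [OF i1' i2] by (simp add: R inner_diff_right)
qed (rule R(2))

end

section \<open>The decomposition\<close>

lemma measurable_translate_borel:
  fixes \<mu> :: "'a::euclidean_space measure"
  assumes "borel_prob \<mu>"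
  shows "(\<lambda>x. x + p) \<in> \<mu> \<rightarrow>\<^sub>M borel"
  using assms by (simp add: measurable_cong_sets [of \<mu> borel borel borel] borel_prob_def)

lemma distr_translate_translate:
  fixes \<mu> :: "'a::euclidean_space measure"
  assumes "borel_prob \<mu>"
  shows "distr (distr \<mu> borel (\<lambda>x. x + p)) borel (\<lambda>x. x + r) = distr \<mu> borel (\<lambda>x. x + (p + r))"
  using distr_distr [OF _ measurable_translate_borel [OF assms, of p], of "\<lambda>x. x + r" borel]
  by (simp add: o_def add.assoc)

lemma distr_translate_0:
  fixes \<mu> :: "'a::euclidean_space measure"
  assumes "borel_prob \<mu>"
  shows "distr \<mu> borel (\<lambda>x. x + 0) = \<mu>"
  using assms by (simp add: borel_prob_def distr_id2)

lemma integral_id_translate: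
  fixes \<mu> :: "'a::euclidean_space measure"
  assumes \<mu>: "borel_prob \<mu>" "bounded_support \<mu>"
  shows "(LINT x|distr \<mu> borel (\<lambda>x. x + p). x) = (LINT x|\<mu>. x) + p"
proof -
  interpret prob_space \<mu> using \<mu> by (simp add: borel_prob_def)
  have "(LINT x|distr \<mu> borel (\<lambda>x. x + p). x) = (LINT x|\<mu>. x + p)"
    by (rule integral_distr [OF measurable_translate_borel [OF \<mu>(1)]]) simp
  also have "\<dots> = (LINT x|\<mu>. x) + p"
    using integrable_continuous_bounded_support [OF \<mu> continuous_on_id] by (simp add: prob_space)
  finally show ?thesis .
qed

lemma power2_ennreal_sqrt: "(ennreal_sqrt z)\<^sup>2 = z"
proof (cases z)
  case (real r)
  then have "(ennreal (sqrt r))\<^sup>2 = ennreal ((sqrt r)\<^sup>2)"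
    by (subst ennreal_power) auto
  then show ?thesis using real by (simp add: ennreal_sqrt_def)
next
  case top
  then show ?thesis by (simp add: ennreal_sqrt_def power2_eq_square ennreal_top_mult)
qed

lemma ennreal_le_ennreal_sqrt:
  assumes "ennreal (r\<^sup>2) \<le> z" "r \<ge> 0"
  shows "ennreal r \<le> ennreal_sqrt z"
proof (cases z)
  case (real s)
  then have "r\<^sup>2 \<le> s" using assms by simp
  then have "r \<le> sqrt s" by (rule real_le_rsqrt)
  then show ?thesis using real by (simp add: ennreal_sqrt_def ennreal_leI)
qed (simp add: ennreal_sqrt_def)

lemma ennreal_sqrt_power2: "r \<ge> 0 \<Longrightarrow> ennreal_sqrt (ennreal (r\<^sup>2)) = ennreal r"
  by (simp add: ennreal_sqrt_def)

section \<open>Constant paths and vanishing energy\<close>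

context gaussian_rkhs
begin

lemma admissible_energy_const:
  assumes \<mu>: "borel_prob \<mu>" "bounded_support \<mu>"
  shows "admissible \<epsilon> evl (\<lambda>t. \<mu>)" "energy \<epsilon> evl (\<lambda>t. \<mu>) = 0"
proof -
  interpret bounded_prob \<epsilon> evl \<mu> using \<mu> by unfold_locales
  have ac: "ac_path (\<lambda>t. B) (\<lambda>t. 0)"
    by (simp add: ac_path_def set_integrable_def)
  have c: "continuous_on {0..1::real} (\<lambda>t. B)" "L2_path (\<lambda>t. 0 :: 'h)"
    by (auto intro: continuous_imp_L2_path)
  note H = ac_path_H1 [OF ac c]
  show "admissible \<epsilon> evl (\<lambda>t. \<mu>)"
    using \<mu> H(1) by (auto simp: admissible_def bounded_support_def)
  have g0: "g_tilde \<epsilon> evl \<mu> 0 = 0"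
  proof -
    have "T 0 = 0" using T_scaleR [of 0 0] by simp
    then show ?thesis using g_tilde_eq [of 0 0] by simp
  qed
  have "energy \<epsilon> evl (\<lambda>t. \<mu>) = (\<integral>\<^sup>+t. 0 \<partial>(lborel :: real measure))"
    unfolding energy_def
  proof (rule nn_integral_cong_AE)
    show "AE t in lborel. ennreal (g_tilde \<epsilon> evl \<mu> (weak_deriv (\<lambda>s. B) t)) * indicator {0<..<1} t = 0"
      using H(2) by eventually_elim (auto simp: g0 split: split_indicator)
  qed
  then show "energy \<epsilon> evl (\<lambda>t. \<mu>) = 0" by simp
qed

abbreviation (input) inf_energy :: "'a measure \<Rightarrow> 'a measure \<Rightarrow> ennreal" where
  "inf_energy \<mu> \<nu> \<equiv> (INF \<kappa>\<in>admissible_between \<epsilon> evl \<mu> \<nu>. energy \<epsilon> evl \<kappa>)"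

lemma zero_energy_imp_const:
  assumes "admissible \<epsilon> evl \<mu>" "energy \<epsilon> evl \<mu> = 0" "t \<in> {0..1}"
  shows "\<mu> t = \<mu> 0"
proof -
  interpret admissible_path \<epsilon> evl \<mu> using assms(1) by unfold_locales
  interpret t: bounded_prob \<epsilon> evl "\<mu> t" by (rule bounded_prob_at [OF assms(3)])
  interpret t0: bounded_prob \<epsilon> evl "\<mu> 0" by (rule bounded_prob_at) simp
  have "ennreal (\<epsilon> / 2 * (norm (\<beta> t - \<beta> 0))\<^sup>2) \<le> 0"
    using energy_lower_bound [of 0 t] assms by simp
  then have "\<epsilon> / 2 * (norm (\<beta> t - \<beta> 0))\<^sup>2 \<le> 0"
    by (simp add: ennreal_eq_0_iff)
  then have "\<beta> t = \<beta> 0"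
    using eps_pos by (simp add: mult_le_0_iff)
  then show ?thesis
    by (intro B_map_inj t.borel_prob t.bounded_support t0.borel_prob t0.bounded_support)
      (simp add: \<beta>_def)
qed

lemma inf_energy_0_imp_eq:
  assumes \<mu>: "borel_prob \<mu>" "bounded_support \<mu>" and \<nu>: "borel_prob \<nu>" "bounded_support \<nu>"
    and 0: "inf_energy \<mu> \<nu> = 0"
  shows "\<mu> = \<nu>"
proof -
  let ?\<Delta> = "ennreal (\<epsilon> / 2 * (norm (B_map \<epsilon> evl \<nu> - B_map \<epsilon> evl \<mu>))\<^sup>2)"
  have "?\<Delta> \<le> inf_energy \<mu> \<nu>"
  proof (rule INF_greatest)
    fix \<kappa> assume \<kappa>: "\<kappa> \<in> admissible_between \<epsilon> evl \<mu> \<nu>"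
    then interpret admissible_path \<epsilon> evl \<kappa>
      by unfold_locales (simp add: admissible_between_def)
    show "?\<Delta> \<le> energy \<epsilon> evl \<kappa>"
      using energy_lower_bound [of 0 1] \<kappa> by (simp add: \<beta>_def admissible_between_def)
  qed
  then have "\<epsilon> / 2 * (norm (B_map \<epsilon> evl \<nu> - B_map \<epsilon> evl \<mu>))\<^sup>2 \<le> 0"
    unfolding 0 by (simp add: ennreal_eq_0_iff)
  then have "B_map \<epsilon> evl \<nu> = B_map \<epsilon> evl \<mu>"
    using eps_pos by (simp add: mult_le_0_iff)
  then show ?thesis
    using B_map_inj [OF \<mu> \<nu>] by simp
qed

end

section \<open>Lifting and centering paths between two given measures\<close>

locale two_measures = gaussian_rkhs \<epsilon> evl
  for \<epsilon> :: real
    and evl :: "'h::{real_inner,banach,second_countable_topology} \<Rightarrow> 'a::euclidean_space \<Rightarrow> real" +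
  fixes \<mu>\<^sub>0 \<mu>\<^sub>1 :: "'a measure"
  assumes \<mu>\<^sub>0: "borel_prob \<mu>\<^sub>0" "bounded_support \<mu>\<^sub>0" and \<mu>\<^sub>1: "borel_prob \<mu>\<^sub>1" "bounded_support \<mu>\<^sub>1"
begin

definition m\<^sub>0 :: 'a where "m\<^sub>0 = (LINT x|\<mu>\<^sub>0. x)"
definition m\<^sub>1 :: 'a where "m\<^sub>1 = (LINT x|\<mu>\<^sub>1. x)"
definition w :: 'a where "w = m\<^sub>1 - m\<^sub>0"
definition c\<^sub>0 :: "'a measure" where "c\<^sub>0 = distr \<mu>\<^sub>0 borel (\<lambda>x. x + (- m\<^sub>0))"
definition c\<^sub>1 :: "'a measure" where "c\<^sub>1 = distr \<mu>\<^sub>1 borel (\<lambda>x. x + (- m\<^sub>1))"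

lemma centered:
  "borel_prob c\<^sub>0" "bounded_support c\<^sub>0" "borel_prob c\<^sub>1" "bounded_support c\<^sub>1"
  "(LINT x|c\<^sub>0. x) = 0" "(LINT x|c\<^sub>1. x) = 0"
proof -
  have "translated_prob \<epsilon> evl \<mu>\<^sub>0" "translated_prob \<epsilon> evl \<mu>\<^sub>1"
    using \<mu>\<^sub>0 \<mu>\<^sub>1 by unfold_locales
  note tr = this
  show "bounded_support c\<^sub>0" "bounded_support c\<^sub>1"
    using translated_prob.bounded_support_translate [OF tr(1), of "- m\<^sub>0"]
      translated_prob.bounded_support_translate [OF tr(2), of "- m\<^sub>1"]
    by (simp_all add: translated_prob.\<nu>_def [OF tr(1)] translated_prob.\<nu>_def [OF tr(2)] c\<^sub>0_def c\<^sub>1_def)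
  show "borel_prob c\<^sub>0" "borel_prob c\<^sub>1"
    unfolding c\<^sub>0_def c\<^sub>1_def by (intro borel_prob_translate \<mu>\<^sub>0 \<mu>\<^sub>1)+
  show "(LINT x|c\<^sub>0. x) = 0" "(LINT x|c\<^sub>1. x) = 0"
    unfolding c\<^sub>0_def c\<^sub>1_def integral_id_translate [OF \<mu>\<^sub>0] integral_id_translate [OF \<mu>\<^sub>1]
    by (simp_all add: m\<^sub>0_def m\<^sub>1_def)
qed

lemma uncentered: "distr c\<^sub>0 borel (\<lambda>x. x + (m\<^sub>0 + r)) = distr \<mu>\<^sub>0 borel (\<lambda>x. x + r)"
  "distr c\<^sub>1 borel (\<lambda>x. x + (m\<^sub>1 + r)) = distr \<mu>\<^sub>1 borel (\<lambda>x. x + r)"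
  unfolding c\<^sub>0_def c\<^sub>1_def distr_translate_translate [OF \<mu>\<^sub>0(1)] distr_translate_translate [OF \<mu>\<^sub>1(1)]
  by simp_all

definition lift :: "(real \<Rightarrow> 'a measure) \<Rightarrow> real \<Rightarrow> 'a measure" where
  "lift \<kappa> t = distr (\<kappa> t) borel (\<lambda>x. x + (m\<^sub>0 + t *\<^sub>R w))"

definition center :: "(real \<Rightarrow> 'a measure) \<Rightarrow> real \<Rightarrow> 'a measure" where
  "center \<kappa> t = distr (\<kappa> t) borel (\<lambda>x. x + (- m\<^sub>0 + t *\<^sub>R (- w)))"

text \<open>Equality with the lift is demanded on the unit interval only: a path is a function on
  all of \<open>real\<close>, and its values outside are arbitrary, so a centered and re-lifted path
  need not agree with the original there.\<close>

lemma energy_of_lift: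
  assumes \<kappa>: "\<kappa> \<in> admissible_between \<epsilon> evl c\<^sub>0 c\<^sub>1" and \<nu>: "\<And>t. t \<in> {0..1} \<Longrightarrow> \<nu> t = lift \<kappa> t"
  shows "energy \<epsilon> evl \<nu> = energy \<epsilon> evl \<kappa> + ennreal ((norm w)\<^sup>2)"
proof -
  interpret translated_path \<epsilon> evl \<kappa> \<nu> m\<^sub>0 w
    using \<kappa> \<nu> by unfold_locales (auto simp: admissible_between_def lift_def)
  show ?thesis
    using \<kappa> by (intro energy_\<nu>) (auto simp: admissible_between_def centered)
qed

lemma lift_admissible:
  assumes \<kappa>: "\<kappa> \<in> admissible_between \<epsilon> evl c\<^sub>0 c\<^sub>1"
  shows "lift \<kappa> \<in> admissible_between \<epsilon> evl \<mu>\<^sub>0 \<mu>\<^sub>1"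
proof -
  interpret translated_path \<epsilon> evl \<kappa> "lift \<kappa>" m\<^sub>0 w
    using \<kappa> by unfold_locales (auto simp: admissible_between_def lift_def)
  have "lift \<kappa> 0 = \<mu>\<^sub>0" "lift \<kappa> 1 = \<mu>\<^sub>1"
    using \<kappa> uncentered(1) [of 0] uncentered(2) [of 0] distr_translate_0 [OF \<mu>\<^sub>0(1)] distr_translate_0 [OF \<mu>\<^sub>1(1)]
    by (simp_all add: lift_def admissible_between_def w_def)
  then show ?thesis
    using admissible_\<nu> by (simp add: admissible_between_def)
qed

lemma center_admissible:
  assumes \<nu>: "\<nu> \<in> admissible_between \<epsilon> evl \<mu>\<^sub>0 \<mu>\<^sub>1"
  shows "center \<nu> \<in> admissible_between \<epsilon> evl c\<^sub>0 c\<^sub>1"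
proof -
  have ends: "\<nu> 0 = \<mu>\<^sub>0" "\<nu> 1 = \<mu>\<^sub>1"
    using \<nu> by (auto simp: admissible_between_def)
  have "center \<nu> 0 = c\<^sub>0" "center \<nu> 1 = c\<^sub>1"
    by (simp_all add: ends center_def w_def c\<^sub>0_def c\<^sub>1_def)
  moreover interpret translated_path \<epsilon> evl \<nu> "center \<nu>" "- m\<^sub>0" "- w"
    using \<nu> by unfold_locales (auto simp: admissible_between_def center_def)
  have "admissible \<epsilon> evl (center \<nu>)"
    by (rule admissible_\<nu>)
  ultimately show ?thesis
    by (simp add: admissible_between_def)
qed

lemma lift_center:
  assumes \<nu>: "\<nu> \<in> admissible_between \<epsilon> evl \<mu>\<^sub>0 \<mu>\<^sub>1" and t: "t \<in> {0..1}"
  shows "\<nu> t = lift (center \<nu>) t"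
proof -
  have "borel_prob (\<nu> t)"
    using \<nu> t by (auto simp: admissible_between_def admissible_def)
  then show ?thesis
    using distr_translate_0 [of "\<nu> t"] by (simp add: lift_def center_def distr_translate_translate)
qed

lemma energy_eq_center:
  assumes "\<nu> \<in> admissible_between \<epsilon> evl \<mu>\<^sub>0 \<mu>\<^sub>1"
  shows "energy \<epsilon> evl \<nu> = energy \<epsilon> evl (center \<nu>) + ennreal ((norm w)\<^sup>2)"
  by (rule energy_of_lift [OF center_admissible [OF assms] lift_center [OF assms]])

lemma inf_energy_decomposition:
  "inf_energy \<mu>\<^sub>0 \<mu>\<^sub>1 = ennreal ((norm w)\<^sup>2) + inf_energy c\<^sub>0 c\<^sub>1"
proof (rule antisym)
  \<comment> \<open>Truncated subtraction isolates the infimum over centered paths, so it suffices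
    to treat each path separately; an empty set of paths, with infimum \<open>\<infinity>\<close>,
    is covered as well.\<close>
  have "inf_energy \<mu>\<^sub>0 \<mu>\<^sub>1 - ennreal ((norm w)\<^sup>2) \<le> inf_energy c\<^sub>0 c\<^sub>1"
  proof (rule INF_greatest)
    fix \<kappa> assume \<kappa>: "\<kappa> \<in> admissible_between \<epsilon> evl c\<^sub>0 c\<^sub>1"
    have "inf_energy \<mu>\<^sub>0 \<mu>\<^sub>1 \<le> energy \<epsilon> evl (lift \<kappa>)"
      by (rule INF_lower [OF lift_admissible [OF \<kappa>]])
    also have "\<dots> = energy \<epsilon> evl \<kappa> + ennreal ((norm w)\<^sup>2)"
      by (rule energy_of_lift [OF \<kappa> refl])
    finally show "inf_energy \<mu>\<^sub>0 \<mu>\<^sub>1 - ennreal ((norm w)\<^sup>2) \<le> energy \<epsilon> evl \<kappa>"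
      by (simp add: ennreal_minus_le_iff add.commute)
  qed
  then show "inf_energy \<mu>\<^sub>0 \<mu>\<^sub>1 \<le> ennreal ((norm w)\<^sup>2) + inf_energy c\<^sub>0 c\<^sub>1"
    by (simp add: ennreal_minus_le_iff)
  show "ennreal ((norm w)\<^sup>2) + inf_energy c\<^sub>0 c\<^sub>1 \<le> inf_energy \<mu>\<^sub>0 \<mu>\<^sub>1"
  proof (rule INF_greatest)
    fix \<nu> assume \<nu>: "\<nu> \<in> admissible_between \<epsilon> evl \<mu>\<^sub>0 \<mu>\<^sub>1"
    have "inf_energy c\<^sub>0 c\<^sub>1 \<le> energy \<epsilon> evl (center \<nu>)"
      by (rule INF_lower [OF center_admissible [OF \<nu>]])
    then show "ennreal ((norm w)\<^sup>2) + inf_energy c\<^sub>0 c\<^sub>1 \<le> energy \<epsilon> evl \<nu>"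
      unfolding energy_eq_center [OF \<nu>] by (simp add: add.commute add_left_mono)
  qed
qed

lemma d_S_decomposition:
  "(d_S \<epsilon> evl \<mu>\<^sub>0 \<mu>\<^sub>1)\<^sup>2 = ennreal ((norm w)\<^sup>2) + (d_S \<epsilon> evl c\<^sub>0 c\<^sub>1)\<^sup>2"
  unfolding d_S_def power2_ennreal_sqrt by (rule inf_energy_decomposition)

lemma d_S_ge: "ennreal (norm w) \<le> d_S \<epsilon> evl \<mu>\<^sub>0 \<mu>\<^sub>1"
  unfolding d_S_def by (intro ennreal_le_ennreal_sqrt) (simp_all add: inf_energy_decomposition)

lemma constant_path: "(\<lambda>t. c\<^sub>0) \<in> admissible_between \<epsilon> evl c\<^sub>0 c\<^sub>0" "energy \<epsilon> evl (\<lambda>t. c\<^sub>0) = 0"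
  using admissible_energy_const [OF centered(1,2)] by (auto simp: admissible_between_def)

lemma inf_energy_centered_eq_0_iff: "inf_energy c\<^sub>0 c\<^sub>1 = 0 \<longleftrightarrow> c\<^sub>0 = c\<^sub>1"
proof
  show "c\<^sub>0 = c\<^sub>1" if "inf_energy c\<^sub>0 c\<^sub>1 = 0"
    by (rule inf_energy_0_imp_eq [OF centered(1-4) that])
  show "inf_energy c\<^sub>0 c\<^sub>1 = 0" if "c\<^sub>0 = c\<^sub>1"
    using INF_lower [OF constant_path(1), of "energy \<epsilon> evl"] constant_path(2) that by simp
qed

lemma centered_eq_iff: "c\<^sub>0 = c\<^sub>1 \<longleftrightarrow> (\<exists>v. \<mu>\<^sub>1 = distr \<mu>\<^sub>0 borel (\<lambda>x. x + v))"
proof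
  assume "c\<^sub>0 = c\<^sub>1"
  then have "\<mu>\<^sub>1 = distr c\<^sub>0 borel (\<lambda>x. x + (m\<^sub>0 + w))"
    using uncentered(2) [of 0] distr_translate_0 [OF \<mu>\<^sub>1(1)] by (simp add: w_def)
  then show "\<exists>v. \<mu>\<^sub>1 = distr \<mu>\<^sub>0 borel (\<lambda>x. x + v)"
    unfolding uncentered by blast
next
  assume "\<exists>v. \<mu>\<^sub>1 = distr \<mu>\<^sub>0 borel (\<lambda>x. x + v)"
  then obtain v where v: "\<mu>\<^sub>1 = distr \<mu>\<^sub>0 borel (\<lambda>x. x + v)" by blast
  \<comment> \<open>Comparing means forces the translation vector to be the difference of the
    means.\<close>
  have "(LINT x|\<mu>\<^sub>1. x) = (LINT x|\<mu>\<^sub>0. x) + v"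
    by (subst v) (rule integral_id_translate [OF \<mu>\<^sub>0])
  then have m: "v + - m\<^sub>1 = - m\<^sub>0"
    by (simp add: m\<^sub>0_def m\<^sub>1_def)
  have "distr (distr \<mu>\<^sub>0 borel (\<lambda>x. x + v)) borel (\<lambda>x. x + - m\<^sub>1) = c\<^sub>0"
    unfolding distr_translate_translate [OF \<mu>\<^sub>0(1)] m c\<^sub>0_def ..
  then show "c\<^sub>0 = c\<^sub>1"
    by (simp only: v [symmetric] c\<^sub>1_def)
qed

lemma d_S_eq_iff: "d_S \<epsilon> evl \<mu>\<^sub>0 \<mu>\<^sub>1 = ennreal (norm w) \<longleftrightarrow> c\<^sub>0 = c\<^sub>1"
proof
  assume "d_S \<epsilon> evl \<mu>\<^sub>0 \<mu>\<^sub>1 = ennreal (norm w)"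
  then have "ennreal ((norm w)\<^sup>2) = ennreal ((norm w)\<^sup>2) + inf_energy c\<^sub>0 c\<^sub>1"
    using d_S_decomposition by (simp add: ennreal_power d_S_def power2_ennreal_sqrt)
  then have "ennreal ((norm w)\<^sup>2) + 0 = ennreal ((norm w)\<^sup>2) + inf_energy c\<^sub>0 c\<^sub>1" by simp
  then have "0 = inf_energy c\<^sub>0 c\<^sub>1"
    unfolding ennreal_add_left_cancel by simp
  then show "c\<^sub>0 = c\<^sub>1"
    using inf_energy_centered_eq_0_iff by simp
next
  assume "c\<^sub>0 = c\<^sub>1"
  then have "inf_energy \<mu>\<^sub>0 \<mu>\<^sub>1 = ennreal ((norm w)\<^sup>2)"
    using inf_energy_decomposition inf_energy_centered_eq_0_iff by simp
  then show "d_S \<epsilon> evl \<mu>\<^sub>0 \<mu>\<^sub>1 = ennreal (norm w)"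
    by (simp add: d_S_def ennreal_sqrt_power2)
qed

lemma lift_constant: "lift (\<lambda>t. c\<^sub>0) = (\<lambda>t. distr \<mu>\<^sub>0 borel (\<lambda>x. x + t *\<^sub>R w))"
  unfolding lift_def by (simp only: uncentered)

lemma translation_geodesic:
  assumes eq: "c\<^sub>0 = c\<^sub>1"
  shows "is_geodesic \<epsilon> evl \<mu>\<^sub>0 \<mu>\<^sub>1 (\<lambda>t. distr \<mu>\<^sub>0 borel (\<lambda>x. x + t *\<^sub>R w))"
proof -
  have c: "(\<lambda>t. c\<^sub>0) \<in> admissible_between \<epsilon> evl c\<^sub>0 c\<^sub>1"
    using constant_path(1) eq by simp
  show ?thesis
    unfolding is_geodesic_def lift_constant [symmetric]
    using lift_admissible [OF c] energy_of_lift [OF c refl] constant_path(2)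
      inf_energy_decomposition inf_energy_centered_eq_0_iff eq
    by simp
qed

lemma geodesic_unique:
  assumes eq: "c\<^sub>0 = c\<^sub>1" and \<nu>: "is_geodesic \<epsilon> evl \<mu>\<^sub>0 \<mu>\<^sub>1 \<nu>" and t: "t \<in> {0..1}"
  shows "\<nu> t = distr \<mu>\<^sub>0 borel (\<lambda>x. x + t *\<^sub>R w)"
proof -
  have \<nu>a: "\<nu> \<in> admissible_between \<epsilon> evl \<mu>\<^sub>0 \<mu>\<^sub>1"
    using \<nu> by (simp add: is_geodesic_def)
  note c = center_admissible [OF \<nu>a]
  have "energy \<epsilon> evl (center \<nu>) + ennreal ((norm w)\<^sup>2) = ennreal ((norm w)\<^sup>2)"
    using \<nu> inf_energy_decomposition inf_energy_centered_eq_0_iff eq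
    unfolding is_geodesic_def energy_eq_center [OF \<nu>a, symmetric] by simp
  then have "ennreal ((norm w)\<^sup>2) + energy \<epsilon> evl (center \<nu>) = ennreal ((norm w)\<^sup>2) + 0"
    by (simp add: add.commute)
  then have "energy \<epsilon> evl (center \<nu>) = 0"
    unfolding ennreal_add_left_cancel by simp
  then have "center \<nu> t = center \<nu> 0"
    using c by (intro zero_energy_imp_const [OF _ _ t]) (auto simp: admissible_between_def)
  then have "center \<nu> t = c\<^sub>0"
    using c by (simp add: admissible_between_def)
  then have "\<nu> t = lift (\<lambda>t. c\<^sub>0) t"
    using lift_center [OF \<nu>a t] by (simp add: lift_def)
  then show ?thesis by (simp add: lift_constant)
qed

end

theorem theorem5p15:
  fixes \<epsilon> :: real
    and evl :: "'h::{real_inner,banach,second_countable_topology} \<Rightarrow> 'a::euclidean_space \<Rightarrow> real"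
    and \<mu>\<^sub>0 \<mu>\<^sub>1 :: "'a measure"
    and m\<^sub>0 m\<^sub>1 :: 'a
  assumes "\<epsilon> > 0"
    and "is_rkhs evl (k_c \<epsilon>)"
    and "borel_prob \<mu>\<^sub>0" and "bounded_support \<mu>\<^sub>0" and "m\<^sub>0 = (LINT x|\<mu>\<^sub>0. x)"
    and "borel_prob \<mu>\<^sub>1" and "bounded_support \<mu>\<^sub>1" and "m\<^sub>1 = (LINT x|\<mu>\<^sub>1. x)"
  shows "(d_S \<epsilon> evl \<mu>\<^sub>0 \<mu>\<^sub>1)\<^sup>2 =
           ennreal ((norm (m\<^sub>1 - m\<^sub>0))\<^sup>2) +
           (d_S \<epsilon> evl (distr \<mu>\<^sub>0 borel (\<lambda>x. x - m\<^sub>0)) (distr \<mu>\<^sub>1 borel (\<lambda>x. x - m\<^sub>1)))\<^sup>2 \<and>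
         d_S \<epsilon> evl \<mu>\<^sub>0 \<mu>\<^sub>1 \<ge> ennreal (norm (m\<^sub>1 - m\<^sub>0)) \<and>
         (d_S \<epsilon> evl \<mu>\<^sub>0 \<mu>\<^sub>1 = ennreal (norm (m\<^sub>1 - m\<^sub>0)) \<longleftrightarrow>
           (\<exists>v. \<mu>\<^sub>1 = distr \<mu>\<^sub>0 borel (\<lambda>x. x + v))) \<and>
         ((\<exists>v. \<mu>\<^sub>1 = distr \<mu>\<^sub>0 borel (\<lambda>x. x + v)) \<longrightarrow>
           is_geodesic \<epsilon> evl \<mu>\<^sub>0 \<mu>\<^sub>1 (\<lambda>t. distr \<mu>\<^sub>0 borel (\<lambda>x. x + t *\<^sub>R (m\<^sub>1 - m\<^sub>0))) \<and>
           (\<forall>\<nu>. is_geodesic \<epsilon> evl \<mu>\<^sub>0 \<mu>\<^sub>1 \<nu> \<longrightarrow>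
              (\<forall>t\<in>{0..1}. \<nu> t = distr \<mu>\<^sub>0 borel (\<lambda>x. x + t *\<^sub>R (m\<^sub>1 - m\<^sub>0)))))"
proof -
  interpret tm: two_measures \<epsilon> evl \<mu>\<^sub>0 \<mu>\<^sub>1
    using assms by unfold_locales
  have m: "m\<^sub>0 = tm.m\<^sub>0" "m\<^sub>1 = tm.m\<^sub>1"
    using assms by (simp_all add: tm.m\<^sub>0_def tm.m\<^sub>1_def)
  have w: "m\<^sub>1 - m\<^sub>0 = tm.w" by (simp add: tm.w_def m)
  have c: "distr \<mu>\<^sub>0 borel (\<lambda>x. x - m\<^sub>0) = tm.c\<^sub>0" "distr \<mu>\<^sub>1 borel (\<lambda>x. x - m\<^sub>1) = tm.c\<^sub>1"
    by (simp_all add: tm.c\<^sub>0_def tm.c\<^sub>1_def m)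
  show ?thesis
    unfolding w c tm.centered_eq_iff [symmetric]
    using tm.d_S_decomposition tm.d_S_ge tm.d_S_eq_iff tm.translation_geodesic tm.geodesic_unique
    by blast
qed

end
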